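(* Let $m\ge1$ be an integer and $c\in(0,\infty)$. For each $N$ let $X\in\mathcal H_A\otimes\mathcal H_B\otimes\mathcal H_C\otimes\mathcal H_D$ be a random tensor with i.i.d. standard complex Gaussian entries, where $\dim\mathcal H_A=N$, $\dim\mathcal H_B=\dim\mathcal H_C=m$ and $\dim\mathcal H_D=\lfloor cN\rfloor$, and let $W_{AB},W_{AC}$ be its marginals. Then the pair of random matrices $\left((mN)^{-1}W_{AB},(mN)^{-1}W_{AC}\right)$ converges in distribution, as $N\to\infty$, to a pair of non-commutative random variables $(x_{AB},x_{AC})$ having the following free cumulants: for every $p\ge1$ and every word $f\in\{AB,AC\}^p$, $$\kappa(x_{f(1)},x_{f(2)},\dots,x_{f(p)})=c\,m^{-\mathsf{alt}(f)},\qquad \mathsf{alt}(f):=\bigl|\{a\in\{1,\dots,p\}:f(a)\neq f(a+1)\}\bigr|,$$ where $f(p+1):=f(1)$. Equivalently, for any word $f\in\{AB,AC\}^p$, as $N\to\infty$, $$\mathbb E\operatorname{Tr}W_f=(1+o(1))\,(mN)^{p+1}\sum_{\alpha\in\mathrm{NC}(p)}c^{\#\alpha}\,m^{-\mathsf{alt}(f,\alpha)},$$ where $\mathsf{alt}(f,\alpha)=\bigl|\{a\in\{1,\dots,p\}:f(a)\neq f(\alpha(a))\}\bigr|$.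
   Context: A standard complex Gaussian variable has density $\frac1\pi e^{-|z|^2}$ on $\mathbb C$. The marginals are the partial traces $W_{AB}=[\mathrm{id}\otimes\mathrm{id}\otimes\operatorname{Tr}\otimes\operatorname{Tr}](XX^* )$ and $W_{AC}=[\mathrm{id}\otimes\operatorname{Tr}\otimes\mathrm{id}\otimes\operatorname{Tr}](XX^* )$; since $\mathcal H_B$ and $\mathcal H_C$ are both identified with $\mathbb C^m$, both are regarded as matrices on $\mathbb C^N\otimes\mathbb C^m$ and can be multiplied. For $f\in\{AB,AC\}^p$, $W_f:=W_{f(p)}\cdots W_{f(2)}W_{f(1)}$. $\mathrm{NC}(p)$ is the set of non-crossing partitions of $\{1,\dots,p\}$; $\#\alpha$ is the number of blocks. A non-crossing partition $\alpha$ is identified with the permutation whose cycles are its blocks, with the elements of each block in the (reversed) cyclic order inherited from $\{1,\dots,p\}$, i.e. a permutation with $\#\alpha+\#(\gamma\alpha)=p+1$ for $\gamma=(1\,2\cdots p)$ (the value of $\mathsf{alt}(f,\alpha)$ does not depend on which of the two cyclic orientations is chosen). Convergence in distribution means convergence of all mixed moments computed with $\mathbb E\frac1{mN}\operatorname{Tr}$. *)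

theory Defs
  imports
    "HOL-Probability.Probability"
    "HOL-Library.Landau_Symbols"
    "HOL-Library.Disjoint_Sets"
    "HOL-Library.Poly_Mapping"
    "Jordan_Normal_Form.Matrix"
begin

section \<open>Non-crossing partitions\<close>

definition noncrossing :: "nat set set \<Rightarrow> bool" where
  "noncrossing P \<longleftrightarrow>
     \<not> (\<exists>B\<in>P. \<exists>C\<in>P. B \<noteq> C \<and>
          (\<exists>i\<in>B. \<exists>j\<in>C. \<exists>k\<in>B. \<exists>l\<in>C. i < j \<and> j < k \<and> k < l))"

definition NC :: "nat \<Rightarrow> nat set set set" where
  "NC p = {P. partition_on {1..p} P \<and> noncrossing P}"

text \<open>
  The permutation attached to a partition: its cycles are the blocks, each traversed downwards,
  with the minimum of a block sent to its maximum. With the cycle \<open>\<gamma> = (1 2 ... p)\<close> this is the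
  orientation for which \<open>#\<alpha> + #(\<gamma> \<alpha>) = p + 1\<close> when \<open>\<alpha>\<close> is non-crossing.
\<close>

definition partition_perm :: "nat set set \<Rightarrow> nat \<Rightarrow> nat" where
  "partition_perm P a =
     (if a \<in> \<Union>P then
        (let B = (THE B. B \<in> P \<and> a \<in> B)
         in if a = Min B then Max B else Max {b \<in> B. b < a})
      else a)"

text \<open>The long cycle \<open>(1 2 ... p)\<close>, relevant only on \<open>{1..p}\<close>.\<close>

definition cyc :: "nat \<Rightarrow> nat \<Rightarrow> nat" where
  "cyc p a = (if a = p then 1 else a + 1)"

text \<open>
  \<open>alt p f \<sigma>\<close> counts the \<open>a\<close> with \<open>f a \<noteq> f (\<sigma> a)\<close>. Thus \<open>alt(f)\<close> is \<open>alt p f (cyc p)\<close>, and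
  \<open>alt(f, \<alpha>)\<close> is \<open>alt p f (partition_perm \<alpha>)\<close>.
\<close>

definition alt :: "nat \<Rightarrow> (nat \<Rightarrow> 'l) \<Rightarrow> (nat \<Rightarrow> nat) \<Rightarrow> nat" where
  "alt p f \<sigma> = card {a \<in> {1..p}. f a \<noteq> f (\<sigma> a)}"


section \<open>Non-commutative probability spaces and free cumulants\<close>

text \<open>A unital complex algebra with a linear functional \<open>\<phi>\<close> such that \<open>\<phi> 1 = 1\<close>.\<close>

locale nc_prob_space = vector_space scale
  for scale :: "complex \<Rightarrow> 'a::ring_1 \<Rightarrow> 'a" (infixr "*\<^sub>\<complex>" 75) +
  fixes \<phi> :: "'a \<Rightarrow> complex"
  assumes scale_mult_left: "(c *\<^sub>\<complex> x) * y = c *\<^sub>\<complex> (x * y)"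
    and scale_mult_right: "x * (c *\<^sub>\<complex> y) = c *\<^sub>\<complex> (x * y)"
    and phi_add: "\<phi> (x + y) = \<phi> x + \<phi> y"
    and phi_scale: "\<phi> (c *\<^sub>\<complex> x) = c * \<phi> x"
    and phi_one: "\<phi> 1 = 1"

definition sublist_at :: "'a list \<Rightarrow> nat set \<Rightarrow> 'a list" where
  "sublist_at xs B = map (\<lambda>i. xs ! (i - 1)) (sorted_list_of_set B)"

text \<open>
  \<open>free_cumulant \<phi> [x\<^sub>1, ..., x\<^sub>p]\<close> is \<open>\<kappa>(x\<^sub>1, ..., x\<^sub>p)\<close>: the moment-cumulant formula over \<open>NC p\<close>,
  solved for the term of the one-block partition; see \<open>moment_cumulant\<close> below.
\<close>

function free_cumulant :: "('a::monoid_mult \<Rightarrow> complex) \<Rightarrow> 'a list \<Rightarrow> complex" where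
  "free_cumulant \<phi> xs =
     \<phi> (prod_list xs)
       - (\<Sum>P \<in> NC (length xs) - {{{1..length xs}}}.
            \<Prod>B\<in>P. free_cumulant \<phi> (sublist_at xs B))"
  by pat_completeness auto
termination
proof (relation "Wellfounded.measure (\<lambda>(\<phi>, xs). length xs)", goal_cases)
  case (2 \<phi> xs P B)
  let ?A = "{1..length xs}"
  from 2 have part: "partition_on ?A P" and ne: "P \<noteq> {?A}" by (auto simp: NC_def)
  have "B \<subseteq> ?A" using part 2(2) by (auto simp: partition_on_def)
  moreover have "B \<noteq> ?A"
  proof
    assume B: "B = ?A"
    have "C = B" if "C \<in> P" for C
    proof (rule ccontr)
      assume "C \<noteq> B"
      then have "C \<inter> B = {}" using part that 2(2) by (auto simp: partition_on_def disjoint_def)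
      moreover have "C \<subseteq> B" "C \<noteq> {}" using part that B by (auto simp: partition_on_def)
      ultimately show False by blast
    qed
    then have "P = {?A}" using 2(2) B by blast
    with ne show False ..
  qed
  ultimately have "card B < card ?A" by (intro psubset_card_mono) auto
  then show ?case by (simp add: sublist_at_def)
qed simp

declare free_cumulant.simps [simp del]

lemma finite_NC: "finite (NC p)"
  by (rule finite_subset[of _ "Pow (Pow {1..p})"]) (auto simp: NC_def partition_on_def)

theorem moment_cumulant:
  assumes "xs \<noteq> []"
  shows "\<phi> (prod_list xs) = (\<Sum>P \<in> NC (length xs). \<Prod>B\<in>P. free_cumulant \<phi> (sublist_at xs B))"
proof -
  let ?A = "{1..length xs}"
  have A: "{?A} \<in> NC (length xs)"
    using assms by (auto simp: NC_def noncrossing_def partition_on_def disjoint_def Suc_le_eq)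
  have "sublist_at xs ?A = xs"
    by (rule nth_equalityI) (auto simp: sublist_at_def atLeastLessThanSuc_atLeastAtMost[symmetric]
          simp del: upt_Suc)
  then show ?thesis
    by (simp add: sum.remove[OF finite_NC A] free_cumulant.simps[of \<phi> xs])
qed


section \<open>Non-commutative polynomials\<close>

text \<open>
  The free monoid on \<open>'l\<close>, written additively because \<open>Poly_Mapping\<close> equips \<open>'k \<Rightarrow>\<^sub>0 complex\<close>
  with the convolution product of a monoid algebra when the keys \<open>'k\<close> form an additive monoid.
  It need not be commutative.
\<close>

datatype 'l free_monoid = Word (letters: "'l list")

instantiation free_monoid :: (type) monoid_add
begin

definition zero_free_monoid :: "'a free_monoid" where
  "0 = Word []"

definition plus_free_monoid :: "'a free_monoid \<Rightarrow> 'a free_monoid \<Rightarrow> 'a free_monoid" where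
  "u + v = Word (letters u @ letters v)"

instance
  by standard (simp_all add: zero_free_monoid_def plus_free_monoid_def)

end

type_synonym 'l nc_poly = "'l free_monoid \<Rightarrow>\<^sub>0 complex"


section \<open>Words in random matrices and convergence in distribution\<close>

definition mat_trace :: "complex mat \<Rightarrow> complex" where
  "mat_trace A = (\<Sum>i<dim_row A. A $$ (i, i))"

text \<open>The dimension \<open>d\<close> is only there to give the empty word the value of an identity matrix.\<close>

definition mat_word :: "nat \<Rightarrow> ('l \<Rightarrow> complex mat) \<Rightarrow> 'l list \<Rightarrow> complex mat" where
  "mat_word d A w = foldr (\<lambda>l B. A l * B) w (1\<^sub>m d)"

text \<open>
  The matrices \<open>Y n l\<close> of size \<open>d n\<close> converge in distribution to the family \<open>x\<close>: all mixed moments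
  with respect to the expected normalised trace converge.
\<close>

definition converges_in_distribution ::
  "(nat \<Rightarrow> 'w measure) \<Rightarrow> (nat \<Rightarrow> nat) \<Rightarrow> (nat \<Rightarrow> 'l \<Rightarrow> 'w \<Rightarrow> complex mat)
     \<Rightarrow> ('a::ring_1 \<Rightarrow> complex) \<Rightarrow> ('l \<Rightarrow> 'a) \<Rightarrow> bool" where
  "converges_in_distribution M d Y \<phi> x \<longleftrightarrow>
     (\<forall>w. (\<lambda>n. \<integral>\<omega>. mat_trace (mat_word (d n) (\<lambda>l. Y n l \<omega>) w) / of_nat (d n) \<partial>M n)
            \<longlonglongrightarrow> \<phi> (prod_list (map x w)))"


section \<open>Marginals of a random tensor\<close>

text \<open>
  A tensor in \<open>H\<^sub>A \<otimes> H\<^sub>B \<otimes> H\<^sub>C \<otimes> H\<^sub>D\<close>, of dimensions \<open>N, m, m, D\<close>, is given by its entries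
  \<open>X (a, b, c, d)\<close>, and an operator on that space by its kernel. The pair \<open>(a, b)\<close> indexing
  \<open>\<complex>\<^sup>N \<otimes> \<complex>\<^sup>m\<close> is encoded as \<open>a * m + b\<close>.
\<close>

type_synonym tensor_index = "nat \<times> nat \<times> nat \<times> nat"

definition tensor_indices :: "nat \<Rightarrow> nat \<Rightarrow> nat \<Rightarrow> tensor_index set" where
  "tensor_indices N m D = {..<N} \<times> {..<m} \<times> {..<m} \<times> {..<D}"

definition outer :: "(tensor_index \<Rightarrow> complex) \<Rightarrow> tensor_index \<Rightarrow> tensor_index \<Rightarrow> complex" where
  "outer X u v = X u * cnj (X v)"

definition partial_trace_CD ::
  "nat \<Rightarrow> nat \<Rightarrow> nat \<Rightarrow> (tensor_index \<Rightarrow> tensor_index \<Rightarrow> complex) \<Rightarrow> complex mat" where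
  "partial_trace_CD N m D T = mat (N * m) (N * m)
     (\<lambda>(r, s). \<Sum>k<m. \<Sum>d<D. T (r div m, r mod m, k, d) (s div m, s mod m, k, d))"

definition partial_trace_BD ::
  "nat \<Rightarrow> nat \<Rightarrow> nat \<Rightarrow> (tensor_index \<Rightarrow> tensor_index \<Rightarrow> complex) \<Rightarrow> complex mat" where
  "partial_trace_BD N m D T = mat (N * m) (N * m)
     (\<lambda>(r, s). \<Sum>k<m. \<Sum>d<D. T (r div m, k, r mod m, d) (s div m, k, s mod m, d))"

datatype marginal = AB | AC

fun W :: "nat \<Rightarrow> nat \<Rightarrow> nat \<Rightarrow> (tensor_index \<Rightarrow> complex) \<Rightarrow> marginal \<Rightarrow> complex mat" where
  "W N m D X AB = partial_trace_CD N m D (outer X)"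
| "W N m D X AC = partial_trace_BD N m D (outer X)"

text \<open>\<open>W\<^sub>f = W\<^sub>f\<^sub>(\<^sub>p\<^sub>) \<cdots> W\<^sub>f\<^sub>(\<^sub>2\<^sub>) W\<^sub>f\<^sub>(\<^sub>1\<^sub>)\<close>\<close>

definition W_word ::
  "nat \<Rightarrow> nat \<Rightarrow> nat \<Rightarrow> (tensor_index \<Rightarrow> complex) \<Rightarrow> nat \<Rightarrow> (nat \<Rightarrow> marginal) \<Rightarrow> complex mat" where
  "W_word N m D X p f = mat_word (N * m) (W N m D X) (rev (map f [1..<p + 1]))"

definition iid_standard_complex_gaussian ::
  "'w measure \<Rightarrow> 'i set \<Rightarrow> ('i \<Rightarrow> 'w \<Rightarrow> complex) \<Rightarrow> bool" where
  "iid_standard_complex_gaussian M I X \<longleftrightarrow>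
     prob_space.indep_vars M (\<lambda>_. borel) X I \<and>
     (\<forall>i\<in>I. distributed M lborel (X i) (\<lambda>z. ennreal (exp (- (cmod z)\<^sup>2) / pi)))"

end

theory Submission
  imports Defs "HOL-Real_Asymp.Real_Asymp"
begin

text \<open>
  Slicing the tensor into the \<open>m\<^sup>2\<close> independent \<open>N \<times> D\<close> Ginibre matrices \<open>G\<^sub>b\<^sub>k = X (\<cdot>, b, k, \<cdot>)\<close> turns
  \<open>Tr W\<^sub>f\<close> into a sum of traces of words in the \<open>G\<^sub>s G\<^sub>t\<^sup>*\<close>, with \<open>m\<close> fixed. Gaussian integration by parts
  expresses the expectation of a product of such traces through shorter words: contracting the
  first letter splits its trace or merges it with another one, and merging costs a factor
  \<open>N\<^sup>-\<^sup>2\<close>. The limit therefore obeys a Catalan type recursion, which is also the recursion of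
  \<open>NC(p)\<close> that removes the first point.

  It remains to count, for a non-crossing \<open>\<alpha>\<close>, the indices \<open>b\<^sub>i, k\<^sub>i\<close> compatible with the pairing.
  Planarity forces \<open>k\<close> to be constant on blocks and \<open>b\<close> to be constant on the blocks of the
  complement, so that the constraints \<open>b\<^sub>i = k\<^sub>i\<close> coming from \<open>f(i) \<noteq> f(\<alpha>(i))\<close> are edges of a tree
  with \<open>p + 1\<close> vertices: there are \<open>m\<^bsup>p + 1 - alt(f, \<alpha>)\<^esup>\<close> solutions.
\<close>

section \<open>Moments of a complex Gaussian\<close>

text \<open>A single trace obeys no closed equation, since contracting a letter can turn one trace
  into two. The expectations of all finite products of traces are therefore treated together, and
  the asymptotic factorisation of such products comes out of the same induction. The tree behind the
  index count is encoded by an order. The variables \<open>b_L, k_L, b_(L+1), ...\<close> are read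
  in this sequence, and every constraint makes a variable a copy of an earlier one. The limit pair
  is built backwards: its cumulants are prescribed, its moments are defined from them through the
  moment-cumulant formula, and the two variables are the letters of the free algebra with the
  resulting functional. The agreement with the matrix limit rests on \<open>alt(f, \<alpha>)\<close>
  being a sum over the blocks of \<open>\<alpha>\<close>. Since \<open>W_f\<close> multiplies in
  decreasing order of the positions, its trace is the conjugate of the one for the increasing order;
  the limits are real, so both have the same asymptotics.\<close>

lemma borel_measurable_Complex:
  "(\<lambda>(x, y). Complex x y) \<in> borel_measurable (lborel \<Otimes>\<^sub>M lborel)"
proof -
  have "(\<lambda>p. Complex (fst p) (snd p)) \<in> borel_measurable (borel \<Otimes>\<^sub>M borel)"
    unfolding borel_prod Complex_eq by (intro borel_measurable_continuous_onI continuous_intros)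
  then show ?thesis
    by (simp add: split_beta' cong: measurable_cong_sets)
qed

text \<open>Lebesgue measure is determined by its values on boxes, and a complex box pulls back to a
  product of two open intervals. This is the bridge from planar integrals to iterated real
  ones.\<close>

lemma lborel_complex_eq_distr:
  "(lborel :: complex measure) = distr (lborel \<Otimes>\<^sub>M lborel) borel (\<lambda>(x, y). Complex x y)"
proof (rule lborel_eqI)
  note borel_measurable_Complex [measurable]
  fix l u :: complex
  assume le: "\<And>b. b \<in> Basis \<Longrightarrow> l \<bullet> b \<le> u \<bullet> b"
  have le': "Re l \<le> Re u" "Im l \<le> Im u"
    using le[of 1] le[of \<i>] by (auto simp: Basis_complex_def)
  have "(\<lambda>(x, y). Complex x y) -` box l u = {Re l<..<Re u} \<times> {Im l<..<Im u}"
    by (auto simp: box_def Basis_complex_def)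
  then show "emeasure (distr (lborel \<Otimes>\<^sub>M lborel) borel (\<lambda>(x, y). Complex x y)) (box l u)
      = ennreal (\<Prod>b\<in>Basis. (u - l) \<bullet> b)"
    using le' by (subst emeasure_distr)
      (auto simp: space_pair_measure lborel.emeasure_pair_measure_Times Basis_complex_def ennreal_mult)
qed simp

text \<open>The constant 1/pi of the density is left out here and reappears in
  \<open>entry_moment\<close>.\<close>

definition gauss_mono :: "nat \<Rightarrow> nat \<Rightarrow> complex \<Rightarrow> complex" where
  "gauss_mono n k z = z ^ n * cnj z ^ k * exp (- of_real ((cmod z)\<^sup>2))"

text \<open>A single term of the exponential series, whose terms are all nonnegative here.\<close>

lemma power_le_fact_exp:
  fixes u :: real
  assumes "u \<ge> 0"
  shows "u ^ n \<le> fact n * exp u"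
proof -
  have "(\<Sum>i\<in>{n}. u ^ i /\<^sub>R fact i) \<le> exp u"
    unfolding exp_def using assms
    by (intro sum_le_suminf summable_exp_generic) auto
  then show ?thesis by (simp add: field_simps)
qed

text \<open>A polynomial factor costs half of the Gaussian decay: \<open>|z|^(n+k)\<close> is at
  most \<open>(n+k)! e^|z|\<close>, and \<open>|z| - |z|^2 <= 1/2 - |z|^2/2\<close> because
  \<open>(|z| - 1)^2 >= 0\<close>. What remains factorises into real and imaginary part, which
  serves both Fubini and the decay along lines.\<close>

lemma norm_gauss_mono_le:
  "cmod (gauss_mono n k z) \<le> fact (n + k) * exp (1/2) * exp (- (cmod z)\<^sup>2 / 2)"
proof -
  have "cmod (gauss_mono n k z) = cmod z ^ (n + k) * exp (- (cmod z)\<^sup>2)"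
    by (simp add: gauss_mono_def norm_mult norm_power power_add flip: exp_of_real of_real_minus)
  also have "\<dots> \<le> (fact (n + k) * exp (cmod z)) * exp (- (cmod z)\<^sup>2)"
    by (intro mult_right_mono power_le_fact_exp) auto
  also have "\<dots> = fact (n + k) * exp (cmod z - (cmod z)\<^sup>2)"
    by (simp add: exp_diff exp_minus field_simps)
  also have "\<dots> \<le> fact (n + k) * exp (1/2 - (cmod z)\<^sup>2 / 2)"
  proof -
    have "0 \<le> (cmod z - 1)\<^sup>2" by simp
    then have "cmod z - (cmod z)\<^sup>2 \<le> 1/2 - (cmod z)\<^sup>2 / 2"
      unfolding power2_eq_square by (simp add: algebra_simps)
    then show ?thesis by simp
  qed
  also have "\<dots> = fact (n + k) * exp (1/2) * exp (- (cmod z)\<^sup>2 / 2)"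
    by (simp flip: exp_add)
  finally show ?thesis .
qed

lemma borel_measurable_gauss_mono [measurable]: "gauss_mono n k \<in> borel_measurable borel"
  unfolding gauss_mono_def by (intro borel_measurable_continuous_onI continuous_intros)

lemma integrable_exp_neg_half_square: "integrable lborel (\<lambda>x::real. exp (- x\<^sup>2 / 2))"
proof -
  have "integrable lborel (\<lambda>x. sqrt (2 * pi) * (std_normal_density x * x ^ 0))"
    by (intro integrable_mult_right integrable_std_normal_moment)
  then show ?thesis by (simp add: std_normal_density_def)
qed

lemma integrable_gauss_mono: "integrable lborel (gauss_mono n k)"
proof -
  note borel_measurable_Complex [measurable]
  have "integrable (lborel \<Otimes>\<^sub>M lborel) (\<lambda>(x::real, y::real). exp (- x\<^sup>2 / 2) * exp (- y\<^sup>2 / 2))"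
  proof (rule lborel_pair.Fubini_integrable)
    show "integrable lborel (\<lambda>x. \<integral>y. norm ((case (x, y) of (x, y) \<Rightarrow> exp (- x\<^sup>2 / 2) * exp (- y\<^sup>2 / 2)) :: real) \<partial>lborel)"
      using integrable_mult_left[OF integrable_exp_neg_half_square] by simp
    show "AE x in lborel. integrable lborel (\<lambda>y. case (x, y) of (x :: real, y) \<Rightarrow> exp (- x\<^sup>2 / 2) * exp (- y\<^sup>2 / 2))"
      using integrable_exp_neg_half_square by simp
  qed measurable
  then have "integrable (lborel \<Otimes>\<^sub>M lborel)
      (\<lambda>p. fact (n + k) * exp (1/2) * (case p of (x::real, y::real) \<Rightarrow> exp (- x\<^sup>2 / 2) * exp (- y\<^sup>2 / 2)))"
    by (intro integrable_mult_right)
  then have "integrable (lborel \<Otimes>\<^sub>M lborel) (\<lambda>(x, y). gauss_mono n k (Complex x y))"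
  proof (rule Bochner_Integration.integrable_bound)
    show "AE p in lborel \<Otimes>\<^sub>M lborel. cmod (case p of (x, y) \<Rightarrow> gauss_mono n k (Complex x y))
       \<le> norm (fact (n + k) * exp (1/2) * (case p of (x::real, y::real) \<Rightarrow> exp (- x\<^sup>2 / 2) * exp (- y\<^sup>2 / 2)) :: real)"
    proof (rule AE_I2, clarsimp)
      fix x y :: real
      have "exp (- (cmod (Complex x y))\<^sup>2 / 2) = exp (- (x\<^sup>2 / 2)) * exp (- (y\<^sup>2 / 2))"
        by (simp add: cmod_power2 add_divide_distrib flip: exp_add)
      then show "cmod (gauss_mono n k (Complex x y)) \<le> fact (n + k) * exp (1 / 2) * (exp (- (x\<^sup>2 / 2)) * exp (- (y\<^sup>2 / 2)))"
        using norm_gauss_mono_le[of n k "Complex x y"] by simp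
    qed
  qed (simp add: split_beta')
  then show ?thesis
    unfolding lborel_complex_eq_distr
    by (subst integrable_distr_eq) (auto simp: split_beta')
qed

lemma integral_derivative_real_line_eq_0:
  fixes F f :: "real \<Rightarrow> complex"
  assumes "\<And>x. (F has_vector_derivative f x) (at x)" "\<And>x. isCont f x" "integrable lborel f"
    and "(F \<longlongrightarrow> 0) at_top" "(F \<longlongrightarrow> 0) at_bot"
  shows "(\<integral>x. f x \<partial>lborel) = 0"
proof -
  have "(LBINT x=-\<infinity>..\<infinity>. f x) = 0 - 0"
    using assms by (intro interval_integral_FTC_integrable)
      (auto simp: ereal_tendsto_simps einterval_eq set_integrable_def)
  then show ?thesis
    by (simp add: interval_lebesgue_integral_def einterval_eq set_lebesgue_integral_def)
qed

text \<open>The derivative of \<open>gauss_mono n k\<close> at \<open>z\<close> in the direction \<open>v\<close>.\<close>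

definition gauss_mono_deriv :: "nat \<Rightarrow> nat \<Rightarrow> complex \<Rightarrow> complex \<Rightarrow> complex" where
  "gauss_mono_deriv n k v z =
     v * (of_nat n * gauss_mono (n - 1) k z - gauss_mono n (k + 1) z)
     + cnj v * (of_nat k * gauss_mono n (k - 1) z - gauss_mono (n + 1) k z)"

lemma has_vector_derivative_gauss_mono:
  "((\<lambda>t. gauss_mono n k (w + of_real t * v)) has_vector_derivative
     gauss_mono_deriv n k v (w + of_real t * v)) (at t)"
proof -
  \<comment> \<open>On a line the conjugate of \<open>w + t v\<close> is
    \<open>cnj w + t cnj v\<close>, so replacing the real parameter by a complex
    \<open>\<tau>\<close> gives a holomorphic function, and the rules for field derivatives
    apply.\<close>
  let ?g = "\<lambda>\<tau>. (w + \<tau> * v) ^ n * (cnj w + \<tau> * cnj v) ^ k * exp (- ((w + \<tau> * v) * (cnj w + \<tau> * cnj v)))"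
  have eq: "gauss_mono n k (w + of_real t * v) = ?g (of_real t)" for t
    by (simp only: gauss_mono_def complex_norm_square) simp
  have "(?g has_field_derivative gauss_mono_deriv n k v (w + of_real t * v)) (at (of_real t))"
    unfolding gauss_mono_deriv_def gauss_mono_def complex_norm_square
    by (rule derivative_eq_intros refl)+ (simp add: algebra_simps)
  then show ?thesis
    unfolding eq by (rule has_vector_derivative_real_field)
qed

lemma isCont_gauss_mono: "isCont (gauss_mono n k) z"
  unfolding gauss_mono_def by (intro continuous_intros)

text \<open>By the hypothesis \<open>|t|\<close> never exceeds the distance from the origin, so
  everything is dominated by a multiple of \<open>exp (- t^2 / 2)\<close>: the derivative is
  integrable and its primitive vanishes at both ends. It holds for horizontal lines based on the
  imaginary axis and for vertical lines based on the real axis.\<close>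

lemma integral_gauss_mono_deriv_line:
  assumes "\<And>t. t\<^sup>2 \<le> (cmod (w + of_real t * v))\<^sup>2"
  shows "(\<integral>t. gauss_mono_deriv n k v (w + of_real t * v) \<partial>lborel) = 0"
proof (rule integral_derivative_real_line_eq_0)
  have bound: "cmod (gauss_mono n k (w + of_real t * v)) \<le> fact (n + k) * exp (1/2) * exp (- t\<^sup>2 / 2)" for n k t
  proof -
    have "cmod (gauss_mono n k (w + of_real t * v)) \<le> fact (n + k) * exp (1/2) * exp (- (cmod (w + of_real t * v))\<^sup>2 / 2)"
      by (rule norm_gauss_mono_le)
    also have "\<dots> \<le> fact (n + k) * exp (1/2) * exp (- t\<^sup>2 / 2)"
      using assms[of t] by (intro mult_left_mono) auto
    finally show ?thesis .
  qed
  have "integrable lborel (\<lambda>t. gauss_mono n k (w + of_real t * v))" for n k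
    by (rule Bochner_Integration.integrable_bound
        [OF integrable_mult_right[OF integrable_exp_neg_half_square, of "fact (n + k) * exp (1/2)"]])
      (use bound in \<open>auto intro!: AE_I2\<close>)
  then show "integrable lborel (\<lambda>t. gauss_mono_deriv n k v (w + of_real t * v))"
    unfolding gauss_mono_deriv_def by auto
  show "((\<lambda>t. gauss_mono n k (w + of_real t * v)) has_vector_derivative
     gauss_mono_deriv n k v (w + of_real t * v)) (at t)" for t
    by (rule has_vector_derivative_gauss_mono)
  show "isCont (\<lambda>t. gauss_mono_deriv n k v (w + of_real t * v)) t" for t
    unfolding gauss_mono_deriv_def by (intro continuous_intros isCont_o2[OF _ isCont_gauss_mono])
  have "((\<lambda>t::real. fact (n + k) * exp (1/2) * exp (- t\<^sup>2 / 2)) \<longlongrightarrow> 0) at_top"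
    "((\<lambda>t::real. fact (n + k) * exp (1/2) * exp (- t\<^sup>2 / 2)) \<longlongrightarrow> 0) at_bot"
    by real_asymp+
  then show "((\<lambda>t. gauss_mono n k (w + of_real t * v)) \<longlongrightarrow> 0) at_top"
    "((\<lambda>t. gauss_mono n k (w + of_real t * v)) \<longlongrightarrow> 0) at_bot"
    by (auto intro: Lim_null_comparison[OF always_eventually[OF allI[OF bound]]])
qed

text \<open>Both orders are stated because the direction \<open>1\<close> needs the inner integral
  over the real part, and the direction \<open>\<i>\<close> the one over the imaginary part.\<close>

lemma integral_complex_iterated:
  fixes f :: "complex \<Rightarrow> complex"
  assumes f: "integrable lborel f"
  shows "(\<integral>z. f z \<partial>lborel) = (\<integral>x. (\<integral>y. f (Complex x y) \<partial>lborel) \<partial>lborel)"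
    and "(\<integral>z. f z \<partial>lborel) = (\<integral>y. (\<integral>x. f (Complex x y) \<partial>lborel) \<partial>lborel)"
proof -
  note borel_measurable_Complex [measurable]
  have [measurable]: "f \<in> borel_measurable borel"
    using f by auto
  have "integrable (lborel \<Otimes>\<^sub>M lborel) (\<lambda>(x, y). f (Complex x y))"
    using f unfolding lborel_complex_eq_distr by (subst (asm) integrable_distr_eq) (auto simp: split_beta')
  moreover have "(\<integral>z. f z \<partial>lborel) = (\<integral>p. f (case p of (x, y) \<Rightarrow> Complex x y) \<partial>(lborel \<Otimes>\<^sub>M lborel))"
    by (subst lborel_complex_eq_distr, rule integral_distr) auto
  ultimately show "(\<integral>z. f z \<partial>lborel) = (\<integral>x. (\<integral>y. f (Complex x y) \<partial>lborel) \<partial>lborel)"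
    and "(\<integral>z. f z \<partial>lborel) = (\<integral>y. (\<integral>x. f (Complex x y) \<partial>lborel) \<partial>lborel)"
    using lborel_pair.integral_fst[of "\<lambda>x y. f (Complex x y)"]
      lborel_pair.integral_snd[of "\<lambda>x y. f (Complex x y)"] by (simp_all add: split_beta')
qed

text \<open>
  Integrating the derivatives in the directions \<open>1\<close> and \<open>\<i>\<close> gives zero; the combination
  \<open>\<partial>\<^sub>x + \<i> \<partial>\<^sub>y\<close> isolates the derivative with respect to \<open>cnj z\<close>.
\<close>

lemma integral_gauss_mono_Suc:
  "(\<integral>z. gauss_mono (Suc n) k z \<partial>lborel) = of_nat k * (\<integral>z. gauss_mono n (k - 1) z \<partial>lborel)"
proof -
  have int: "integrable lborel (gauss_mono_deriv n k v)" for v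
    unfolding gauss_mono_deriv_def
    by (intro Bochner_Integration.integrable_add Bochner_Integration.integrable_diff
        integrable_mult_right integrable_gauss_mono)
  have 1: "(\<integral>z. gauss_mono_deriv n k 1 z \<partial>lborel) = 0"
  proof -
    have "(\<integral>x. gauss_mono_deriv n k 1 (Complex x y) \<partial>lborel) = 0" for y
      using integral_gauss_mono_deriv_line[of "\<i> * of_real y" 1 n k]
      by (simp add: Complex_eq cmod_power2 add.commute)
    then show ?thesis
      by (subst integral_complex_iterated(2)[OF int]) simp
  qed
  have 2: "(\<integral>z. gauss_mono_deriv n k \<i> z \<partial>lborel) = 0"
  proof -
    have "(\<integral>y. gauss_mono_deriv n k \<i> (Complex x y) \<partial>lborel) = 0" for x
      using integral_gauss_mono_deriv_line[of "of_real x" \<i> n k]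
      by (simp add: Complex_eq cmod_power2 mult.commute)
    then show ?thesis
      by (subst integral_complex_iterated(1)[OF int]) simp
  qed
  \<comment> \<open>In the combination the coefficient of the holomorphic part is
    \<open>1 + \<i> * \<i> = 0\<close> and that of the antiholomorphic part is
    \<open>1 + \<i> * cnj \<i> = 2\<close>; hence the division by 2.\<close>
  have "0 = (\<integral>z. (gauss_mono_deriv n k 1 z + \<i> * gauss_mono_deriv n k \<i> z) / 2 \<partial>lborel)"
    using 1 2 int by simp
  also have "\<dots> = (\<integral>z. of_nat k * gauss_mono n (k - 1) z - gauss_mono (Suc n) k z \<partial>lborel)"
    by (intro Bochner_Integration.integral_cong) (auto simp: gauss_mono_deriv_def field_simps)
  also have "\<dots> = of_nat k * (\<integral>z. gauss_mono n (k - 1) z \<partial>lborel) - (\<integral>z. gauss_mono (Suc n) k z \<partial>lborel)"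
    using integrable_gauss_mono by simp
  finally show ?thesis by simp
qed

section \<open>Integration by parts for families of complex Gaussians\<close>

locale complex_gaussian_family = prob_space M for M :: "'w measure" +
  fixes I :: "'i set" and X :: "'i \<Rightarrow> 'w \<Rightarrow> complex"
  assumes finite_index: "finite I"
    and iid: "iid_standard_complex_gaussian M I X"
begin

lemma indep: "indep_vars (\<lambda>_. borel) X I"
  using iid by (simp add: iid_standard_complex_gaussian_def)

lemma distributed_entry:
  "i \<in> I \<Longrightarrow> distributed M lborel (X i) (\<lambda>z. ennreal (exp (- (cmod z)\<^sup>2) / pi))"
  using iid by (simp add: iid_standard_complex_gaussian_def)

lemma entry_moment:
  assumes i: "i \<in> I"
  shows "integrable M (\<lambda>\<omega>. X i \<omega> ^ n * cnj (X i \<omega>) ^ k)"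
    and "(\<integral>\<omega>. X i \<omega> ^ n * cnj (X i \<omega>) ^ k \<partial>M) = (\<integral>z. gauss_mono n k z \<partial>lborel) / pi"
proof -
  let ?d = "\<lambda>z::complex. exp (- (cmod z)\<^sup>2) / pi"
  let ?h = "\<lambda>z. z ^ n * cnj z ^ k"
  have X[measurable]: "X i \<in> borel_measurable M"
    and distr: "distr M lborel (X i) = density lborel (\<lambda>z. ennreal (?d z))"
    using distributed_entry[OF i] by (auto simp: distributed_def)
  have h[measurable]: "?h \<in> borel_measurable borel"
    by (intro borel_measurable_continuous_onI continuous_intros)
  have d[measurable]: "?d \<in> borel_measurable borel"
    by measurable
  have eq: "?d z *\<^sub>R ?h z = gauss_mono n k z / pi" for z
    by (simp add: gauss_mono_def scaleR_conv_of_real field_simps flip: exp_of_real)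
  have "integrable (density lborel (\<lambda>z. ennreal (?d z))) ?h"
    by (subst integrable_density) (auto simp: eq integrable_gauss_mono)
  then show "integrable M (\<lambda>\<omega>. X i \<omega> ^ n * cnj (X i \<omega>) ^ k)"
    by (subst (asm) distr[symmetric], subst (asm) integrable_distr_eq) auto
  have "(\<integral>\<omega>. ?h (X i \<omega>) \<partial>M) = (\<integral>z. ?h z \<partial>distr M lborel (X i))"
    by (subst integral_distr) auto
  also have "\<dots> = (\<integral>z. gauss_mono n k z / pi \<partial>lborel)"
    unfolding distr by (subst integral_density) (auto simp: eq)
  also have "\<dots> = (\<integral>z. gauss_mono n k z \<partial>lborel) / pi"
    by simp
  finally show "(\<integral>\<omega>. ?h (X i \<omega>) \<partial>M) = (\<integral>z. gauss_mono n k z \<partial>lborel) / pi" .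
qed

definition entry_monomial :: "('i \<Rightarrow> nat) \<Rightarrow> ('i \<Rightarrow> nat) \<Rightarrow> 'w \<Rightarrow> complex" where
  "entry_monomial n k \<omega> = (\<Prod>i\<in>I. X i \<omega> ^ n i * cnj (X i \<omega>) ^ k i)"

lemma entry_monomial_expectation:
  shows integrable_entry_monomial: "integrable M (entry_monomial n k)"
    and integral_entry_monomial:
      "(\<integral>\<omega>. entry_monomial n k \<omega> \<partial>M) = (\<Prod>i\<in>I. (\<integral>z. gauss_mono (n i) (k i) z \<partial>lborel) / pi)"
proof -
  have [measurable]: "(\<lambda>z. z ^ n i * cnj z ^ k i) \<in> borel_measurable borel" for i
    by (intro borel_measurable_continuous_onI continuous_intros)
  have ind: "indep_vars (\<lambda>_. borel) (\<lambda>i \<omega>. X i \<omega> ^ n i * cnj (X i \<omega>) ^ k i) I"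
    by (rule indep_vars_compose2[OF indep]) measurable
  show "integrable M (entry_monomial n k)"
    unfolding entry_monomial_def[abs_def]
    by (rule indep_vars_integrable[OF finite_index ind]) (rule entry_moment)
  show "(\<integral>\<omega>. entry_monomial n k \<omega> \<partial>M) = (\<Prod>i\<in>I. (\<integral>z. gauss_mono (n i) (k i) z \<partial>lborel) / pi)"
    unfolding entry_monomial_def[abs_def]
    by (subst indep_vars_lebesgue_integral[OF finite_index ind]) (simp_all add: entry_moment)
qed

lemma entry_monomial_mult: "entry_monomial n k \<omega> * entry_monomial n' k' \<omega> = entry_monomial (\<lambda>i. n i + n' i) (\<lambda>i. k i + k' i) \<omega>"
  by (simp add: entry_monomial_def power_add algebra_simps flip: prod.distrib)

text \<open>\<open>cnj_deriv e F G\<close>: \<open>G\<close> is the formal derivative of the polynomial \<open>F\<close> by \<open>cnj (X e)\<close>.\<close>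

inductive cnj_deriv :: "'i \<Rightarrow> ('w \<Rightarrow> complex) \<Rightarrow> ('w \<Rightarrow> complex) \<Rightarrow> bool" for e where
  monomial: "cnj_deriv e (entry_monomial n k) (\<lambda>\<omega>. of_nat (k e) * entry_monomial n (k(e := k e - 1)) \<omega>)"
| add: "cnj_deriv e F G \<Longrightarrow> cnj_deriv e F' G' \<Longrightarrow> cnj_deriv e (\<lambda>\<omega>. F \<omega> + F' \<omega>) (\<lambda>\<omega>. G \<omega> + G' \<omega>)"
| scale: "cnj_deriv e F G \<Longrightarrow> cnj_deriv e (\<lambda>\<omega>. c * F \<omega>) (\<lambda>\<omega>. c * G \<omega>)"

lemma cnj_deriv_integrable:
  "cnj_deriv e F G \<Longrightarrow> integrable M F"
  by (induction rule: cnj_deriv.induct) (auto intro: integrable_entry_monomial)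

lemma entry_monomial_upd_Suc: "e \<in> I \<Longrightarrow> X e \<omega> * entry_monomial n k \<omega> = entry_monomial (n(e := Suc (n e))) k \<omega>"
  using finite_index by (simp add: entry_monomial_def prod.remove algebra_simps)

lemma entry_monomial_upd_cnj_Suc: "e \<in> I \<Longrightarrow> cnj (X e \<omega>) * entry_monomial n k \<omega> = entry_monomial n (k(e := Suc (k e))) \<omega>"
  using finite_index by (simp add: entry_monomial_def prod.remove algebra_simps)

text \<open>This is \<open>E[X_e F] = E[dF / d(cnj X_e)]\<close>. On a monomial only the factor with
  index \<open>e\<close> changes, so independence reduces the identity to
  \<open>integral_gauss_mono_Suc\<close>; the rest is linearity. Both integrabilities are carried
  through the induction because linearity of the integral asks for them.\<close>

lemma cnj_deriv_by_parts:
  assumes "cnj_deriv e F G" and e: "e \<in> I"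
  shows "integrable M (\<lambda>\<omega>. X e \<omega> * F \<omega>)" and "integrable M G"
    and "(\<integral>\<omega>. X e \<omega> * F \<omega> \<partial>M) = (\<integral>\<omega>. G \<omega> \<partial>M)"
proof -
  have "integrable M (\<lambda>\<omega>. X e \<omega> * F \<omega>) \<and> integrable M G \<and> (\<integral>\<omega>. X e \<omega> * F \<omega> \<partial>M) = (\<integral>\<omega>. G \<omega> \<partial>M)"
    using assms(1)
  proof induction
    case (monomial n k)
    have "(\<integral>\<omega>. X e \<omega> * entry_monomial n k \<omega> \<partial>M)
        = (\<Prod>i\<in>I. (\<integral>z. gauss_mono ((n(e := Suc (n e))) i) (k i) z \<partial>lborel) / pi)"
      using e by (simp only: entry_monomial_upd_Suc integral_entry_monomial)
    also have "\<dots> = of_nat (k e) * (\<Prod>i\<in>I. (\<integral>z. gauss_mono (n i) ((k(e := k e - 1)) i) z \<partial>lborel) / pi)"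
      using e finite_index by (simp add: prod.remove integral_gauss_mono_Suc)
    also have "\<dots> = (\<integral>\<omega>. of_nat (k e) * entry_monomial n (k(e := k e - 1)) \<omega> \<partial>M)"
      by (simp only: integral_entry_monomial integral_mult_right_zero)
    finally show ?case
      using e by (simp add: entry_monomial_upd_Suc integrable_entry_monomial)
  next
    case (add F G F' G')
    then show ?case
      by (simp add: distrib_left)
  next
    case (scale F G c)
    then have "integrable M (\<lambda>\<omega>. c * (X e \<omega> * F \<omega>))"
      by simp
    moreover have "(\<integral>\<omega>. c * (X e \<omega> * F \<omega>) \<partial>M) = (\<integral>\<omega>. c * G \<omega> \<partial>M)"
      using scale by (simp only: integral_mult_right_zero)
    ultimately show ?case
      using scale by (simp add: algebra_simps)
  qed
  then show "integrable M (\<lambda>\<omega>. X e \<omega> * F \<omega>)" and "integrable M G"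
    and "(\<integral>\<omega>. X e \<omega> * F \<omega> \<partial>M) = (\<integral>\<omega>. G \<omega> \<partial>M)" by auto
qed

text \<open>The Leibniz rule follows from the case of two monomials by bilinearity, hence the nested
  induction over both derivations.\<close>

lemma cnj_deriv_mult:
  assumes "cnj_deriv e F G" "cnj_deriv e F' G'"
  shows "cnj_deriv e (\<lambda>\<omega>. F \<omega> * F' \<omega>) (\<lambda>\<omega>. F \<omega> * G' \<omega> + G \<omega> * F' \<omega>)"
  using assms(1)
proof induction
  case (monomial n k)
  from assms(2) show ?case
  proof induction
    case (monomial n' k')
    let ?k = "\<lambda>i. k i + k' i"
    let ?m = "\<lambda>\<omega>. entry_monomial (\<lambda>i. n i + n' i) (?k(e := ?k e - 1)) \<omega>"
    \<comment> \<open>Where an exponent of \<open>cnj (X e)\<close> is 0, the truncated subtraction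
      gives a wrong monomial, but its coefficient is 0 as well.\<close>
    have "of_nat (k' e) * (entry_monomial n k \<omega> * entry_monomial n' (k'(e := k' e - 1)) \<omega>) = of_nat (k' e) * ?m \<omega>"
      and "of_nat (k e) * (entry_monomial n (k(e := k e - 1)) \<omega> * entry_monomial n' k' \<omega>) = of_nat (k e) * ?m \<omega>" for \<omega>
      by (auto simp: entry_monomial_mult intro!: arg_cong[where f = "\<lambda>k. entry_monomial (\<lambda>i. n i + n' i) k \<omega>"])
    then have "(\<lambda>\<omega>. entry_monomial n k \<omega> * (of_nat (k' e) * entry_monomial n' (k'(e := k' e - 1)) \<omega>)
           + of_nat (k e) * entry_monomial n (k(e := k e - 1)) \<omega> * entry_monomial n' k' \<omega>)
        = (\<lambda>\<omega>. of_nat (?k e) * ?m \<omega>)"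
      by (intro ext) (simp only: mult.assoc mult.left_commute[of "entry_monomial n k _" "of_nat (k' e)"] of_nat_add distrib_right add.commute)
    moreover have "(\<lambda>\<omega>. entry_monomial n k \<omega> * entry_monomial n' k' \<omega>) = entry_monomial (\<lambda>i. n i + n' i) ?k"
      by (intro ext entry_monomial_mult)
    ultimately show ?case
      using cnj_deriv.monomial[of e "\<lambda>i. n i + n' i" ?k] by (simp only:)
  next
    case (add F G F' G')
    from cnj_deriv.add[OF add.IH] show ?case by (simp add: algebra_simps)
  next
    case (scale F G c)
    from cnj_deriv.scale[OF scale.IH, of c] show ?case by (simp add: algebra_simps)
  qed
next
  case (add F G F'' G'')
  from cnj_deriv.add[OF add.IH] show ?case by (simp add: algebra_simps)
next
  case (scale F G c)
  from cnj_deriv.scale[OF scale.IH, of c] show ?case by (simp add: algebra_simps)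
qed

lemma cnj_deriv_const: "cnj_deriv e (\<lambda>_. c) (\<lambda>_. 0)"
  using cnj_deriv.scale[OF cnj_deriv.monomial[of e "\<lambda>_. 0" "\<lambda>_. 0"], of c] by (simp add: entry_monomial_def)

lemma cnj_deriv_sum:
  "(\<And>x. x \<in> A \<Longrightarrow> cnj_deriv e (F x) (G x)) \<Longrightarrow> cnj_deriv e (\<lambda>\<omega>. \<Sum>x\<in>A. F x \<omega>) (\<lambda>\<omega>. \<Sum>x\<in>A. G x \<omega>)"
  by (induction A rule: infinite_finite_induct) (auto intro: cnj_deriv_const cnj_deriv.add)

text \<open>An entry and its conjugate count as independent variables, so the derivative vanishes
  also for \<open>i = e\<close>.\<close>

lemma cnj_deriv_entry: "i \<in> I \<Longrightarrow> cnj_deriv e (X i) (\<lambda>_. 0)"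
  using cnj_deriv.monomial[of e "(\<lambda>_. 0)(i := 1)" "\<lambda>_. 0"] entry_monomial_upd_Suc[of i _ "\<lambda>_. 0" "\<lambda>_. 0"]
  by (simp add: ext[of "X i" "entry_monomial ((\<lambda>_. 0)(i := Suc 0)) (\<lambda>_. 0)"] entry_monomial_def[of "\<lambda>_. 0" "\<lambda>_. 0"])

lemma cnj_deriv_cnj_entry: "i \<in> I \<Longrightarrow> cnj_deriv e (\<lambda>\<omega>. cnj (X i \<omega>)) (\<lambda>_. of_bool (i = e))"
  using cnj_deriv.monomial[of e "\<lambda>_. 0" "(\<lambda>_. 0)(i := 1)"] entry_monomial_upd_cnj_Suc[of i _ "\<lambda>_. 0" "\<lambda>_. 0"]
  by (cases "i = e") (simp_all add: fun_upd_idem entry_monomial_def[of "\<lambda>_. 0" "\<lambda>_. 0"])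

lemma cnj_deriv_prod_list:
  assumes "\<And>x. x \<in> set xs \<Longrightarrow> cnj_deriv e (F x) (G x)"
  shows "cnj_deriv e (\<lambda>\<omega>. \<Prod>x\<leftarrow>xs. F x \<omega>)
    (\<lambda>\<omega>. \<Sum>l<length xs. G (xs ! l) \<omega> * (\<Prod>x\<leftarrow>take l xs @ drop (Suc l) xs. F x \<omega>))"
  using assms
proof (induction xs)
  case Nil
  then show ?case by (simp add: cnj_deriv_const)
next
  case (Cons x xs)
  have "cnj_deriv e (\<lambda>\<omega>. F x \<omega> * (\<Prod>x\<leftarrow>xs. F x \<omega>))
      (\<lambda>\<omega>. F x \<omega> * (\<Sum>l<length xs. G (xs ! l) \<omega> * (\<Prod>x\<leftarrow>take l xs @ drop (Suc l) xs. F x \<omega>))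
        + G x \<omega> * (\<Prod>x\<leftarrow>xs. F x \<omega>))"
    using Cons.prems by (intro cnj_deriv_mult Cons.IH) auto
  then show ?case
    by (simp add: sum.lessThan_Suc_shift sum_distrib_left algebra_simps del: sum.lessThan_Suc)
qed

end

section \<open>Loop equations\<close>

text \<open>
  For a colour \<open>s = (b, k)\<close> let \<open>G\<^sub>s\<close> be the \<open>N \<times> D\<close> matrix \<open>X (\<cdot>, b, k, \<cdot>)\<close>. A list of pairs of
  colours \<open>[(s\<^sub>1, t\<^sub>1), ..., (s\<^sub>p, t\<^sub>p)]\<close> encodes the word \<open>G\<^sub>s\<^sub>1 G\<^sub>t\<^sub>1\<^sup>* \<cdots> G\<^sub>s\<^sub>p G\<^sub>t\<^sub>p\<^sup>*\<close>.
\<close>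

type_synonym colour = "nat \<times> nat"

definition entry_index :: "nat \<Rightarrow> colour \<Rightarrow> nat \<Rightarrow> tensor_index" where
  "entry_index a s d = (a, fst s, snd s, d)"

text \<open>The entries of a matrix word are spelled out as scalar sums, since the formal derivative
  \<open>cnj_deriv\<close> acts on complex functions built from the tensor entries. The index
  \<open>d\<close> runs over the columns shared by \<open>G_s\<close> and
  \<open>G_t\<close>.\<close>

fun word_entry ::
  "nat \<Rightarrow> nat \<Rightarrow> (tensor_index \<Rightarrow> complex) \<Rightarrow> (colour \<times> colour) list \<Rightarrow> nat \<Rightarrow> nat \<Rightarrow> complex" where
  "word_entry N D x [] a a' = of_bool (a = a')"
| "word_entry N D x ((s, t) # w) a a' =
     (\<Sum>d<D. \<Sum>e<N. x (entry_index a s d) * (cnj (x (entry_index e t d)) * word_entry N D x w e a'))"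

definition word_trace :: "nat \<Rightarrow> nat \<Rightarrow> (tensor_index \<Rightarrow> complex) \<Rightarrow> (colour \<times> colour) list \<Rightarrow> complex" where
  "word_trace N D x w = (\<Sum>a<N. word_entry N D x w a a)"

lemma word_trace_Nil: "word_trace N D x [] = of_nat N"
  by (simp add: word_trace_def)

lemma word_entry_append:
  "a < N \<Longrightarrow> word_entry N D x (u @ v) a a' = (\<Sum>e<N. word_entry N D x u a e * word_entry N D x v e a')"
proof (induction u arbitrary: a)
  case Nil
  then show ?case by (simp add: of_bool_def if_distrib[of "\<lambda>z. z * _"] sum.delta cong: if_cong)
next
  case (Cons p u)
  obtain s t where p: "p = (s, t)" by (cases p)
  have "word_entry N D x ((p # u) @ v) a a'
      = (\<Sum>d<D. \<Sum>f<N. \<Sum>e<N. x (entry_index a s d) * (cnj (x (entry_index f t d)) * word_entry N D x u f e) * word_entry N D x v e a')"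
    unfolding p using Cons.IH by (simp add: sum_distrib_left mult.assoc)
  also have "\<dots> = (\<Sum>d<D. \<Sum>e<N. \<Sum>f<N. x (entry_index a s d) * (cnj (x (entry_index f t d)) * word_entry N D x u f e) * word_entry N D x v e a')"
    by (intro sum.cong refl sum.swap)
  also have "\<dots> = (\<Sum>e<N. word_entry N D x (p # u) a e * word_entry N D x v e a')"
    unfolding p by (simp add: sum_distrib_right) (rule sum.swap)
  finally show ?case .
qed

lemma word_entry_snoc:
  assumes "a < N" "a' < N"
  shows "word_entry N D x (u @ [(s, t)]) a a'
    = (\<Sum>d<D. (\<Sum>e<N. word_entry N D x u a e * x (entry_index e s d)) * cnj (x (entry_index a' t d)))"
proof -
  have "word_entry N D x (u @ [(s, t)]) a a'
    = (\<Sum>e<N. \<Sum>d<D. word_entry N D x u a e * x (entry_index e s d) * cnj (x (entry_index a' t d)))"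
    using assms by (simp add: word_entry_append of_bool_def if_distrib[of "\<lambda>z. _ * z"] sum.delta sum_distrib_left mult.assoc cong: if_cong)
  also have "\<dots> = (\<Sum>d<D. \<Sum>e<N. word_entry N D x u a e * x (entry_index e s d) * cnj (x (entry_index a' t d)))"
    by (rule sum.swap)
  finally show ?thesis by (simp add: sum_distrib_right)
qed

text \<open>Entry \<open>(a, d)\<close> of the rectangular matrix \<open>w G_s\<close>.
  Differentiating by a conjugate entry deletes one adjoint factor and leaves a word that stops in
  the middle of a letter.\<close>

definition half_entry where
  "half_entry N D x w s a d = (\<Sum>e<N. word_entry N D x w a e * x (entry_index e s d))"

lemma half_entry_Nil: "a < N \<Longrightarrow> half_entry N D x [] s a d = x (entry_index a s d)"
  by (simp add: half_entry_def of_bool_def if_distrib[of "\<lambda>z. z * _"] sum.delta cong: if_cong)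

lemma half_entry_Cons:
  "half_entry N D x ((s', t') # w) s a d
    = (\<Sum>d'<D. \<Sum>e<N. x (entry_index a s' d') * (cnj (x (entry_index e t' d')) * half_entry N D x w s e d))"
proof -
  have "half_entry N D x ((s', t') # w) s a d
    = (\<Sum>f<N. \<Sum>d'<D. \<Sum>e<N. x (entry_index a s' d') * (cnj (x (entry_index e t' d')) * (word_entry N D x w e f * x (entry_index f s d))))"
    by (simp add: half_entry_def sum_distrib_right mult.assoc)
  also have "\<dots> = (\<Sum>d'<D. \<Sum>f<N. \<Sum>e<N. x (entry_index a s' d') * (cnj (x (entry_index e t' d')) * (word_entry N D x w e f * x (entry_index f s d))))"
    by (rule sum.swap)
  also have "\<dots> = (\<Sum>d'<D. \<Sum>e<N. \<Sum>f<N. x (entry_index a s' d') * (cnj (x (entry_index e t' d')) * (word_entry N D x w e f * x (entry_index f s d))))"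
    by (intro sum.cong refl sum.swap)
  finally show ?thesis by (simp add: half_entry_def sum_distrib_left)
qed

lemma word_trace_snoc:
  "word_trace N D x (u @ [(s, t)])
    = (\<Sum>a<N. \<Sum>d<D. half_entry N D x u s a d * cnj (x (entry_index a t d)))"
  unfolding word_trace_def half_entry_def by (intro sum.cong refl word_entry_snoc) auto

locale gaussian_tensor =
  complex_gaussian_family M "tensor_indices N m D" X
  for M :: "'w measure" and N m D :: nat and X :: "tensor_index \<Rightarrow> 'w \<Rightarrow> complex"
begin

abbreviation colours :: "colour set" where "colours \<equiv> {..<m} \<times> {..<m}"

lemma entry_index_in: "a < N \<Longrightarrow> s \<in> colours \<Longrightarrow> d < D \<Longrightarrow> entry_index a s d \<in> tensor_indices N m D"
  by (auto simp: entry_index_def tensor_indices_def)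

lemma entry_index_eq_iff: "entry_index a s d = entry_index a' s' d' \<longleftrightarrow> a = a' \<and> s = s' \<and> d = d'"
  by (auto simp: entry_index_def prod_eq_iff)

abbreviation entry where "entry w a a' \<omega> \<equiv> word_entry N D (\<lambda>i. X i \<omega>) w a a'"
abbreviation half where "half w s a d \<omega> \<equiv> half_entry N D (\<lambda>i. X i \<omega>) w s a d"
abbreviation tr where "tr w \<omega> \<equiv> word_trace N D (\<lambda>i. X i \<omega>) w"

text \<open>The conjugate entry occurs in the adjoint factor of letter \<open>j\<close> when that
  factor has colour \<open>s\<^sub>0\<close>, at position \<open>(d\<^sub>0, a\<^sub>0)\<close>.
  Deleting it cuts the word into a half word ending at \<open>d\<^sub>0\<close> and a full word
  starting at \<open>a\<^sub>0\<close>.\<close>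

lemma cnj_deriv_word_entry:
  assumes "set w \<subseteq> colours \<times> colours" "a < N" "a\<^sub>0 < N" "d\<^sub>0 < D"
  shows "cnj_deriv (entry_index a\<^sub>0 s\<^sub>0 d\<^sub>0) (entry w a a')
    (\<lambda>\<omega>. \<Sum>j<length w. of_bool (snd (w ! j) = s\<^sub>0) *
       (half (take j w) (fst (w ! j)) a d\<^sub>0 \<omega> * entry (drop (Suc j) w) a\<^sub>0 a' \<omega>))"
  using assms(1,2)
proof (induction w arbitrary: a)
  case Nil
  then show ?case by (simp add: cnj_deriv_const)
next
  case (Cons p w)
  obtain s t where p: "p = (s, t)" by (cases p)
  let ?D = "\<lambda>a \<omega>. \<Sum>j<length w. of_bool (snd (w ! j) = s\<^sub>0) *
       (half (take j w) (fst (w ! j)) a d\<^sub>0 \<omega> * entry (drop (Suc j) w) a\<^sub>0 a' \<omega>)"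
  let ?x = "\<lambda>\<omega> a d. X (entry_index a s d) \<omega>" and ?y = "\<lambda>\<omega> e d. cnj (X (entry_index e t d) \<omega>)"
  \<comment> \<open>The derivative literally as the product rule assembles it, with the zero
    contributed by the factor without conjugate, so that the introduction rules can be applied
    backwards.\<close>
  let ?G = "\<lambda>\<omega>. \<Sum>d<D. \<Sum>e<N. ?x \<omega> a d * (?y \<omega> e d * ?D e \<omega>
          + of_bool (entry_index e t d = entry_index a\<^sub>0 s\<^sub>0 d\<^sub>0) * entry w e a' \<omega>)
          + 0 * (?y \<omega> e d * entry w e a' \<omega>)"
  have "cnj_deriv (entry_index a\<^sub>0 s\<^sub>0 d\<^sub>0) (entry (p # w) a a') ?G"
    unfolding p word_entry.simps using Cons.prems
    by (intro cnj_deriv_sum cnj_deriv_mult cnj_deriv_entry cnj_deriv_cnj_entry entry_index_in Cons.IH)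
      (auto simp: p)
  moreover have "?G = (\<lambda>\<omega>. \<Sum>j<length (p # w). of_bool (snd ((p # w) ! j) = s\<^sub>0) *
       (half (take j (p # w)) (fst ((p # w) ! j)) a d\<^sub>0 \<omega> * entry (drop (Suc j) (p # w)) a\<^sub>0 a' \<omega>))"
  proof
    fix \<omega>
    have "?G \<omega> = (\<Sum>d<D. \<Sum>e<N. ?x \<omega> a d * (of_bool (entry_index e t d = entry_index a\<^sub>0 s\<^sub>0 d\<^sub>0) * entry w e a' \<omega>))
       + (\<Sum>d<D. \<Sum>e<N. ?x \<omega> a d * (?y \<omega> e d * ?D e \<omega>))"
      by (simp add: sum.distrib distrib_left)
    also have "(\<Sum>d<D. \<Sum>e<N. ?x \<omega> a d * (of_bool (entry_index e t d = entry_index a\<^sub>0 s\<^sub>0 d\<^sub>0) * entry w e a' \<omega>))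
        = (\<Sum>d<D. if d = d\<^sub>0 then \<Sum>e<N. if e = a\<^sub>0 then of_bool (t = s\<^sub>0) * (?x \<omega> a d\<^sub>0 * entry w a\<^sub>0 a' \<omega>) else 0 else 0)"
      by (intro sum.cong refl) (auto simp: entry_index_eq_iff of_bool_def
          if_distrib[of "\<lambda>z. _ * z"] if_distrib[of "\<lambda>z. z * _"] cong: if_cong)
    also have "\<dots> = of_bool (t = s\<^sub>0) * (?x \<omega> a d\<^sub>0 * entry w a\<^sub>0 a' \<omega>)"
      using assms(3,4) by (simp add: sum.delta)
    also have "(\<Sum>d<D. \<Sum>e<N. ?x \<omega> a d * (?y \<omega> e d * ?D e \<omega>))
      = (\<Sum>d<D. \<Sum>e<N. \<Sum>j<length w. of_bool (snd (w ! j) = s\<^sub>0) *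
       (?x \<omega> a d * (?y \<omega> e d * half (take j w) (fst (w ! j)) e d\<^sub>0 \<omega>) * entry (drop (Suc j) w) a\<^sub>0 a' \<omega>))"
      by (simp only: sum_distrib_left mult_ac)
    also have "\<dots> = (\<Sum>d<D. \<Sum>j<length w. \<Sum>e<N. of_bool (snd (w ! j) = s\<^sub>0) *
       (?x \<omega> a d * (?y \<omega> e d * half (take j w) (fst (w ! j)) e d\<^sub>0 \<omega>) * entry (drop (Suc j) w) a\<^sub>0 a' \<omega>))"
      by (intro sum.cong refl sum.swap)
    also have "\<dots> = (\<Sum>j<length w. \<Sum>d<D. \<Sum>e<N. of_bool (snd (w ! j) = s\<^sub>0) *
       (?x \<omega> a d * (?y \<omega> e d * half (take j w) (fst (w ! j)) e d\<^sub>0 \<omega>) * entry (drop (Suc j) w) a\<^sub>0 a' \<omega>))"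
      by (rule sum.swap)
    also have "\<dots> = (\<Sum>j<length w. of_bool (snd (w ! j) = s\<^sub>0) *
       (half (p # take j w) (fst (w ! j)) a d\<^sub>0 \<omega> * entry (drop (Suc j) w) a\<^sub>0 a' \<omega>))"
      unfolding p half_entry_Cons by (simp add: sum_distrib_left sum_distrib_right)
    finally show "?G \<omega> = (\<Sum>j<length (p # w). of_bool (snd ((p # w) ! j) = s\<^sub>0) *
       (half (take j (p # w)) (fst ((p # w) ! j)) a d\<^sub>0 \<omega> * entry (drop (Suc j) (p # w)) a\<^sub>0 a' \<omega>))"
      using Cons.prems by (simp add: sum.lessThan_Suc_shift half_entry_Nil p del: sum.lessThan_Suc)
  qed
  ultimately show ?case by simp
qed

text \<open>Closing the trace puts the right piece of the cut word in front of the left piece: the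
  word is rotated so that it starts just after the deleted factor.\<close>

lemma cnj_deriv_word_trace:
  assumes "set w \<subseteq> colours \<times> colours" "a\<^sub>0 < N" "d\<^sub>0 < D"
  shows "cnj_deriv (entry_index a\<^sub>0 s\<^sub>0 d\<^sub>0) (tr w)
    (\<lambda>\<omega>. \<Sum>j<length w. of_bool (snd (w ! j) = s\<^sub>0) *
       half (drop (Suc j) w @ take j w) (fst (w ! j)) a\<^sub>0 d\<^sub>0 \<omega>)"
proof -
  have "cnj_deriv (entry_index a\<^sub>0 s\<^sub>0 d\<^sub>0) (tr w) (\<lambda>\<omega>. \<Sum>a<N. \<Sum>j<length w. of_bool (snd (w ! j) = s\<^sub>0) *
       (half (take j w) (fst (w ! j)) a d\<^sub>0 \<omega> * entry (drop (Suc j) w) a\<^sub>0 a \<omega>))"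
    unfolding word_trace_def[abs_def] using assms
    by (intro cnj_deriv_sum cnj_deriv_word_entry) auto
  moreover have "(\<Sum>a<N. \<Sum>j<length w. of_bool (snd (w ! j) = s\<^sub>0) *
       (half (take j w) (fst (w ! j)) a d\<^sub>0 \<omega> * entry (drop (Suc j) w) a\<^sub>0 a \<omega>))
     = (\<Sum>j<length w. of_bool (snd (w ! j) = s\<^sub>0) *
       half (drop (Suc j) w @ take j w) (fst (w ! j)) a\<^sub>0 d\<^sub>0 \<omega>)" for \<omega>
  proof -
    have *: "half (drop (Suc j) w @ take j w) (fst (w ! j)) a\<^sub>0 d\<^sub>0 \<omega>
        = (\<Sum>a<N. half (take j w) (fst (w ! j)) a d\<^sub>0 \<omega> * entry (drop (Suc j) w) a\<^sub>0 a \<omega>)" for j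
      using assms unfolding half_entry_def
      by (simp add: word_entry_append sum_distrib_right sum_distrib_left mult_ac) (rule sum.swap)
    show ?thesis
      unfolding * by (subst sum.swap) (simp add: sum_distrib_left)
  qed
  ultimately show ?thesis by simp
qed

definition trace_moment :: "(colour \<times> colour) list list \<Rightarrow> complex" where
  "trace_moment ws = (\<integral>\<omega>. (\<Prod>w\<leftarrow>ws. tr w \<omega>) \<partial>M)"

lemma integral_double_sum:
  fixes f :: "nat \<Rightarrow> nat \<Rightarrow> 'w \<Rightarrow> complex"
  assumes "\<And>i j. i < k \<Longrightarrow> j < l i \<Longrightarrow> integrable M (f i j)"
  shows "(\<integral>\<omega>. (\<Sum>i<k. \<Sum>j<l i. f i j \<omega>) \<partial>M) = (\<Sum>i<k. \<Sum>j<l i. \<integral>\<omega>. f i j \<omega> \<partial>M)"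
proof -
  have "(\<integral>\<omega>. (\<Sum>i<k. \<Sum>j<l i. f i j \<omega>) \<partial>M) = (\<Sum>i<k. \<integral>\<omega>. (\<Sum>j<l i. f i j \<omega>) \<partial>M)"
    by (rule Bochner_Integration.integral_sum) (auto intro!: assms Bochner_Integration.integrable_sum)
  also have "\<dots> = (\<Sum>i<k. \<Sum>j<l i. \<integral>\<omega>. f i j \<omega> \<partial>M)"
    by (intro sum.cong refl Bochner_Integration.integral_sum) (auto intro: assms)
  finally show ?thesis .
qed

lemma trace_moment_empty: "trace_moment [] = 1"
  by (simp add: trace_moment_def prob_space)

lemma trace_moment_Nil: "trace_moment ([] # ws) = of_nat N * trace_moment ws"
  by (simp add: trace_moment_def word_trace_Nil)

lemma integrable_trace_product:
  assumes "\<forall>w\<in>set ws. set w \<subseteq> colours \<times> colours"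
  shows "integrable M (\<lambda>\<omega>. \<Prod>w\<leftarrow>ws. tr w \<omega>)"
proof (cases "N > 0 \<and> D > 0")
  case True
  \<comment> \<open>Any entry would do: a function with a formal derivative is a polynomial in the
    tensor entries and hence integrable. Only row 0 and column 0 must exist; otherwise the traces
    are constants.\<close>
  have "cnj_deriv (entry_index 0 (0, 0) 0) (tr w)
     (\<lambda>\<omega>. \<Sum>j<length w. of_bool (snd (w ! j) = (0, 0)) *
       half (drop (Suc j) w @ take j w) (fst (w ! j)) 0 0 \<omega>)" if "w \<in> set ws" for w
    using assms True that by (intro cnj_deriv_word_trace) auto
  from cnj_deriv_integrable[OF cnj_deriv_prod_list[where F = "\<lambda>w. tr w", OF this]]
  show ?thesis by simp
next
  case False
  have "\<exists>C. \<forall>\<omega>. tr w \<omega> = C" for w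
  proof (cases w)
    case (Cons p w')
    then show ?thesis using False by (cases p) (auto simp: word_trace_def)
  qed (simp add: word_trace_Nil)
  then obtain C where "tr w \<omega> = C w" for w \<omega> by metis
  then show ?thesis by simp
qed

text \<open>Integration by parts is applied to the entry of \<open>G_s\<close> that opens the first
  trace. Its conjugate partner lies in the adjoint of the same letter, further along the same word,
  or in another word. In the last two cases the adjoint of \<open>G_t\<close> is cut off from its
  neighbour and reattached, by cyclicity, to the \<open>G\<close> exposed by the deletion; this
  produces the letter with first colour \<open>fst (w ! j)\<close> or
  \<open>fst (ws ! l ! j)\<close> and second colour \<open>t\<close>.\<close>

lemma trace_moment_loop_equation:
  assumes "set ((s, t) # w) \<subseteq> colours \<times> colours" "\<forall>w\<in>set ws. set w \<subseteq> colours \<times> colours"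
  shows "trace_moment (((s, t) # w) # ws) =
      of_bool (t = s) * of_nat D * trace_moment (w # ws)
    + (\<Sum>j<length w. of_bool (snd (w ! j) = s) *
         trace_moment ((take j w @ [(fst (w ! j), t)]) # drop (Suc j) w # ws))
    + (\<Sum>l<length ws. \<Sum>j<length (ws ! l). of_bool (snd (ws ! l ! j) = s) *
         trace_moment ((w @ drop (Suc j) (ws ! l) @ take j (ws ! l) @ [(fst (ws ! l ! j), t)])
           # take l ws @ drop (Suc l) ws))"
proof -
  let ?F = "\<lambda>\<omega>. \<Prod>w\<leftarrow>ws. tr w \<omega>" and ?ws = "\<lambda>l \<omega>. \<Prod>w\<leftarrow>take l ws @ drop (Suc l) ws. tr w \<omega>"
  let ?y = "\<lambda>e d \<omega>. cnj (X (entry_index e t d) \<omega>)"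
  let ?D1 = "\<lambda>e a d \<omega>. \<Sum>j<length w. of_bool (snd (w ! j) = s) *
       (half (take j w) (fst (w ! j)) e d \<omega> * entry (drop (Suc j) w) a a \<omega>)"
  let ?D2 = "\<lambda>a d \<omega>. \<Sum>l<length ws. (\<Sum>j<length (ws ! l). of_bool (snd (ws ! l ! j) = s) *
       half (drop (Suc j) (ws ! l) @ take j (ws ! l)) (fst (ws ! l ! j)) a d \<omega>) * ?ws l \<omega>"
  let ?G = "\<lambda>a d \<omega>. \<Sum>e<N. ?y e d \<omega> * (entry w e a \<omega> * ?D2 a d \<omega> + ?D1 e a d \<omega> * ?F \<omega>)
          + of_bool (entry_index e t d = entry_index a s d) * (entry w e a \<omega> * ?F \<omega>)"
  let ?H = "\<lambda>a d \<omega>. \<Sum>e<N. ?y e d \<omega> * (entry w e a \<omega> * ?F \<omega>)"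
  have s: "s \<in> colours" and t: "t \<in> colours" using assms by auto
  have deriv: "cnj_deriv (entry_index a s d) (?H a d) (?G a d)" if "a < N" "d < D" for a d
    using assms that
    by (intro cnj_deriv_sum cnj_deriv_mult cnj_deriv_cnj_entry entry_index_in
        cnj_deriv_word_entry cnj_deriv_prod_list cnj_deriv_word_trace) auto
  have parts: "integrable M (\<lambda>\<omega>. X (entry_index a s d) \<omega> * ?H a d \<omega>)" "integrable M (?G a d)"
     "(\<integral>\<omega>. X (entry_index a s d) \<omega> * ?H a d \<omega> \<partial>M) = (\<integral>\<omega>. ?G a d \<omega> \<partial>M)" if "a < N" "d < D" for a d
    using cnj_deriv_by_parts[OF deriv[OF that] entry_index_in[OF that(1) s that(2)]] by auto
  have "trace_moment (((s, t) # w) # ws) = (\<integral>\<omega>. (\<Sum>a<N. \<Sum>d<D. X (entry_index a s d) \<omega> * ?H a d \<omega>) \<partial>M)"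
    by (simp add: trace_moment_def word_trace_def sum_distrib_left sum_distrib_right mult.assoc)
  also have "\<dots> = (\<Sum>a<N. \<Sum>d<D. \<integral>\<omega>. X (entry_index a s d) \<omega> * ?H a d \<omega> \<partial>M)"
    using parts(1) by (intro integral_double_sum) auto
  also have "\<dots> = (\<Sum>a<N. \<Sum>d<D. \<integral>\<omega>. ?G a d \<omega> \<partial>M)"
    using parts(3) by simp
  also have "\<dots> = (\<integral>\<omega>. (\<Sum>a<N. \<Sum>d<D. ?G a d \<omega>) \<partial>M)"
    using parts(2) by (intro integral_double_sum[symmetric]) auto
  also have "\<dots> = (\<integral>\<omega>. of_bool (t = s) * of_nat D * (tr w \<omega> * ?F \<omega>)
    + (\<Sum>j<length w. of_bool (snd (w ! j) = s) *
         (tr (take j w @ [(fst (w ! j), t)]) \<omega> * (tr (drop (Suc j) w) \<omega> * ?F \<omega>)))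
    + (\<Sum>l<length ws. \<Sum>j<length (ws ! l). of_bool (snd (ws ! l ! j) = s) *
         (tr ((w @ drop (Suc j) (ws ! l) @ take j (ws ! l)) @ [(fst (ws ! l ! j), t)]) \<omega>
           * ?ws l \<omega>)) \<partial>M)"
  proof (rule Bochner_Integration.integral_cong[OF refl])
    fix \<omega>
    \<comment> \<open>Matching the two entries forces \<open>e = a\<close> and \<open>t = s\<close>
      and leaves \<open>d\<close> free, whence the factor \<open>D\<close>.\<close>
    have 1: "(\<Sum>a<N. \<Sum>d<D. \<Sum>e<N. of_bool (entry_index e t d = entry_index a s d) * (entry w e a \<omega> * ?F \<omega>))
       = of_bool (t = s) * of_nat D * (tr w \<omega> * ?F \<omega>)"
    proof -
      have "(\<Sum>a<N. \<Sum>d<D. \<Sum>e<N. of_bool (entry_index e t d = entry_index a s d) * (entry w e a \<omega> * ?F \<omega>))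
        = (\<Sum>a<N. \<Sum>d<D. \<Sum>e<N. if e = a then of_bool (t = s) * (entry w a a \<omega> * ?F \<omega>) else 0)"
        by (intro sum.cong refl) (auto simp: entry_index_eq_iff)
      also have "\<dots> = (\<Sum>a<N. of_nat D * (of_bool (t = s) * (entry w a a \<omega> * ?F \<omega>)))"
        by (intro sum.cong refl) (simp add: sum.delta)
      finally show ?thesis by (simp add: word_trace_def sum_distrib_left sum_distrib_right mult_ac)
    qed
    have 2: "(\<Sum>a<N. \<Sum>d<D. \<Sum>e<N. ?y e d \<omega> * (?D1 e a d \<omega> * ?F \<omega>))
      = (\<Sum>j<length w. of_bool (snd (w ! j) = s) *
         (tr (take j w @ [(fst (w ! j), t)]) \<omega> * (tr (drop (Suc j) w) \<omega> * ?F \<omega>)))"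
      (is "?L = ?R")
    proof -
      let ?q = "\<lambda>a d e j. of_bool (snd (w ! j) = s) * (half (take j w) (fst (w ! j)) e d \<omega> * ?y e d \<omega>
         * (entry (drop (Suc j) w) a a \<omega> * ?F \<omega>))"
      have "?L = (\<Sum>a<N. \<Sum>d<D. \<Sum>e<N. \<Sum>j<length w. ?q a d e j)"
        by (simp only: sum_distrib_left sum_distrib_right mult_ac)
      also have "\<dots> = (\<Sum>a<N. \<Sum>e<N. \<Sum>d<D. \<Sum>j<length w. ?q a d e j)"
        by (intro sum.cong refl sum.swap)
      also have "\<dots> = (\<Sum>a<N. \<Sum>e<N. \<Sum>j<length w. \<Sum>d<D. ?q a d e j)"
        by (intro sum.cong refl sum.swap)
      also have "\<dots> = (\<Sum>a<N. \<Sum>j<length w. \<Sum>e<N. \<Sum>d<D. ?q a d e j)"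
        by (intro sum.cong refl sum.swap)
      also have "\<dots> = (\<Sum>j<length w. \<Sum>a<N. \<Sum>e<N. \<Sum>d<D. ?q a d e j)"
        by (rule sum.swap)
      also have "\<dots> = (\<Sum>j<length w. \<Sum>a<N. of_bool (snd (w ! j) = s) *
         (tr (take j w @ [(fst (w ! j), t)]) \<omega> * (entry (drop (Suc j) w) a a \<omega> * ?F \<omega>)))"
        by (simp add: word_trace_snoc sum_distrib_left sum_distrib_right)
      also have "\<dots> = ?R"
        by (simp add: word_trace_def[of _ _ _ "drop _ _"] sum_distrib_left sum_distrib_right)
      finally show ?thesis .
    qed
    have 3: "(\<Sum>a<N. \<Sum>d<D. \<Sum>e<N. ?y e d \<omega> * (entry w e a \<omega> * ?D2 a d \<omega>))
      = (\<Sum>l<length ws. \<Sum>j<length (ws ! l). of_bool (snd (ws ! l ! j) = s) *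
         (tr ((w @ drop (Suc j) (ws ! l) @ take j (ws ! l)) @ [(fst (ws ! l ! j), t)]) \<omega>
           * ?ws l \<omega>))" (is "?L = ?R")
    proof -
      let ?h = "\<lambda>l j a d. half (drop (Suc j) (ws ! l) @ take j (ws ! l)) (fst (ws ! l ! j)) a d \<omega>"
      let ?q = "\<lambda>a d e l j. of_bool (snd (ws ! l ! j) = s) * (entry w e a \<omega> * ?h l j a d * ?y e d \<omega> * ?ws l \<omega>)"
      have half: "half (w @ drop (Suc j) (ws ! l) @ take j (ws ! l)) (fst (ws ! l ! j)) e d \<omega>
          = (\<Sum>a<N. entry w e a \<omega> * ?h l j a d)" if "e < N" for e d l j
      proof -
        have "half (w @ v) s' e d \<omega> = (\<Sum>a<N. entry w e a \<omega> * half v s' a d \<omega>)" for v s'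
          using that unfolding half_entry_def
          by (simp add: word_entry_append sum_distrib_right sum_distrib_left mult.assoc) (rule sum.swap)
        then show ?thesis by simp
      qed
      have "?L = (\<Sum>a<N. \<Sum>d<D. \<Sum>e<N. \<Sum>l<length ws. \<Sum>j<length (ws ! l). ?q a d e l j)"
        by (simp only: sum_distrib_left sum_distrib_right mult_ac)
      also have "\<dots> = (\<Sum>a<N. \<Sum>e<N. \<Sum>d<D. \<Sum>l<length ws. \<Sum>j<length (ws ! l). ?q a d e l j)"
        by (intro sum.cong refl sum.swap)
      also have "\<dots> = (\<Sum>e<N. \<Sum>a<N. \<Sum>d<D. \<Sum>l<length ws. \<Sum>j<length (ws ! l). ?q a d e l j)"
        by (rule sum.swap)
      also have "\<dots> = (\<Sum>e<N. \<Sum>d<D. \<Sum>a<N. \<Sum>l<length ws. \<Sum>j<length (ws ! l). ?q a d e l j)"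
        by (intro sum.cong refl sum.swap)
      also have "\<dots> = (\<Sum>e<N. \<Sum>d<D. \<Sum>l<length ws. \<Sum>a<N. \<Sum>j<length (ws ! l). ?q a d e l j)"
        by (intro sum.cong refl sum.swap)
      also have "\<dots> = (\<Sum>e<N. \<Sum>d<D. \<Sum>l<length ws. \<Sum>j<length (ws ! l). \<Sum>a<N. ?q a d e l j)"
        by (intro sum.cong refl sum.swap)
      also have "\<dots> = (\<Sum>e<N. \<Sum>l<length ws. \<Sum>d<D. \<Sum>j<length (ws ! l). \<Sum>a<N. ?q a d e l j)"
        by (intro sum.cong refl sum.swap)
      also have "\<dots> = (\<Sum>l<length ws. \<Sum>e<N. \<Sum>d<D. \<Sum>j<length (ws ! l). \<Sum>a<N. ?q a d e l j)"
        by (rule sum.swap)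
      also have "\<dots> = (\<Sum>l<length ws. \<Sum>e<N. \<Sum>j<length (ws ! l). \<Sum>d<D. \<Sum>a<N. ?q a d e l j)"
        by (intro sum.cong refl sum.swap)
      also have "\<dots> = (\<Sum>l<length ws. \<Sum>j<length (ws ! l). \<Sum>e<N. \<Sum>d<D. \<Sum>a<N. ?q a d e l j)"
        by (intro sum.cong refl sum.swap)
      also have "\<dots> = (\<Sum>l<length ws. \<Sum>j<length (ws ! l). \<Sum>e<N. \<Sum>d<D. of_bool (snd (ws ! l ! j) = s) *
         (half (w @ drop (Suc j) (ws ! l) @ take j (ws ! l)) (fst (ws ! l ! j)) e d \<omega> * ?y e d \<omega> * ?ws l \<omega>))"
        by (intro sum.cong refl) (simp add: half sum_distrib_left sum_distrib_right)
      also have "\<dots> = ?R"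
        by (intro sum.cong refl, subst word_trace_snoc) (simp only: sum_distrib_left sum_distrib_right mult.assoc)
      finally show ?thesis .
    qed
    have "(\<Sum>a<N. \<Sum>d<D. ?G a d \<omega>)
      = (\<Sum>a<N. \<Sum>d<D. \<Sum>e<N. ?y e d \<omega> * (entry w e a \<omega> * ?D2 a d \<omega>))
      + (\<Sum>a<N. \<Sum>d<D. \<Sum>e<N. ?y e d \<omega> * (?D1 e a d \<omega> * ?F \<omega>))
      + (\<Sum>a<N. \<Sum>d<D. \<Sum>e<N. of_bool (entry_index e t d = entry_index a s d) * (entry w e a \<omega> * ?F \<omega>))"
      by (simp only: sum.distrib distrib_left)
    then show "(\<Sum>a<N. \<Sum>d<D. ?G a d \<omega>) = of_bool (t = s) * of_nat D * (tr w \<omega> * ?F \<omega>)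
      + (\<Sum>j<length w. of_bool (snd (w ! j) = s) *
           (tr (take j w @ [(fst (w ! j), t)]) \<omega> * (tr (drop (Suc j) w) \<omega> * ?F \<omega>)))
      + (\<Sum>l<length ws. \<Sum>j<length (ws ! l). of_bool (snd (ws ! l ! j) = s) *
           (tr ((w @ drop (Suc j) (ws ! l) @ take j (ws ! l)) @ [(fst (ws ! l ! j), t)]) \<omega>
             * ?ws l \<omega>))"
      unfolding 1 2 3 by (simp only: add_ac)
  qed
  also have "\<dots> = of_bool (t = s) * of_nat D * trace_moment (w # ws)
    + (\<Sum>j<length w. of_bool (snd (w ! j) = s) *
         trace_moment ((take j w @ [(fst (w ! j), t)]) # drop (Suc j) w # ws))
    + (\<Sum>l<length ws. \<Sum>j<length (ws ! l). of_bool (snd (ws ! l ! j) = s) *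
         trace_moment ((w @ drop (Suc j) (ws ! l) @ take j (ws ! l) @ [(fst (ws ! l ! j), t)])
           # take l ws @ drop (Suc l) ws))"
  proof -
    have w: "set w \<subseteq> colours \<times> colours" using assms by simp
    have j: "fst (v ! j) \<in> colours" if "set v \<subseteq> colours \<times> colours" "j < length v" for v j
      using subsetD[OF that(1) nth_mem[OF that(2)]] by (simp add: mem_Times_iff)
    have i1: "integrable M (\<lambda>\<omega>. tr w \<omega> * ?F \<omega>)"
      using integrable_trace_product[of "w # ws"] assms by simp
    have i2: "integrable M (\<lambda>\<omega>. tr (take j w @ [(fst (w ! j), t)]) \<omega> * (tr (drop (Suc j) w) \<omega> * ?F \<omega>))"
      if "j < length w" for j
      using integrable_trace_product[of "(take j w @ [(fst (w ! j), t)]) # drop (Suc j) w # ws"]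
        assms w t j[OF w that] set_take_subset[of j w] set_drop_subset[of "Suc j" w] by auto
    have i3: "integrable M (\<lambda>\<omega>. tr ((w @ drop (Suc j) (ws ! l) @ take j (ws ! l)) @ [(fst (ws ! l ! j), t)]) \<omega>
             * ?ws l \<omega>)" if l: "l < length ws" and jl: "j < length (ws ! l)" for l j
    proof -
      have wl: "set (ws ! l) \<subseteq> colours \<times> colours" using assms l by simp
      have ws: "set (take l ws @ drop (Suc l) ws) \<subseteq> set ws"
        using set_take_subset[of l ws] set_drop_subset[of "Suc l" ws] by simp
      have "\<forall>v\<in>set (((w @ drop (Suc j) (ws ! l) @ take j (ws ! l)) @ [(fst (ws ! l ! j), t)])
          # take l ws @ drop (Suc l) ws). set v \<subseteq> colours \<times> colours"
        using assms(2) ws w wl t j[OF wl jl] set_take_subset[of j "ws ! l"] set_drop_subset[of "Suc j" "ws ! l"]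
        by (simp only: list.set set_append ball_simps Un_iff) (use assms in auto)
      from integrable_trace_product[OF this] show ?thesis by simp
    qed
    let ?T2 = "\<lambda>j \<omega>. tr (take j w @ [(fst (w ! j), t)]) \<omega> * (tr (drop (Suc j) w) \<omega> * ?F \<omega>)"
    let ?T3 = "\<lambda>l j \<omega>. tr ((w @ drop (Suc j) (ws ! l) @ take j (ws ! l)) @ [(fst (ws ! l ! j), t)]) \<omega> * ?ws l \<omega>"
    let ?c2 = "\<lambda>j. of_bool (snd (w ! j) = s) :: complex"
    let ?c3 = "\<lambda>l j. of_bool (snd (ws ! l ! j) = s) :: complex"
    have j1: "integrable M (\<lambda>\<omega>. of_bool (t = s) * of_nat D * (tr w \<omega> * ?F \<omega>))"
      by (rule integrable_mult_right[OF i1])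
    have j2: "integrable M (\<lambda>\<omega>. \<Sum>j<length w. ?c2 j * ?T2 j \<omega>)"
      by (intro Bochner_Integration.integrable_sum integrable_mult_right i2) simp
    have j3: "integrable M (\<lambda>\<omega>. \<Sum>l<length ws. \<Sum>j<length (ws ! l). ?c3 l j * ?T3 l j \<omega>)"
      by (intro Bochner_Integration.integrable_sum integrable_mult_right i3) simp_all
    have "(\<integral>\<omega>. (\<Sum>j<length w. ?c2 j * ?T2 j \<omega>) \<partial>M) = (\<Sum>j<length w. ?c2 j * (\<integral>\<omega>. ?T2 j \<omega> \<partial>M))"
      by (subst Bochner_Integration.integral_sum) (auto simp only: lessThan_iff integral_mult_right_zero intro!: integrable_mult_right i2)
    moreover have "(\<integral>\<omega>. (\<Sum>l<length ws. \<Sum>j<length (ws ! l). ?c3 l j * ?T3 l j \<omega>) \<partial>M)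
        = (\<Sum>l<length ws. \<Sum>j<length (ws ! l). ?c3 l j * (\<integral>\<omega>. ?T3 l j \<omega> \<partial>M))"
      by (subst integral_double_sum) (auto simp only: integral_mult_right_zero intro!: integrable_mult_right i3)
    moreover have "(\<integral>\<omega>. of_bool (t = s) * of_nat D * (tr w \<omega> * ?F \<omega>) \<partial>M)
        = of_bool (t = s) * of_nat D * (\<integral>\<omega>. tr w \<omega> * ?F \<omega> \<partial>M)"
      by (rule integral_mult_right_zero)
    ultimately show ?thesis
      using Bochner_Integration.integral_add[OF Bochner_Integration.integrable_add[OF j1 j2] j3]
        Bochner_Integration.integral_add[OF j1 j2]
      by (simp only: trace_moment_def list.map prod_list.Cons append_assoc)
  qed
  finally show ?thesis .
qed

end

section \<open>The planar limit\<close>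

text \<open>The planar part of the loop equation: terms that merge two traces are suppressed by \<open>N\<^sup>-\<^sup>2\<close>.\<close>

function planar_moment :: "complex \<Rightarrow> ('s \<times> 's) list \<Rightarrow> complex" where
  "planar_moment c [] = 1"
| "planar_moment c ((s, t) # w) = of_bool (t = s) * c * planar_moment c w
     + (\<Sum>j<length w. of_bool (snd (w ! j) = s) *
         (planar_moment c (take j w @ [(fst (w ! j), t)]) * planar_moment c (drop (Suc j) w)))"
  by pat_completeness auto
termination by (relation "Wellfounded.measure (\<lambda>(c, w). length w)") auto

text \<open>The exponent counts letters plus traces. The first term of the loop equation loses a
  letter and is compensated by \<open>D / N\<close>; a split loses a letter but gains a trace; a
  merge loses one of each, which leaves the vanishing factor \<open>1 / N^2\<close>.\<close>

lemma trace_moment_limit: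
  fixes M :: "nat \<Rightarrow> 'w measure"
  assumes tensor: "\<And>N. N \<ge> 1 \<Longrightarrow> gaussian_tensor (M N) N m (D N) (X N)"
    and D: "(\<lambda>N. of_nat (D N) / of_nat N) \<longlonglongrightarrow> c"
    and ws: "\<forall>w\<in>set ws. set w \<subseteq> ({..<m} \<times> {..<m}) \<times> ({..<m} \<times> {..<m})"
  shows "(\<lambda>N. gaussian_tensor.trace_moment (M N) N (D N) (X N) ws
      / of_nat N ^ (sum_list (map length ws) + length ws)) \<longlonglongrightarrow> (\<Prod>w\<leftarrow>ws. planar_moment c w)"
  using ws
\<comment> \<open>A split deletes a letter and adds a trace. With weight 2 for letters and 1 for
  traces this is still a decrease, and so is dropping an empty word.\<close>
proof (induction "sum_list (map (\<lambda>w. 2 * length w + 1) ws)" arbitrary: ws rule: less_induct)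
  case less
  let ?E = "\<lambda>N ws. gaussian_tensor.trace_moment (M N) N (D N) (X N) ws"
  let ?e = "\<lambda>ws. sum_list (map length ws) + length ws"
  let ?R = "\<lambda>N ws. ?E N ws / of_nat N ^ ?e ws"
  let ?C = "({..<m} \<times> {..<m}) \<times> ({..<m} \<times> {..<m}) :: (colour \<times> colour) set"
  show ?case
  proof (cases ws)
    case Nil
    have "eventually (\<lambda>N. ?R N ws = 1) sequentially"
      using eventually_ge_at_top[of 1]
      by eventually_elim (simp add: Nil gaussian_tensor.trace_moment_empty[OF tensor])
    then show ?thesis by (simp add: Nil tendsto_eventually)
  next
    case (Cons w' ws')
    show ?thesis
    proof (cases w')
      case Nil
      have "eventually (\<lambda>N. ?R N ws' = ?R N ws) sequentially"
        using eventually_ge_at_top[of 1]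
        by eventually_elim (simp add: Cons Nil gaussian_tensor.trace_moment_Nil[OF tensor])
      moreover have "(\<lambda>N. ?R N ws') \<longlonglongrightarrow> (\<Prod>w\<leftarrow>ws'. planar_moment c w)"
        using less.prems by (intro less.hyps) (auto simp: Cons)
      ultimately have "(\<lambda>N. ?R N ws) \<longlonglongrightarrow> (\<Prod>w\<leftarrow>ws'. planar_moment c w)"
        by (rule Lim_transform_eventually[rotated])
      then show ?thesis by (simp add: Cons Nil)
    next
      case w': (Cons p w)
      obtain s t where p: "p = (s, t)" by (cases p)
      have w: "set w \<subseteq> ?C" and st: "s \<in> {..<m} \<times> {..<m}" "t \<in> {..<m} \<times> {..<m}"
        and ws': "\<forall>w\<in>set ws'. set w \<subseteq> ?C"
        using less.prems by (auto simp: Cons w' p)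
      have fst_nth: "fst (v ! j) \<in> {..<m} \<times> {..<m}" if "set v \<subseteq> ?C" "j < length v" for v j
        using subsetD[OF that(1) nth_mem[OF that(2)]] by (simp add: mem_Times_iff)
      let ?v1 = "w # ws'"
      let ?v2 = "\<lambda>j. (take j w @ [(fst (w ! j), t)]) # drop (Suc j) w # ws'"
      let ?v3 = "\<lambda>l j. (w @ drop (Suc j) (ws' ! l) @ take j (ws' ! l) @ [(fst (ws' ! l ! j), t)])
         # take l ws' @ drop (Suc l) ws'"
      have lim1: "(\<lambda>N. ?R N ?v1) \<longlonglongrightarrow> (\<Prod>w\<leftarrow>?v1. planar_moment c w)"
        using w ws' by (intro less.hyps) (auto simp: Cons w' p)
      have e1: "?e ws = ?e ?v1 + 1"
        by (simp add: Cons w')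
      have lim2: "(\<lambda>N. ?R N (?v2 j)) \<longlonglongrightarrow> (\<Prod>w\<leftarrow>?v2 j. planar_moment c w)"
        and e2: "?e ws = ?e (?v2 j)" if j: "j < length w" for j
      proof -
        show "(\<lambda>N. ?R N (?v2 j)) \<longlonglongrightarrow> (\<Prod>w\<leftarrow>?v2 j. planar_moment c w)"
        proof (rule less.hyps)
          show "\<forall>v\<in>set (?v2 j). set v \<subseteq> ?C"
            using w ws' st fst_nth[OF w j] set_take_subset[of j w] set_drop_subset[of "Suc j" w] by auto
        qed (use j in \<open>simp add: Cons w'\<close>)
        show "?e ws = ?e (?v2 j)"
          using j by (simp add: Cons w')
      qed
      have lim3: "(\<lambda>N. ?R N (?v3 l j)) \<longlonglongrightarrow> (\<Prod>w\<leftarrow>?v3 l j. planar_moment c w)"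
        and e3: "?e ws = ?e (?v3 l j) + 2" if l: "l < length ws'" and j: "j < length (ws' ! l)" for l j
      proof -
        have split: "ws' = take l ws' @ ws' ! l # drop (Suc l) ws'"
          using l by (rule id_take_nth_drop)
        have sum: "sum_list (map f ws') = sum_list (map f (take l ws')) + (f (ws' ! l) + sum_list (map f (drop (Suc l) ws')))"
          for f :: "_ \<Rightarrow> nat"
          by (subst split) (simp only: map_append sum_list_append list.map sum_list.Cons)
        show "(\<lambda>N. ?R N (?v3 l j)) \<longlonglongrightarrow> (\<Prod>w\<leftarrow>?v3 l j. planar_moment c w)"
        proof (rule less.hyps)
          have wl: "set (ws' ! l) \<subseteq> ?C" using ws' l by simp
          have others: "set (take l ws' @ drop (Suc l) ws') \<subseteq> set ws'"
            using set_take_subset[of l ws'] set_drop_subset[of "Suc l" ws'] by simp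
          have "set (take j (ws' ! l)) \<subseteq> ?C" "set (drop (Suc j) (ws' ! l)) \<subseteq> ?C"
            using wl set_take_subset[of j "ws' ! l"] set_drop_subset[of "Suc j" "ws' ! l"] by blast+
          moreover have "(fst (ws' ! l ! j), t) \<in> ?C"
            using fst_nth[OF wl j] st by simp
          ultimately have "set (w @ drop (Suc j) (ws' ! l) @ take j (ws' ! l) @ [(fst (ws' ! l ! j), t)]) \<subseteq> ?C"
            using w by (simp only: set_append list.set Un_subset_iff insert_subset) simp
          then show "\<forall>v\<in>set (?v3 l j). set v \<subseteq> ?C"
            using others ws' unfolding list.set(2) by blast
          show "(\<Sum>w\<leftarrow>?v3 l j. 2 * length w + 1) < (\<Sum>w\<leftarrow>ws. 2 * length w + 1)"
            using j sum[of "\<lambda>w. 2 * length w + 1"] unfolding Cons w' by simp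
        qed
        show "?e ws = ?e (?v3 l j) + 2"
          using j l unfolding Cons w' by (subst list.map, subst sum_list.Cons, subst sum) simp
      qed
      let ?S = "\<lambda>N. of_bool (t = s) * (of_nat (D N) / of_nat N) * ?R N ?v1
        + (\<Sum>j<length w. of_bool (snd (w ! j) = s) * ?R N (?v2 j))
        + (\<Sum>l<length ws'. \<Sum>j<length (ws' ! l). of_bool (snd (ws' ! l ! j) = s) * (?R N (?v3 l j) * (1 / of_nat N ^ 2)))"
      have "(\<lambda>N. 1 / of_nat N ^ 2 :: complex) \<longlonglongrightarrow> 0"
        using tendsto_power[OF lim_1_over_n, of 2] by (simp add: power_divide)
      then have "?S \<longlonglongrightarrow> of_bool (t = s) * c * (\<Prod>w\<leftarrow>?v1. planar_moment c w)
        + (\<Sum>j<length w. of_bool (snd (w ! j) = s) * (\<Prod>w\<leftarrow>?v2 j. planar_moment c w))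
        + (\<Sum>l<length ws'. \<Sum>j<length (ws' ! l). of_bool (snd (ws' ! l ! j) = s) * ((\<Prod>w\<leftarrow>?v3 l j. planar_moment c w) * 0))"
        by (intro tendsto_intros D lim1 lim2 lim3) auto
      also have "of_bool (t = s) * c * (\<Prod>w\<leftarrow>?v1. planar_moment c w)
        + (\<Sum>j<length w. of_bool (snd (w ! j) = s) * (\<Prod>w\<leftarrow>?v2 j. planar_moment c w))
        + (\<Sum>l<length ws'. \<Sum>j<length (ws' ! l). of_bool (snd (ws' ! l ! j) = s) * ((\<Prod>w\<leftarrow>?v3 l j. planar_moment c w) * 0))
        = (\<Prod>w\<leftarrow>ws. planar_moment c w)"
        by (simp only: Cons w' p planar_moment.simps list.map prod_list.Cons mult_zero_right sum.neutral_const
            distrib_right sum_distrib_right mult.assoc add_0_right)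
      finally have lim: "?S \<longlonglongrightarrow> (\<Prod>w\<leftarrow>ws. planar_moment c w)" .
      have "eventually (\<lambda>N. ?S N = ?R N ws) sequentially"
        using eventually_ge_at_top[of 1]
      proof eventually_elim
        case (elim N)
        interpret gaussian_tensor "M N" N m "D N" "X N" using tensor elim by blast
        have loop: "trace_moment ws = of_bool (t = s) * of_nat (D N) * trace_moment ?v1
          + (\<Sum>j<length w. of_bool (snd (w ! j) = s) * trace_moment (?v2 j))
          + (\<Sum>l<length ws'. \<Sum>j<length (ws' ! l). of_bool (snd (ws' ! l ! j) = s) * trace_moment (?v3 l j))"
          unfolding Cons w' p using w ws' st by (intro trace_moment_loop_equation) auto
        have q1: "?R N ?v1 * (1 / of_nat N) = trace_moment ?v1 / of_nat N ^ ?e ws"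
          unfolding e1 by simp
        have q3: "?R N (?v3 l j) * (1 / of_nat N ^ 2) = trace_moment (?v3 l j) / of_nat N ^ ?e ws"
          if "l < length ws'" "j < length (ws' ! l)" for l j
          unfolding e3[OF that] power_add by (simp only: times_divide_times_eq mult_1_right)
        have "?S N = of_bool (t = s) * of_nat (D N) * (trace_moment ?v1 / of_nat N ^ ?e ws)
          + (\<Sum>j<length w. of_bool (snd (w ! j) = s) * (trace_moment (?v2 j) / of_nat N ^ ?e ws))
          + (\<Sum>l<length ws'. \<Sum>j<length (ws' ! l). of_bool (snd (ws' ! l ! j) = s) * (trace_moment (?v3 l j) / of_nat N ^ ?e ws))"
        proof (intro arg_cong2[where f = "(+)"] sum.cong refl)
          show "of_bool (t = s) * (of_nat (D N) / of_nat N) * ?R N ?v1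
            = of_bool (t = s) * of_nat (D N) * (trace_moment ?v1 / of_nat N ^ ?e ws)"
            unfolding q1[symmetric] by simp
        next
          fix j assume "j \<in> {..<length w}"
          then show "of_bool (snd (w ! j) = s) * ?R N (?v2 j)
            = of_bool (snd (w ! j) = s) * (trace_moment (?v2 j) / of_nat N ^ ?e ws)"
            using e2[of j] by (simp only: lessThan_iff)
        next
          fix l j assume "l \<in> {..<length ws'}" "j \<in> {..<length (ws' ! l)}"
          then show "of_bool (snd (ws' ! l ! j) = s) * (?R N (?v3 l j) * (1 / of_nat N ^ 2))
            = of_bool (snd (ws' ! l ! j) = s) * (trace_moment (?v3 l j) / of_nat N ^ ?e ws)"
            using q3[of l j] by (simp only: lessThan_iff)
        qed
        also have "\<dots> = ?R N ws"
          unfolding loop by (simp only: add_divide_distrib sum_divide_distrib times_divide_eq_right)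
        finally show ?case .
      qed
      with lim show ?thesis by (rule Lim_transform_eventually)
    qed
  qed
qed

section \<open>Recursion for non-crossing partitions\<close>

text \<open>Arbitrary end points let the recursion cut off pieces without renumbering their
  elements.\<close>

definition NC_interval :: "nat \<Rightarrow> nat \<Rightarrow> nat set set set" where
  "NC_interval l r = {P. partition_on {l..<r} P \<and> noncrossing P}"

lemma NC_eq_NC_interval: "NC p = NC_interval 1 (p + 1)"
  by (simp add: NC_def NC_interval_def atLeastLessThanSuc_atLeastAtMost)

lemma finite_NC_interval: "finite (NC_interval l r)"
  by (rule finite_subset[of _ "Pow (Pow {l..<r})"]) (auto simp: NC_interval_def partition_on_def)

lemma noncrossingD:
  assumes "noncrossing P" "B \<in> P" "C \<in> P" "i \<in> B" "j \<in> C" "k \<in> B" "l \<in> C" "i < j" "j < k" "k < l"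
  shows "B = C"
  using assms unfolding noncrossing_def by blast

lemma partition_on_unique: "partition_on A P \<Longrightarrow> B \<in> P \<Longrightarrow> C \<in> P \<Longrightarrow> a \<in> B \<Longrightarrow> a \<in> C \<Longrightarrow> B = C"
  by (auto simp: partition_on_def disjoint_def)

lemma partition_on_memD: "partition_on A P \<Longrightarrow> B \<in> P \<Longrightarrow> x \<in> B \<Longrightarrow> x \<in> A"
  by (auto simp: partition_on_def)

lemma partition_on_blockE:
  assumes "partition_on A P" "a \<in> A"
  obtains B where "B \<in> P" "a \<in> B"
  using assms by (auto simp: partition_on_def)

lemma partition_on_nonemptyE:
  assumes "partition_on A P" "B \<in> P"
  obtains x where "x \<in> B"
  using assms by (metis partition_on_def ex_in_conv)

definition block_pred :: "nat set \<Rightarrow> nat \<Rightarrow> nat" where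
  "block_pred B a = (if a = Min B then Max B else Max {b \<in> B. b < a})"

lemma partition_perm_eq_block_pred:
  assumes "partition_on A P" "B \<in> P" "a \<in> B"
  shows "partition_perm P a = block_pred B a"
proof -
  have "(THE B. B \<in> P \<and> a \<in> B) = B"
    using assms(2,3) partition_on_unique[OF assms(1)] by (intro the_equality conjI) metis+
  moreover have "a \<in> \<Union>P" using assms(2,3) by blast
  ultimately show ?thesis by (simp add: partition_perm_def block_pred_def)
qed

text \<open>
  Puts back the first point \<open>l\<close>, where \<open>j > l\<close> is the maximum of its block; \<open>P\<^sub>1\<close> and \<open>P\<^sub>2\<close> are the
  parts of the partition up to and beyond \<open>j\<close>.
\<close>

definition nc_join :: "nat \<Rightarrow> nat \<Rightarrow> nat set set \<Rightarrow> nat set set \<Rightarrow> nat set set" where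
  "nc_join l j P\<^sub>1 P\<^sub>2 = (\<lambda>B. if j \<in> B then insert l B else B) ` P\<^sub>1 \<union> P\<^sub>2"

lemma partition_on_singleton_insert:
  assumes "l < r"
  shows "partition_on {l..<r} P \<and> {l} \<in> P \<longleftrightarrow> (\<exists>Q. P = insert {l} Q \<and> {l} \<notin> Q \<and> partition_on {Suc l..<r} Q)"
proof -
  have eq: "{l..<r} = insert l {Suc l..<r}" using assms by auto
  show ?thesis
  proof
    assume "partition_on {l..<r} P \<and> {l} \<in> P"
    then have part: "partition_on {l..<r} P" and mem: "{l} \<in> P" by auto
    have notin: "l \<notin> C" if "C \<in> P" "C \<noteq> {l}" for C
      using that partition_on_unique[OF part that(1) mem] by blast
    have "partition_on {Suc l..<r} (P - {{l}})"
    proof (rule partition_onI)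
      have "\<Union> (P - {{l}}) = \<Union>P - {l}"
      proof (intro equalityI subsetI)
        fix x assume "x \<in> \<Union> (P - {{l}})"
        then show "x \<in> \<Union>P - {l}" using notin by blast
      qed blast
      also have "\<dots> = {Suc l..<r}"
        using part by (auto simp: partition_on_def)
      finally show "\<Union> (P - {{l}}) = {Suc l..<r}" .
      show "{} \<notin> P - {{l}}"
        using part by (auto simp: partition_on_def)
      show "disjnt B C" if "B \<in> P - {{l}}" "C \<in> P - {{l}}" "B \<noteq> C" for B C
        using that part by (auto simp: partition_on_def disjoint_def disjnt_def)
    qed
    moreover have "P = insert {l} (P - {{l}})" "{l} \<notin> P - {{l}}"
      using mem by (simp_all add: insert_absorb)
    ultimately show "\<exists>Q. P = insert {l} Q \<and> {l} \<notin> Q \<and> partition_on {Suc l..<r} Q"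
      by blast
  next
    assume "\<exists>Q. P = insert {l} Q \<and> {l} \<notin> Q \<and> partition_on {Suc l..<r} Q"
    then obtain Q where Q: "P = insert {l} Q" "partition_on {Suc l..<r} Q" by blast
    have "partition_on {l..<r} (insert {l} Q)"
      unfolding eq
    proof (rule partition_onI)
      have notin: "l \<notin> C" if "C \<in> Q" for C using partition_on_memD[OF Q(2) that, of l] by auto
      show "disjnt B C" if "B \<in> insert {l} Q" "C \<in> insert {l} Q" "B \<noteq> C" for B C
        using that notin partition_on_unique[OF Q(2)] by (auto simp: disjnt_def)
    qed (use Q in \<open>auto simp: partition_on_def\<close>)
    then show "partition_on {l..<r} P \<and> {l} \<in> P" using Q by auto
  qed
qed

text \<open>A crossing uses two points from each of the two blocks involved.\<close>

lemma noncrossing_insert_singleton: "noncrossing (insert {l} Q) \<longleftrightarrow> noncrossing Q"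
proof
  assume nc: "noncrossing Q"
  show "noncrossing (insert {l} Q)"
    unfolding noncrossing_def
  proof (intro notI, elim bexE conjE)
    fix B C i j k n
    assume "B \<in> insert {l} Q" "C \<in> insert {l} Q" "B \<noteq> C"
      and mem: "i \<in> B" "j \<in> C" "k \<in> B" "n \<in> C" and lt: "i < j" "j < k" "k < n"
    then have "B \<in> Q" "C \<in> Q" by auto
    then show False using noncrossingD[OF nc _ _ mem lt] \<open>B \<noteq> C\<close> by blast
  qed
qed (auto simp: noncrossing_def)

lemma singleton_notin_NC_interval:
  assumes "Q \<in> NC_interval (Suc l) r"
  shows "{l} \<notin> Q"
proof
  assume "{l} \<in> Q"
  then have "l \<in> \<Union>Q" by blast
  moreover have "\<Union>Q = {Suc l..<r}" using assms by (simp add: NC_interval_def partition_on_def)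
  ultimately have "l \<in> {Suc l..<r}" by (simp only:)
  then show False by simp
qed

lemma bij_betw_NC_singleton:
  assumes "l < r"
  shows "bij_betw (insert {l}) (NC_interval (Suc l) r) {P \<in> NC_interval l r. {l} \<in> P}"
proof (rule bij_betwI')
  note notin = singleton_notin_NC_interval
  show "(insert {l} Q = insert {l} Q') = (Q = Q')"
    if "Q \<in> NC_interval (Suc l) r" "Q' \<in> NC_interval (Suc l) r" for Q Q'
    using notin[OF that(1)] notin[OF that(2)] by (metis insert_ident)
  show "insert {l} Q \<in> {P \<in> NC_interval l r. {l} \<in> P}" if "Q \<in> NC_interval (Suc l) r" for Q
  proof -
    have "\<exists>Q'. insert {l} Q = insert {l} Q' \<and> {l} \<notin> Q' \<and> partition_on {Suc l..<r} Q'"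
      using that notin[OF that] unfolding NC_interval_def by blast
    then have "partition_on {l..<r} (insert {l} Q)"
      unfolding partition_on_singleton_insert[OF assms, symmetric] ..
    then show ?thesis using that by (simp add: NC_interval_def noncrossing_insert_singleton)
  qed
  show "\<exists>Q\<in>NC_interval (Suc l) r. P = insert {l} Q" if "P \<in> {P \<in> NC_interval l r. {l} \<in> P}" for P
  proof -
    have "\<exists>Q. P = insert {l} Q \<and> {l} \<notin> Q \<and> partition_on {Suc l..<r} Q"
      unfolding partition_on_singleton_insert[OF assms, symmetric] using that by (simp add: NC_interval_def)
    then obtain Q where "P = insert {l} Q" "partition_on {Suc l..<r} Q" by blast
    with that show ?thesis by (auto simp: NC_interval_def noncrossing_insert_singleton)
  qed
qed

section \<open>Adding a first point to a pair of non-crossing partitions\<close>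

context
  fixes l j r :: nat and P\<^sub>1 P\<^sub>2 :: "nat set set"
  assumes lj: "l < j" and jr: "j < r"
    and P1: "P\<^sub>1 \<in> NC_interval (Suc l) (Suc j)" and P2: "P\<^sub>2 \<in> NC_interval (Suc j) r"
begin

private lemma parts:
  "partition_on {Suc l..<Suc j} P\<^sub>1" "noncrossing P\<^sub>1" "partition_on {Suc j..<r} P\<^sub>2" "noncrossing P\<^sub>2"
  using P1 P2 by (auto simp: NC_interval_def)

private lemma sub1: "B \<in> P\<^sub>1 \<Longrightarrow> x \<in> B \<Longrightarrow> l < x \<and> x \<le> j"
  using partition_on_memD[OF parts(1)] by fastforce

private lemma sub2: "B \<in> P\<^sub>2 \<Longrightarrow> x \<in> B \<Longrightarrow> j < x \<and> x < r"
  using partition_on_memD[OF parts(3)] by fastforce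

private lemma join_cases:
  assumes "B \<in> nc_join l j P\<^sub>1 P\<^sub>2"
  obtains "B \<in> P\<^sub>1" "j \<notin> B" | B\<^sub>1 where "B\<^sub>1 \<in> P\<^sub>1" "j \<in> B\<^sub>1" "B = insert l B\<^sub>1" | "B \<in> P\<^sub>2"
  using assms by (auto simp: nc_join_def split: if_splits)

private lemma block_of_j: obtains B where "B \<in> P\<^sub>1" "j \<in> B"
  using partition_on_blockE[OF parts(1), of j] lj by auto

lemma partition_on_nc_join: "partition_on {l..<r} (nc_join l j P\<^sub>1 P\<^sub>2)"
proof (rule partition_onI)
  have "\<Union> (nc_join l j P\<^sub>1 P\<^sub>2) = insert l (\<Union>P\<^sub>1) \<union> \<Union>P\<^sub>2"
    using block_of_j by (auto simp: nc_join_def split: if_splits)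
  also have "\<dots> = {l..<r}"
    using parts lj jr by (auto simp: partition_on_def)
  finally show "\<Union> (nc_join l j P\<^sub>1 P\<^sub>2) = {l..<r}" .
  show "{} \<notin> nc_join l j P\<^sub>1 P\<^sub>2"
        using parts by (auto simp: nc_join_def partition_on_def split: if_splits)
  fix B C assume "B \<in> nc_join l j P\<^sub>1 P\<^sub>2" "C \<in> nc_join l j P\<^sub>1 P\<^sub>2" "B \<noteq> C"
  have "B = C" if x: "x \<in> B" "x \<in> C" for x
    using \<open>B \<in> _\<close>
  proof (cases rule: join_cases)
    case 1
    from \<open>C \<in> _\<close> show ?thesis
    proof (cases rule: join_cases)
      case (2 C\<^sub>1)
      then have "x \<in> C\<^sub>1" using x sub1[OF \<open>B \<in> P\<^sub>1\<close>, of x] by auto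
      then show ?thesis using partition_on_unique[OF parts(1) \<open>B \<in> P\<^sub>1\<close> \<open>C\<^sub>1 \<in> P\<^sub>1\<close> x(1)] 1 2 by blast
    qed (use 1 x sub1[of B x] sub2[of C x] partition_on_unique[OF parts(1), of B C x] in auto)
  next
    case (2 B\<^sub>1)
    from \<open>C \<in> _\<close> show ?thesis
    proof (cases rule: join_cases)
      case 1
      then have "x \<in> B\<^sub>1" using 2 x sub1[OF \<open>C \<in> P\<^sub>1\<close>, of x] by auto
      then show ?thesis using partition_on_unique[OF parts(1) \<open>B\<^sub>1 \<in> P\<^sub>1\<close> \<open>C \<in> P\<^sub>1\<close> _ x(2)] 1 2 by blast
    next
      case (2 C\<^sub>1)
      then show ?thesis
        using partition_on_unique[OF parts(1) \<open>B\<^sub>1 \<in> P\<^sub>1\<close> \<open>C\<^sub>1 \<in> P\<^sub>1\<close> \<open>j \<in> B\<^sub>1\<close>] \<open>B = insert l B\<^sub>1\<close> by blast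
    qed (use 2 x lj sub1[of B\<^sub>1 x] sub2[of C x] in auto)
  next
    case 3
    from \<open>C \<in> _\<close> show ?thesis
    proof (cases rule: join_cases)
      case (2 C\<^sub>1)
      then show ?thesis using 3 x lj sub1[of C\<^sub>1 x] sub2[of B x] by auto
    qed (use 3 x sub1[of C x] sub2[of B x] partition_on_unique[OF parts(3), of B C x] in auto)
  qed
  with \<open>B \<noteq> C\<close> show "disjnt B C" unfolding disjnt_def by blast
qed

text \<open>The delicate case is a crossing whose leftmost point \<open>a\<close> is the new point
  \<open>l\<close>. Then \<open>b < c < d < j\<close> would already be a crossing in
  \<open>P\<^sub>1\<close>, with \<open>j\<close> in the role of \<open>l\<close>. Blocks of
  \<open>P\<^sub>1\<close> and \<open>P\<^sub>2\<close> cannot interfere because they live on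
  opposite sides of the cut after \<open>j\<close>.\<close>

lemma noncrossing_nc_join: "noncrossing (nc_join l j P\<^sub>1 P\<^sub>2)"
  unfolding noncrossing_def
proof (intro notI, elim bexE conjE)
  fix B C a b c d
  assume B: "B \<in> nc_join l j P\<^sub>1 P\<^sub>2" and C: "C \<in> nc_join l j P\<^sub>1 P\<^sub>2"
    and mem: "a \<in> B" "b \<in> C" "c \<in> B" "d \<in> C" and lt: "a < b" "b < c" "c < d"
  assume "B \<noteq> C"
  have "B = C"
    using B
  proof (cases rule: join_cases)
    case 1
    from C show ?thesis
    proof (cases rule: join_cases)
      case 1
      with \<open>B \<in> P\<^sub>1\<close> show ?thesis using noncrossingD[OF parts(2) _ _ mem lt] by blast
    next
      case (2 C\<^sub>1)
      with mem lt sub1[OF \<open>B \<in> P\<^sub>1\<close>, of a] sub1[OF \<open>B \<in> P\<^sub>1\<close>, of c] have "b \<in> C\<^sub>1" "d \<in> C\<^sub>1" by auto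
      with \<open>B \<in> P\<^sub>1\<close> 2 \<open>j \<notin> B\<close> show ?thesis using noncrossingD[OF parts(2) _ _ mem(1) _ mem(3) _ lt] by blast
    next
      case 3
      with \<open>B \<in> P\<^sub>1\<close> mem lt show ?thesis using sub1[of B c] sub2[of C b] by auto
    qed
  next
    case (2 B\<^sub>1)
    then have c: "c \<in> B\<^sub>1"
      using mem lt sub1[of B\<^sub>1 a] by auto
    from C show ?thesis
    proof (cases rule: join_cases)
      case 1
      then have "d < j" using mem(4) sub1[of C d] by (metis le_neq_implies_less)
      with noncrossingD[OF parts(2) 1(1) \<open>B\<^sub>1 \<in> P\<^sub>1\<close> mem(2) c mem(4) \<open>j \<in> B\<^sub>1\<close> lt(2,3)]
      show ?thesis using \<open>j \<notin> C\<close> \<open>j \<in> B\<^sub>1\<close> by blast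
    next
      case (2 C\<^sub>1)
      with \<open>B = insert l B\<^sub>1\<close> \<open>B\<^sub>1 \<in> P\<^sub>1\<close> \<open>j \<in> B\<^sub>1\<close> show ?thesis
        using partition_on_unique[OF parts(1)] by blast
    next
      case 3
      with \<open>B\<^sub>1 \<in> P\<^sub>1\<close> c mem lt show ?thesis using sub1[of B\<^sub>1 c] sub2[of C b] by auto
    qed
  next
    case 3
    from C show ?thesis
    proof (cases rule: join_cases)
      case 1
      with 3 mem lt show ?thesis using sub1[of C d] sub2[of B c] by auto
    next
      case (2 C\<^sub>1)
      with 3 mem lt lj show ?thesis using sub1[of C\<^sub>1 d] sub2[of B c] by auto
    next
      case 3
      with \<open>B \<in> P\<^sub>2\<close> show ?thesis using noncrossingD[OF parts(4) _ _ mem lt] by blast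
    qed
  qed
  then show False using \<open>B \<noteq> C\<close> by blast
qed

lemma card_nc_join: "card (nc_join l j P\<^sub>1 P\<^sub>2) = card P\<^sub>1 + card P\<^sub>2"
proof -
  let ?e = "\<lambda>B. if j \<in> B then insert l B else B"
  have fin: "finite P\<^sub>1" "finite P\<^sub>2"
    using finite_elements[OF _ parts(1)] finite_elements[OF _ parts(3)] by auto
  have "?e B - {l} = B" if "B \<in> P\<^sub>1" for B
    using sub1[OF that] by auto
  then have "inj_on ?e P\<^sub>1" by (intro inj_on_inverseI[where g = "\<lambda>B. B - {l}"])
  moreover have "?e ` P\<^sub>1 \<inter> P\<^sub>2 = {}"
  proof -
    have "?e B \<noteq> C" if "B \<in> P\<^sub>1" "C \<in> P\<^sub>2" for B C
    proof -
      obtain x where "x \<in> B" using partition_on_nonemptyE[OF parts(1) \<open>B \<in> P\<^sub>1\<close>] .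
      then show ?thesis using sub1[OF that(1), of x] sub2[OF that(2), of x] by auto
    qed
    then show ?thesis by blast
  qed
  ultimately show ?thesis
    unfolding nc_join_def using fin by (simp only: card_Un_disjoint card_image finite_imageI)
qed

lemma partition_perm_nc_join_outer:
  assumes "i \<in> {Suc j..<r}"
  shows "partition_perm (nc_join l j P\<^sub>1 P\<^sub>2) i = partition_perm P\<^sub>2 i"
proof -
  obtain B where B: "B \<in> P\<^sub>2" "i \<in> B" using partition_on_blockE[OF parts(3) assms] .
  then have "B \<in> nc_join l j P\<^sub>1 P\<^sub>2" by (simp add: nc_join_def)
  with B show ?thesis
    using partition_perm_eq_block_pred[OF partition_on_nc_join] partition_perm_eq_block_pred[OF parts(3)] by simp
qed

private lemma block_facts:
  assumes "B \<in> P\<^sub>1" "j \<in> B"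
  shows "finite B" "Max B = j" "Min (insert l B) = l" "Max (insert l B) = j"
proof -
  have *: "l < x \<and> x \<le> j" if "x \<in> B" for x using sub1[OF assms(1) that] .
  then have "B \<subseteq> {..j}" by auto
  then show fin: "finite B" using finite_subset by blast
  show "Max B = j" using fin assms * by (intro Max_eqI) auto
  show "Min (insert l B) = l" using fin * by (intro Min_eqI) (auto simp: less_imp_le)
  show "Max (insert l B) = j" using fin assms * lj by (intro Max_eqI) (auto simp: less_imp_le)
qed

lemma partition_perm_nc_join_left: "partition_perm (nc_join l j P\<^sub>1 P\<^sub>2) l = j"
proof -
  obtain B where B: "B \<in> P\<^sub>1" "j \<in> B" by (rule block_of_j)
  then have "insert l B \<in> nc_join l j P\<^sub>1 P\<^sub>2" by (auto simp: nc_join_def)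
  then show ?thesis
    using partition_perm_eq_block_pred[OF partition_on_nc_join, of "insert l B" l] block_facts[OF B]
    by (simp add: block_pred_def)
qed

text \<open>In the cycle of the block of \<open>j\<close>, the step from the minimum up to
  \<open>j\<close> is interrupted by \<open>l\<close>: old minimum, then \<open>l\<close>, then
  \<open>j\<close>. The value \<open>j\<close> is taken only at that minimum.\<close>

lemma partition_perm_nc_join_inner:
  assumes i: "i \<in> {Suc l..<Suc j}"
  shows "partition_perm (nc_join l j P\<^sub>1 P\<^sub>2) i
    = (if partition_perm P\<^sub>1 i = j then l else partition_perm P\<^sub>1 i)"
proof -
  obtain B where B: "B \<in> P\<^sub>1" "i \<in> B" using partition_on_blockE[OF parts(1) i] .
  have fin: "finite B" using sub1[OF B(1)] finite_subset[of B "{..j}"] by auto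
  note pp1 = partition_perm_eq_block_pred[OF parts(1) B]
  show ?thesis
  proof (cases "j \<in> B")
    case True
    then have mem: "insert l B \<in> nc_join l j P\<^sub>1 P\<^sub>2" using B by (auto simp: nc_join_def)
    note f = block_facts[OF B(1) True]
    have pp: "partition_perm (nc_join l j P\<^sub>1 P\<^sub>2) i = Max {b \<in> insert l B. b < i}"
      using partition_perm_eq_block_pred[OF partition_on_nc_join mem, of i] B i f by (simp add: block_pred_def)
    show ?thesis
    proof (cases "i = Min B")
      case True
      then have "{b \<in> insert l B. b < i} = {l}"
        using i Min_le[OF fin] by (fastforce simp: True)
      then show ?thesis using pp pp1 True f by (simp add: block_pred_def)
    next
      case False
      then have "Min B < i" using Min_le[OF fin B(2)] by simp
      moreover have "Min B \<in> B" using Min_in[OF fin] B(2) by blast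
      ultimately have ne: "{b \<in> B. b < i} \<noteq> {}" by blast
      have in': "Max {b \<in> B. b < i} \<in> {b \<in> B. b < i}"
        using Max_in[OF _ ne] fin by simp
      have "{b \<in> insert l B. b < i} = insert l {b \<in> B. b < i}"
        using i by auto
      then have "Max {b \<in> insert l B. b < i} = max l (Max {b \<in> B. b < i})"
        using ne fin by simp
      also have "\<dots> = Max {b \<in> B. b < i}"
        using in' sub1[OF B(1), of "Max {b \<in> B. b < i}"] by (auto simp: max_def)
      finally show ?thesis using pp pp1 False in' i by (auto simp: block_pred_def)
    qed
  next
    case False
    then have "B \<in> nc_join l j P\<^sub>1 P\<^sub>2" using B by (auto simp: nc_join_def)
    then have "partition_perm (nc_join l j P\<^sub>1 P\<^sub>2) i = partition_perm P\<^sub>1 i"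
      using partition_perm_eq_block_pred[OF partition_on_nc_join] pp1 B by simp
    moreover have "block_pred B i \<in> B"
    proof (cases "i = Min B")
      case False
      then have "Min B < i" using Min_le[OF fin B(2)] by simp
      moreover have "Min B \<in> B" using Min_in[OF fin] B(2) by blast
      ultimately have "{b \<in> B. b < i} \<noteq> {}" by blast
      then show ?thesis using Max_in[of "{b \<in> B. b < i}"] fin False by (auto simp: block_pred_def)
    qed (use Max_in[OF fin] B in \<open>auto simp: block_pred_def\<close>)
    ultimately show ?thesis using pp1 False by auto
  qed
qed

lemma singleton_notin_nc_join: "{l} \<notin> nc_join l j P\<^sub>1 P\<^sub>2"
proof
  assume "{l} \<in> nc_join l j P\<^sub>1 P\<^sub>2"
  then show False using lj by (cases rule: join_cases) (auto dest: sub1 sub2)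
qed

text \<open>These formulas are the inverse map for the reindexing in
  \<open>sum_NC_interval_rec\<close>: \<open>j\<close> is the maximum of the block of
  \<open>l\<close>, and the other blocks are sorted by whether they stay below
  \<open>j\<close>.\<close>

lemma nc_join_left_inverse:
  shows "Max (\<Union>{B \<in> nc_join l j P\<^sub>1 P\<^sub>2. l \<in> B}) = j"
    and "(\<lambda>B. B - {l}) ` {B \<in> nc_join l j P\<^sub>1 P\<^sub>2. B \<subseteq> {..j}} = P\<^sub>1"
    and "{B \<in> nc_join l j P\<^sub>1 P\<^sub>2. \<not> B \<subseteq> {..j}} = P\<^sub>2"
proof -
  obtain B where B: "B \<in> P\<^sub>1" "j \<in> B" by (rule block_of_j)
  then have mem: "insert l B \<in> nc_join l j P\<^sub>1 P\<^sub>2" by (auto simp: nc_join_def)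
  have "C = insert l B" if "C \<in> nc_join l j P\<^sub>1 P\<^sub>2" "l \<in> C" for C
    using partition_on_unique[OF partition_on_nc_join that(1) mem that(2)] by blast
  then have "{C \<in> nc_join l j P\<^sub>1 P\<^sub>2. l \<in> C} = {insert l B}" using mem by blast
  then show "Max (\<Union>{B \<in> nc_join l j P\<^sub>1 P\<^sub>2. l \<in> B}) = j"
    using block_facts[OF B] by simp
  have e: "\<exists>x\<in>C. x \<notin> {..j}" if "C \<in> P\<^sub>2" for C
  proof -
    obtain x where "x \<in> C" using partition_on_nonemptyE[OF parts(3) \<open>C \<in> P\<^sub>2\<close>] .
    then show ?thesis using sub2[OF that, of x] by (intro bexI[of _ x]) auto
  qed
  have "(if j \<in> C then insert l C else C) \<subseteq> {..j}" if "C \<in> P\<^sub>1" for C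
    using sub1[OF that] lj by auto
  then have eq: "{B \<in> nc_join l j P\<^sub>1 P\<^sub>2. B \<subseteq> {..j}} = (\<lambda>B. if j \<in> B then insert l B else B) ` P\<^sub>1"
    and eq2: "{B \<in> nc_join l j P\<^sub>1 P\<^sub>2. \<not> B \<subseteq> {..j}} = P\<^sub>2"
    using e by (fastforce simp: nc_join_def)+
  have "(if j \<in> C then insert l C else C) - {l} = C" if "C \<in> P\<^sub>1" for C
    using sub1[OF that] by auto
  then show "(\<lambda>B. B - {l}) ` {B \<in> nc_join l j P\<^sub>1 P\<^sub>2. B \<subseteq> {..j}} = P\<^sub>1"
    unfolding eq image_image by simp
  show "{B \<in> nc_join l j P\<^sub>1 P\<^sub>2. \<not> B \<subseteq> {..j}} = P\<^sub>2" by (rule eq2)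
qed

end

text \<open>Since \<open>l\<close> and \<open>j\<close> lie in one block, another block with points
  on both sides of \<open>j\<close> would cross it. Hence every other block lies strictly between
  \<open>l\<close> and \<open>j\<close> or entirely beyond \<open>j\<close>.\<close>

lemma nc_join_split:
  assumes P: "P \<in> NC_interval l r" "{l} \<notin> P" and lr: "l < r"
  defines "j \<equiv> Max (\<Union>{B \<in> P. l \<in> B})"
  defines "P\<^sub>1 \<equiv> (\<lambda>B. B - {l}) ` {B \<in> P. B \<subseteq> {..j}}" and "P\<^sub>2 \<equiv> {B \<in> P. \<not> B \<subseteq> {..j}}"
  shows "l < j" "j < r" "P\<^sub>1 \<in> NC_interval (Suc l) (Suc j)" "P\<^sub>2 \<in> NC_interval (Suc j) r"
    "nc_join l j P\<^sub>1 P\<^sub>2 = P"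
proof -
  have part: "partition_on {l..<r} P" and nc: "noncrossing P" using P by (auto simp: NC_interval_def)
  obtain B where B: "B \<in> P" "l \<in> B" using partition_on_blockE[OF part, of l] lr by auto
  have "{C \<in> P. l \<in> C} = {B}" using partition_on_unique[OF part B(1) _ B(2)] B by blast
  then have j: "j = Max B" by (simp add: j_def)
  have sub: "C \<subseteq> {l..<r}" if "C \<in> P" for C using part that by (auto simp: partition_on_def)
  have fin: "finite B" using sub[OF B(1)] finite_subset by blast
  have jB: "j \<in> B" unfolding j using fin B(2) by (intro Max_in) auto
  have "B \<noteq> {l}" using B P by auto
  then obtain x where "x \<in> B" "x \<noteq> l" using B by auto
  then show lj: "l < j" using subsetD[OF sub[OF B(1)], of x] j Max_ge[OF fin, of x] by auto
  show jr: "j < r" using sub[OF B(1)] jB by auto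
  have B_le: "B \<subseteq> {..j}" using fin j by auto
  have cases: "C = B \<or> C \<subseteq> {Suc l..<j} \<or> C \<subseteq> {Suc j..<r}" if C: "C \<in> P" for C
  proof (rule ccontr)
    assume neg: "\<not> ?thesis"
    have notin: "l \<notin> C" "j \<notin> C" using partition_on_unique[OF part C B(1)] B jB neg by auto
    obtain y where y: "y \<in> C" "y \<notin> {Suc l..<j}" using neg by blast
    obtain x where x: "x \<in> C" "x \<notin> {Suc j..<r}" using neg by blast
    have "x \<noteq> l" "x \<noteq> j" "y \<noteq> l" "y \<noteq> j" using x y notin by auto
    then have "l < x" "x < j" "j < y" using x y sub[OF C] by (auto simp: subset_iff not_less Suc_le_eq)
    from noncrossingD[OF nc B(1) C B(2) x(1) jB y(1) this] neg show False by blast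
  qed
  have P1_iff: "C \<subseteq> {..j} \<longleftrightarrow> C = B \<or> C \<subseteq> {Suc l..<j}" if C: "C \<in> P" for C
  proof -
    obtain x where "x \<in> C" using partition_on_nonemptyE[OF part C] .
    then show ?thesis using cases[OF C] B_le by force
  qed
  have P1: "P\<^sub>1 = insert (B - {l}) {C \<in> P. C \<subseteq> {Suc l..<j}}"
  proof -
    have "{C \<in> P. C \<subseteq> {..j}} = insert B {C \<in> P. C \<subseteq> {Suc l..<j}}" using P1_iff B by blast
    moreover have "C - {l} = C" if "C \<subseteq> {Suc l..<j}" for C using that by auto
    ultimately show ?thesis by (simp add: P\<^sub>1_def)
  qed
  have P2_iff: "C \<in> P\<^sub>2 \<longleftrightarrow> C \<in> P \<and> C \<subseteq> {Suc j..<r}" for C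
  proof (cases "C \<in> P")
    case True
    obtain x where "x \<in> C" using partition_on_nonemptyE[OF part True] .
    then show ?thesis using cases[OF True] B_le by (force simp: P\<^sub>2_def)
  qed (simp add: P\<^sub>2_def)
  have ex: "\<exists>C\<in>P. x \<in> C" if "l \<le> x" "x < r" for x
    using partition_on_blockE[OF part, of x] that by auto
  show "P\<^sub>1 \<in> NC_interval (Suc l) (Suc j)"
    unfolding NC_interval_def
  proof (intro CollectI conjI)
    show "partition_on {Suc l..<Suc j} P\<^sub>1"
    proof (rule partition_onI)
      show "\<Union>P\<^sub>1 = {Suc l..<Suc j}"
      proof (intro equalityI subsetI)
        fix x assume "x \<in> \<Union>P\<^sub>1"
        then show "x \<in> {Suc l..<Suc j}"
          using sub[OF B(1)] B_le by (auto simp: P1 subset_iff le_less Suc_le_eq)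
      next
        fix x assume x: "x \<in> {Suc l..<Suc j}"
        then obtain C where C: "C \<in> P" "x \<in> C" using ex[of x] jr by auto
        then show "x \<in> \<Union>P\<^sub>1" using cases[OF C(1)] x by (auto simp: P1)
      qed
      show "{} \<notin> P\<^sub>1"
        using part jB lj by (auto simp: P1 partition_on_def)
      show "disjnt C C'" if "C \<in> P\<^sub>1" "C' \<in> P\<^sub>1" "C \<noteq> C'" for C C'
        using that partition_on_unique[OF part] B by (auto simp: P1 disjnt_def)
    qed
    show "noncrossing P\<^sub>1"
    proof -
      have ext: "\<exists>C'\<in>P. C = C' - {l}" if "C \<in> P\<^sub>1" for C using that by (auto simp: P\<^sub>1_def)
      show ?thesis
        unfolding noncrossing_def
      proof (intro notI, elim bexE conjE)
        fix B C a b c d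
        assume BC: "B \<in> P\<^sub>1" "C \<in> P\<^sub>1" "B \<noteq> C"
          and mem: "a \<in> B" "b \<in> C" "c \<in> B" "d \<in> C" and lt: "a < b" "b < c" "c < d"
        obtain B' C' where "B' \<in> P" "B = B' - {l}" "C' \<in> P" "C = C' - {l}"
          using ext BC by metis
        then show False using noncrossingD[OF nc _ _ _ _ _ _ lt, of B' C'] mem BC(3) by blast
      qed
    qed
  qed
  show "P\<^sub>2 \<in> NC_interval (Suc j) r"
    unfolding NC_interval_def
  proof (intro CollectI conjI)
    show "partition_on {Suc j..<r} P\<^sub>2"
    proof (rule partition_onI)
      show "\<Union>P\<^sub>2 = {Suc j..<r}"
      proof (intro equalityI subsetI)
        fix x assume x: "x \<in> {Suc j..<r}"
        then obtain C where C: "C \<in> P" "x \<in> C" using ex[of x] lj by auto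
        then show "x \<in> \<Union>P\<^sub>2" using cases[OF C(1)] x B_le P2_iff[of C] by auto
      next
        fix x assume "x \<in> \<Union>P\<^sub>2"
        then show "x \<in> {Suc j..<r}" using P2_iff by blast
      qed
      show "{} \<notin> P\<^sub>2"
        using part by (auto simp: P2_iff partition_on_def)
      show "disjnt C C'" if "C \<in> P\<^sub>2" "C' \<in> P\<^sub>2" "C \<noteq> C'" for C C'
        using that partition_on_unique[OF part] by (auto simp: P2_iff disjnt_def)
    qed
    show "noncrossing P\<^sub>2" using nc unfolding noncrossing_def P\<^sub>2_def by blast
  qed
  have "(\<lambda>C. if j \<in> C then insert l C else C) ` P\<^sub>1 = insert B {C \<in> P. C \<subseteq> {Suc l..<j}}"
  proof -
    have "(\<lambda>C. if j \<in> C then insert l C else C) ` {C \<in> P. C \<subseteq> {Suc l..<j}} = {C \<in> P. C \<subseteq> {Suc l..<j}}"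
      by force
    then show ?thesis unfolding P1 image_insert using jB lj B by (simp add: insert_absorb)
  qed
  then have "nc_join l j P\<^sub>1 P\<^sub>2 = insert B {C \<in> P. C \<subseteq> {Suc l..<j}} \<union> P\<^sub>2"
    by (simp only: nc_join_def)
  also have "\<dots> = P"
  proof (intro equalityI subsetI)
    fix C assume "C \<in> P"
    then show "C \<in> insert B {C \<in> P. C \<subseteq> {Suc l..<j}} \<union> P\<^sub>2"
      using cases[of C] P2_iff[of C] by blast
  qed (use B(1) P2_iff in blast)
  finally show "nc_join l j P\<^sub>1 P\<^sub>2 = P" .
qed

text \<open>Either \<open>l\<close> is alone, or its block has a maximum \<open>j > l\<close> and
  deleting \<open>l\<close> leaves two independent partitions, of the points up to \<open>j\<close>
  and of those beyond.\<close>

lemma sum_NC_interval_rec: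
  assumes "l < r"
  shows "(\<Sum>P\<in>NC_interval l r. F P) = (\<Sum>Q\<in>NC_interval (Suc l) r. F (insert {l} Q))
    + (\<Sum>j\<in>{Suc l..<r}. \<Sum>P\<^sub>1\<in>NC_interval (Suc l) (Suc j). \<Sum>P\<^sub>2\<in>NC_interval (Suc j) r. F (nc_join l j P\<^sub>1 P\<^sub>2))"
proof -
  have "(\<Sum>P\<in>NC_interval l r. F P)
    = (\<Sum>P\<in>{P\<in>NC_interval l r. {l} \<in> P}. F P) + (\<Sum>P\<in>{P\<in>NC_interval l r. {l} \<notin> P}. F P)"
    by (subst sum.union_disjoint[symmetric]) (auto intro: sum.cong finite_subset[OF _ finite_NC_interval])
  also have "(\<Sum>P\<in>{P\<in>NC_interval l r. {l} \<in> P}. F P) = (\<Sum>Q\<in>NC_interval (Suc l) r. F (insert {l} Q))"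
    by (rule sum.reindex_bij_betw[OF bij_betw_NC_singleton[OF assms], symmetric])
  also have "(\<Sum>P\<in>{P\<in>NC_interval l r. {l} \<notin> P}. F P)
    = (\<Sum>(j, P\<^sub>1, P\<^sub>2)\<in>(SIGMA j:{Suc l..<r}. NC_interval (Suc l) (Suc j) \<times> NC_interval (Suc j) r). F (nc_join l j P\<^sub>1 P\<^sub>2))"
    (is "_ = sum ?G ?S")
  proof (rule sum.reindex_bij_witness[where i = "\<lambda>(j, P\<^sub>1, P\<^sub>2). nc_join l j P\<^sub>1 P\<^sub>2"
        and j = "\<lambda>P. let j = Max (\<Union>{B \<in> P. l \<in> B}) in
          (j, (\<lambda>B. B - {l}) ` {B \<in> P. B \<subseteq> {..j}}, {B \<in> P. \<not> B \<subseteq> {..j}})"], goal_cases)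
    case (1 P)
    then show ?case using nc_join_split(5)[of P l r] assms by (simp add: Let_def)
  next
    case (2 P)
    then show ?case using nc_join_split(1-4)[of P l r] assms by (simp add: Let_def)
  next
    case (3 q)
    then obtain j P\<^sub>1 P\<^sub>2 where q: "q = (j, P\<^sub>1, P\<^sub>2)" and *: "l < j" "j < r"
      "P\<^sub>1 \<in> NC_interval (Suc l) (Suc j)" "P\<^sub>2 \<in> NC_interval (Suc j) r" by auto
    show ?case
      by (simp only: q prod.case Let_def nc_join_left_inverse[OF *])
  next
    case (4 q)
    then show ?case
      using partition_on_nc_join[of l "fst q" r "fst (snd q)" "snd (snd q)"]
        noncrossing_nc_join[of l "fst q" r "fst (snd q)" "snd (snd q)"]
        singleton_notin_nc_join[of l "fst q" r "fst (snd q)" "snd (snd q)"]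
      by (auto simp: Suc_le_eq NC_interval_def[of l])
  next
    case (5 P)
    then show ?case using nc_join_split(5)[of P l r] assms by (simp add: Let_def)
  qed
  also have "sum ?G ?S = (\<Sum>j\<in>{Suc l..<r}. \<Sum>P\<^sub>1\<in>NC_interval (Suc l) (Suc j). \<Sum>P\<^sub>2\<in>NC_interval (Suc j) r. F (nc_join l j P\<^sub>1 P\<^sub>2))"
    by (simp only: sum.cartesian_product, subst sum.Sigma) (auto simp: finite_NC_interval)
  finally show ?thesis .
qed

text \<open>Both recursions agree term by term. Contracting \<open>s l\<close> with
  \<open>t j\<close> means that the permutation sends \<open>l\<close> to \<open>j\<close>, and the
  letter reattached at \<open>j\<close> carries \<open>t l\<close>. Updating \<open>t\<close> at
  \<open>j\<close> mirrors \<open>partition_perm_nc_join_inner\<close>, where the value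
  \<open>j\<close> is replaced by \<open>l\<close>; this is why \<open>t\<close> is generalised in
  the induction.\<close>

lemma planar_moment_eq_sum_NC:
  "planar_moment c (map (\<lambda>i. (s i, t i)) [l..<r])
    = (\<Sum>P\<in>NC_interval l r. c ^ card P * of_bool (\<forall>i\<in>{l..<r}. s i = t (partition_perm P i)))"
proof (induction "r - l" arbitrary: l r t rule: less_induct)
  case less
  show ?case
  proof (cases "l < r")
    case False
    then have "NC_interval l r = {{}}"
      by (auto simp: NC_interval_def noncrossing_def partition_on_def)
    then show ?thesis using False by simp
  next
    case True
    let ?p = "\<lambda>t i. (s i, t i)"
    let ?ok = "\<lambda>t l r P. of_bool (\<forall>i\<in>{l..<r}. s i = t (partition_perm P i)) :: complex"
    have "planar_moment c (map (?p t) [l..<r])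
      = of_bool (t l = s l) * c * planar_moment c (map (?p t) [Suc l..<r])
       + (\<Sum>j<r - Suc l. of_bool (t (Suc l + j) = s l) *
         (planar_moment c (map (?p (t(Suc l + j := t l))) [Suc l..<Suc (Suc l + j)])
          * planar_moment c (map (?p t) [Suc (Suc l + j)..<r])))"
    proof -
      have w: "map (?p t) [l..<r] = (s l, t l) # map (?p t) [Suc l..<r]"
        using True by (simp add: upt_conv_Cons)
      have len: "length (map (?p t) [Suc l..<r]) = r - Suc l"
        by simp
      have nth: "map (?p t) [Suc l..<r] ! j = ?p t (Suc l + j)" if "j < r - Suc l" for j
        using that by simp
      have take: "take j (map (?p t) [Suc l..<r]) @ [(s (Suc l + j), t l)]
          = map (?p (t(Suc l + j := t l))) [Suc l..<Suc (Suc l + j)]" if "j < r - Suc l" for j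
      proof -
        have "[Suc l..<Suc (Suc l + j)] = [Suc l..<Suc l + j] @ [Suc l + j]"
          by simp
        moreover have "map (?p (t(Suc l + j := t l))) [Suc l..<Suc l + j] = map (?p t) [Suc l..<Suc l + j]"
          by (intro map_cong) auto
        moreover have "take j (map (?p t) [Suc l..<r]) = map (?p t) [Suc l..<Suc l + j]"
          using that by (simp only: take_map take_upt)
        ultimately show ?thesis by (simp only: map_append list.map fun_upd_same)
      qed
      have drop: "drop (Suc j) (map (?p t) [Suc l..<r]) = map (?p t) [Suc (Suc l + j)..<r]" for j
        by (simp add: drop_map)
      show ?thesis
        unfolding w planar_moment.simps len drop
        by (intro arg_cong2[where f = "(+)"] sum.cong refl) (simp only: lessThan_iff take nth fst_conv snd_conv)
    qed
    also have "(\<Sum>j<r - Suc l. of_bool (t (Suc l + j) = s l) *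
         (planar_moment c (map (?p (t(Suc l + j := t l))) [Suc l..<Suc (Suc l + j)])
          * planar_moment c (map (?p t) [Suc (Suc l + j)..<r])))
      = (\<Sum>j\<in>{Suc l..<r}. of_bool (t j = s l) *
         (planar_moment c (map (?p (t(j := t l))) [Suc l..<Suc j]) * planar_moment c (map (?p t) [Suc j..<r])))"
      by (rule sum.reindex_bij_witness[of _ "\<lambda>j. j - Suc l" "\<lambda>j. Suc l + j"]) auto
    also have "\<dots> = (\<Sum>j\<in>{Suc l..<r}. of_bool (t j = s l) *
         ((\<Sum>P\<in>NC_interval (Suc l) (Suc j). c ^ card P * ?ok (t(j := t l)) (Suc l) (Suc j) P)
           * (\<Sum>P\<in>NC_interval (Suc j) r. c ^ card P * ?ok t (Suc j) r P)))"
    proof (intro sum.cong refl, goal_cases)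
      case (1 j)
      then have "Suc j - Suc l < r - l" "r - Suc j < r - l" by auto
      then show ?case by (simp only: less)
    qed
    also have "\<dots> = (\<Sum>j\<in>{Suc l..<r}. \<Sum>P\<^sub>1\<in>NC_interval (Suc l) (Suc j). \<Sum>P\<^sub>2\<in>NC_interval (Suc j) r.
       c ^ card (nc_join l j P\<^sub>1 P\<^sub>2) * ?ok t l r (nc_join l j P\<^sub>1 P\<^sub>2))"
    proof (intro sum.cong refl, goal_cases)
      case (1 j)
      have "of_bool (t j = s l) * ((c ^ card P\<^sub>1 * ?ok (t(j := t l)) (Suc l) (Suc j) P\<^sub>1) * (c ^ card P\<^sub>2 * ?ok t (Suc j) r P\<^sub>2))
          = c ^ card (nc_join l j P\<^sub>1 P\<^sub>2) * ?ok t l r (nc_join l j P\<^sub>1 P\<^sub>2)"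
        if P: "P\<^sub>1 \<in> NC_interval (Suc l) (Suc j)" "P\<^sub>2 \<in> NC_interval (Suc j) r" for P\<^sub>1 P\<^sub>2
      proof -
        have lj: "l < j" "j < r" using 1 by auto
        let ?P = "nc_join l j P\<^sub>1 P\<^sub>2"
        have "{l..<r} = insert l ({Suc l..<Suc j} \<union> {Suc j..<r})" using lj by auto
        then have "(\<forall>i\<in>{l..<r}. s i = t (partition_perm ?P i)) \<longleftrightarrow> s l = t (partition_perm ?P l)
           \<and> (\<forall>i\<in>{Suc l..<Suc j}. s i = t (partition_perm ?P i)) \<and> (\<forall>i\<in>{Suc j..<r}. s i = t (partition_perm ?P i))"
          by (metis UnE UnI1 UnI2 insertE insertI1 insertI2)
        also have "\<dots> \<longleftrightarrow> t j = s l \<and> (\<forall>i\<in>{Suc l..<Suc j}. s i = (t(j := t l)) (partition_perm P\<^sub>1 i))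
           \<and> (\<forall>i\<in>{Suc j..<r}. s i = t (partition_perm P\<^sub>2 i))"
          using partition_perm_nc_join_left[OF lj P] partition_perm_nc_join_inner[OF lj P]
            partition_perm_nc_join_outer[OF lj P] by auto
        finally show ?thesis
          by (simp add: card_nc_join[OF lj P] power_add)
      qed
      then show ?case
        by (subst sum_product) (simp only: sum_distrib_left cong: sum.cong)
    qed
    also have "of_bool (t l = s l) * c * planar_moment c (map (?p t) [Suc l..<r])
      = (\<Sum>Q\<in>NC_interval (Suc l) r. c ^ card (insert {l} Q) * ?ok t l r (insert {l} Q))"
    proof -
      have "of_bool (t l = s l) * c * (c ^ card Q * ?ok t (Suc l) r Q) = c ^ card (insert {l} Q) * ?ok t l r (insert {l} Q)"
        if Q: "Q \<in> NC_interval (Suc l) r" for Q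
      proof -
        have part: "partition_on {Suc l..<r} Q" and notin: "{l} \<notin> Q" and fin: "finite Q"
          using Q singleton_notin_NC_interval[OF Q] finite_elements[of "{Suc l..<r}" Q] by (auto simp: NC_interval_def)
        have part': "partition_on {l..<r} (insert {l} Q)"
          using partition_on_singleton_insert[OF True, of "insert {l} Q"] part notin by blast
        have "partition_perm (insert {l} Q) l = l"
          using partition_perm_eq_block_pred[OF part', of "{l}" l] by (simp add: block_pred_def)
        moreover have "partition_perm (insert {l} Q) i = partition_perm Q i" if "i \<in> {Suc l..<r}" for i
        proof -
          obtain B where "B \<in> Q" "i \<in> B" using partition_on_blockE[OF part \<open>i \<in> {Suc l..<r}\<close>] .
          then show ?thesis
            using partition_perm_eq_block_pred[OF part', of B i] partition_perm_eq_block_pred[OF part, of B i] by simp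
        qed
        moreover have "{l..<r} = insert l {Suc l..<r}" using True by auto
        ultimately have "(\<forall>i\<in>{l..<r}. s i = t (partition_perm (insert {l} Q) i))
          \<longleftrightarrow> t l = s l \<and> (\<forall>i\<in>{Suc l..<r}. s i = t (partition_perm Q i))"
          by auto
        then show ?thesis using notin fin by simp
      qed
      moreover have "planar_moment c (map (?p t) [Suc l..<r]) = (\<Sum>Q\<in>NC_interval (Suc l) r. c ^ card Q * ?ok t (Suc l) r Q)"
        using True by (intro less) simp
      ultimately show ?thesis by (simp only: sum_distrib_left cong: sum.cong)
    qed
    finally show ?thesis
      by (simp only: sum_NC_interval_rec[OF True])
  qed
qed

section \<open>Counting compatible indices\<close>

text \<open>Values are assigned in increasing order of the variables: one in \<open>A\<close> has
  \<open>m\<close> choices, any other is determined by an earlier one. The induction removes the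
  last variable.\<close>

lemma card_copy_constrained:
  fixes lo hi :: nat
  assumes "A \<subseteq> {lo..<hi}" "\<And>x. x \<in> {lo..<hi} - A \<Longrightarrow> lo \<le> h x \<and> h x < x"
  shows "card {v \<in> {lo..<hi} \<rightarrow>\<^sub>E {..<m}. \<forall>x\<in>{lo..<hi} - A. v x = v (h x)} = (m::nat) ^ card A"
  using assms
proof (induction "hi - lo" arbitrary: hi A)
  case 0
  then have "{lo..<hi} = {}" "A = {}" by auto
  then show ?case by simp
next
  case (Suc n)
  then obtain hi' where hi: "hi = Suc hi'" and le: "lo \<le> hi'" and n: "n = hi' - lo"
    by (cases hi) auto
  let ?S = "\<lambda>hi A. {v \<in> {lo..<hi} \<rightarrow>\<^sub>E {..<m}. \<forall>x\<in>{lo..<hi} - A. v x = v (h x)}"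
  let ?A = "A - {hi'}"
  have set: "{lo..<hi} = insert hi' {lo..<hi'}" using hi le by auto
  have IH: "card (?S hi' ?A) = m ^ card ?A"
    using Suc.prems set by (intro Suc.hyps(1)[OF n]) auto
  have fin: "finite (?S hi' ?A)"
    by (rule finite_subset[of _ "{lo..<hi'} \<rightarrow>\<^sub>E {..<m}"]) (auto intro: finite_PiE)
  have old: "(v(hi' := y)) x = (v(hi' := y)) (h x) \<longleftrightarrow> v x = v (h x)" if "x \<in> {lo..<hi'} - A" for v y x
    using that Suc.prems(2)[of x] set by auto
  have ext: "?S hi A = (\<lambda>(y, v). v(hi' := y)) ` {(y, v). y < m \<and> v \<in> ?S hi' ?A \<and> (hi' \<in> A \<or> y = v (h hi'))}"
    (is "_ = ?F ` ?T")
  proof (intro equalityI subsetI)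
    fix v assume v: "v \<in> ?S hi A"
    let ?v = "v(hi' := undefined)"
    have "v = ?F (v hi', ?v)" by simp
    moreover have "(v hi', ?v) \<in> ?T"
    proof -
      have "?v \<in> {lo..<hi'} \<rightarrow>\<^sub>E {..<m}" "v hi' < m"
        using v unfolding set by (auto simp: PiE_iff extensional_def)
      moreover have "?v x = ?v (h x)" if "x \<in> {lo..<hi'} - ?A" for x
      proof -
        have x: "x \<in> {lo..<hi'} - A" using that by auto
        then have "x \<in> {lo..<hi} - A" using set by simp
        then have "v x = v (h x)" using v by blast
        then show ?thesis by (simp only: old[OF x])
      qed
      moreover have "hi' \<in> A \<or> v hi' = ?v (h hi')"
      proof (cases "hi' \<in> A")
        case False
        then have x: "hi' \<in> {lo..<hi} - A" using set by simp
        then have "v hi' = v (h hi')" using v by blast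
        then show ?thesis using Suc.prems(2)[OF x] by simp
      qed simp
      ultimately show ?thesis by simp
    qed
    ultimately show "v \<in> ?F ` ?T" by (rule image_eqI)
  next
    fix w assume "w \<in> ?F ` ?T"
    then obtain y v where w: "w = v(hi' := y)" and y: "y < m" and v: "v \<in> ?S hi' ?A"
      and c: "hi' \<in> A \<or> y = v (h hi')" by auto
    have "w \<in> {lo..<hi} \<rightarrow>\<^sub>E {..<m}"
      using v y unfolding set w by (auto simp: PiE_iff extensional_def)
    moreover have "w x = w (h x)" if "x \<in> {lo..<hi} - A" for x
    proof (cases "x = hi'")
      case True
      then show ?thesis using c that Suc.prems(2)[OF that] by (auto simp: w)
    next
      case False
      then have x: "x \<in> {lo..<hi'} - A" using that set by auto
      then have "v x = v (h x)" using v by blast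
      then show ?thesis unfolding w old[OF x] .
    qed
    ultimately show "w \<in> ?S hi A" by simp
  qed
  have inj: "inj_on ?F ?T"
  proof (rule inj_onI, clarify)
    fix y v y' v' assume "v \<in> {lo..<hi'} \<rightarrow>\<^sub>E {..<m}" "v' \<in> {lo..<hi'} \<rightarrow>\<^sub>E {..<m}"
      and eq: "v(hi' := y) = v'(hi' := y')"
    then have "v hi' = v' hi'" by (auto simp: PiE_iff extensional_def)
    with eq show "y = y' \<and> v = v'" by (metis fun_upd_same fun_upd_triv fun_upd_upd)
  qed
  have "card (?S hi A) = card ?T"
    unfolding ext by (rule card_image[OF inj])
  also have "\<dots> = m ^ card A"
  proof (cases "hi' \<in> A")
    case True
    then have "?T = {..<m} \<times> ?S hi' ?A" by auto
    then have "card ?T = m * m ^ card ?A" by (simp only: card_cartesian_product IH card_lessThan)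
    moreover have "finite A" using Suc.prems(1) finite_subset by blast
    then have "card A = Suc (card ?A)" using True by (rule card.remove)
    ultimately show ?thesis by simp
  next
    case False
    then have hA: "lo \<le> h hi'" "h hi' < hi'" using Suc.prems(2)[of hi'] set by auto
    then have "?T = (\<lambda>v. (v (h hi'), v)) ` ?S hi' ?A" using False by (auto simp: PiE_iff)
    moreover have "inj_on (\<lambda>v. (v (h hi'), v)) (?S hi' ?A)" by (auto intro: inj_onI)
    ultimately have "card ?T = m ^ card ?A" by (simp only: card_image IH)
    then show ?thesis using False by simp
  qed
  finally show ?case .
qed

section \<open>Gaps between neighbouring points of a block\<close>

locale nc_interval_partition =
  fixes L R :: nat and P :: "nat set set"
  assumes P_NC: "P \<in> NC_interval L R"
begin

lemma part: "partition_on {L..<R} P" and nc: "noncrossing P"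
  using P_NC by (auto simp: NC_interval_def)

abbreviation \<sigma> where "\<sigma> \<equiv> partition_perm P"

lemma block_subset: "B \<in> P \<Longrightarrow> B \<subseteq> {L..<R}"
  using partition_on_memD[OF part] by blast

lemma block_finite: "B \<in> P \<Longrightarrow> finite B"
  using block_subset finite_subset by blast

lemma block_nonempty: "B \<in> P \<Longrightarrow> B \<noteq> {}"
  using partition_on_nonemptyE[OF part] by blast

lemmas block_Min_in = Min_in[OF block_finite block_nonempty]
  and block_Max_in = Max_in[OF block_finite block_nonempty]

lemma perm_Min: "B \<in> P \<Longrightarrow> \<sigma> (Min B) = Max B"
  using partition_perm_eq_block_pred[OF part _ block_Min_in] by (simp add: block_pred_def)

lemma perm_pred:
  assumes "B \<in> P" "i \<in> B" "i \<noteq> Min B"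
  shows "\<sigma> i \<in> B" "\<sigma> i < i" "\<And>x. x \<in> B \<Longrightarrow> x < i \<Longrightarrow> x \<le> \<sigma> i"
proof -
  have eq: "\<sigma> i = Max {b \<in> B. b < i}"
    using partition_perm_eq_block_pred[OF part assms(1,2)] assms(3) by (simp add: block_pred_def)
  have fin: "finite {b \<in> B. b < i}" using block_finite[OF assms(1)] by simp
  have "Min B \<le> i" using Min_le[OF block_finite] assms by blast
  then have "Min B \<in> {b \<in> B. b < i}" using block_Min_in assms by auto
  then have "{b \<in> B. b < i} \<noteq> {}" by blast
  from Max_in[OF fin this] show "\<sigma> i \<in> B" "\<sigma> i < i" unfolding eq by auto
  show "x \<le> \<sigma> i" if "x \<in> B" "x < i" for x unfolding eq using that fin by (intro Max_ge) auto
qed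

lemma perm_in_block: "B \<in> P \<Longrightarrow> i \<in> B \<Longrightarrow> \<sigma> i \<in> B"
  using perm_Min perm_pred(1) block_Max_in by metis

text \<open>The preimage is the next larger point of the block.\<close>

lemma perm_surj_pred:
  assumes "B \<in> P" "i \<in> B" "i \<noteq> Max B"
  obtains i' where "i' \<in> B" "i' \<noteq> Min B" "\<sigma> i' = i"
proof -
  let ?U = "{b \<in> B. i < b}"
  have fin: "finite ?U" using block_finite assms by simp
  have "i \<le> Max B" using Max_ge[OF block_finite] assms by blast
  then have "Max B \<in> ?U" using assms block_Max_in by auto
  then have in': "Min ?U \<in> ?U" using Min_in[OF fin] by blast
  have ne: "Min ?U \<noteq> Min B" using in' Min_le[OF block_finite[OF assms(1)] assms(2)] by auto
  have iU: "i < Min ?U" "Min ?U \<in> B" using in' by auto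
  have "\<sigma> (Min ?U) \<le> i"
  proof (rule ccontr)
    assume "\<not> ?thesis"
    then have "\<sigma> (Min ?U) \<in> ?U" using perm_pred(1)[OF assms(1) iU(2) ne] by auto
    then have "Min ?U \<le> \<sigma> (Min ?U)" using fin by (intro Min_le)
    then show False using perm_pred(2)[OF assms(1) iU(2) ne] by auto
  qed
  moreover have "i \<le> \<sigma> (Min ?U)" using perm_pred(3)[OF assms(1) iU(2) ne assms(2) iU(1)] .
  ultimately show thesis using that[of "Min ?U"] iU ne by auto
qed

lemma perm_inj_pred:
  assumes "B \<in> P" "i \<in> B" "i \<noteq> Min B" "C \<in> P" "j \<in> C" "j \<noteq> Min C" "\<sigma> i = \<sigma> j"
  shows "i = j"
proof -
  have "B = C" using partition_on_unique[OF part assms(1,4) perm_pred(1)[OF assms(1-3)]]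
      perm_pred(1)[OF assms(4-6)] assms(7) by simp
  then show ?thesis
    using perm_pred(2,3)[OF assms(1-3)] perm_pred(2,3)[OF assms(4-6)] assms
    by (metis linorder_neqE_nat not_le)
qed

text \<open>Such an interval is a union of blocks; the gaps between consecutive points of a block
  are the typical case.\<close>

definition block_closed :: "nat \<Rightarrow> nat \<Rightarrow> bool" where
  "block_closed l r \<longleftrightarrow> L \<le> l \<and> r \<le> R \<and> (\<forall>C\<in>P. C \<inter> {l..<r} \<noteq> {} \<longrightarrow> C \<subseteq> {l..<r})"

lemma block_closedD: "block_closed l r \<Longrightarrow> C \<in> P \<Longrightarrow> x \<in> C \<Longrightarrow> l \<le> x \<Longrightarrow> x < r \<Longrightarrow> C \<subseteq> {l..<r}"
  unfolding block_closed_def by (metis IntI atLeastLessThan_iff empty_iff)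

text \<open>A block with one point inside the gap and one outside would cross the block of
  \<open>i\<close> at the neighbours \<open>\<sigma> i\<close> and \<open>i\<close>.\<close>

lemma block_closed_gap:
  assumes "B \<in> P" "i \<in> B" "i \<noteq> Min B"
  shows "block_closed (Suc (\<sigma> i)) i"
  unfolding block_closed_def
proof (intro conjI ballI impI)
  note pred = perm_pred[OF assms]
  show "L \<le> Suc (\<sigma> i)" "i \<le> R" using block_subset assms pred(1) by fastforce+
  fix C assume C: "C \<in> P" "C \<inter> {Suc (\<sigma> i)..<i} \<noteq> {}"
  then obtain y where "y \<in> C" "y \<in> {Suc (\<sigma> i)..<i}" by blast
  then have y: "y \<in> C" "\<sigma> i < y" "y < i" by auto
  have ne: "B \<noteq> C" using pred(3)[of y] y by auto
  show "C \<subseteq> {Suc (\<sigma> i)..<i}"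
  proof
    fix z assume z: "z \<in> C"
    have "z \<noteq> \<sigma> i" "z \<noteq> i" using partition_on_unique[OF part assms(1) C(1)] pred(1) assms(2) z ne by blast+
    moreover have "\<not> z < \<sigma> i"
      using noncrossingD[OF nc C(1) assms(1) z pred(1) y(1) assms(2) _ y(2,3)] ne by blast
    moreover have "\<not> i < z"
      using noncrossingD[OF nc assms(1) C(1) pred(1) y(1) assms(2) z y(2,3)] ne by blast
    ultimately show "z \<in> {Suc (\<sigma> i)..<i}" by auto
  qed
qed

lemma block_closed_after:
  assumes "block_closed l r" "B \<in> P" "l \<in> B" "l < r"
  shows "block_closed (Suc (Max B)) r" "l \<le> Max B" "Max B < r" "Min B = l"
proof -
  have sub: "B \<subseteq> {l..<r}" using block_closedD[OF assms(1,2,3)] assms(4) by simp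
  show lM: "l \<le> Max B" using Max_ge[OF block_finite] assms by blast
  show "Max B < r" using sub block_Max_in[OF assms(2)] assms(2) by auto
  show "Min B = l" using sub assms block_finite by (intro Min_eqI) auto
  show "block_closed (Suc (Max B)) r"
    unfolding block_closed_def
  proof (intro conjI ballI impI)
    show "L \<le> Suc (Max B)" "r \<le> R" using assms(1) lM by (auto simp: block_closed_def)
    fix C assume C: "C \<in> P" "C \<inter> {Suc (Max B)..<r} \<noteq> {}"
    then obtain y where "y \<in> C" "y \<in> {Suc (Max B)..<r}" by blast
    then have y: "y \<in> C" "Max B < y" "y < r" by auto
    have ne: "B \<noteq> C" using y Max_ge[OF block_finite[OF assms(2)], of y] by auto
    have Csub: "C \<subseteq> {l..<r}" using block_closedD[OF assms(1) C(1) y(1)] y lM by simp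
    show "C \<subseteq> {Suc (Max B)..<r}"
    proof
      fix z assume z: "z \<in> C"
      have "z \<noteq> l" "z \<noteq> Max B"
        using partition_on_unique[OF part assms(2) C(1)] assms(2,3) block_Max_in z ne by blast+
      moreover have "\<not> (l < z \<and> z < Max B)"
        using noncrossingD[OF nc assms(2) C(1) assms(3) z block_Max_in[OF assms(2,2)] y(1) _ _ y(2)] ne by blast
      ultimately show "z \<in> {Suc (Max B)..<r}" using Csub z by auto
    qed
  qed
qed

text \<open>The interval is exhausted by its outer blocks: from \<open>l\<close> one jumps to the
  point after the maximum of the block of \<open>l\<close>, and so on. Each jump preserves
  \<open>b\<close> by hypothesis.\<close>

lemma boundary_eq:
  assumes "block_closed l r" "l \<le> r" "\<And>C. C \<in> P \<Longrightarrow> C \<subseteq> {l..<r} \<Longrightarrow> b (Suc (Max C)) = b (Min C)"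
  shows "b l = b r"
  using assms
proof (induction "r - l" arbitrary: l rule: less_induct)
  case less
  show ?case
  proof (cases "l = r")
    case False
    then have lr: "l < r" using less.prems by simp
    moreover have "L \<le> l" "r \<le> R" using less.prems(1) by (auto simp: block_closed_def)
    ultimately obtain B where B: "B \<in> P" "l \<in> B"
      using partition_on_blockE[OF part, of l] by auto
    note after = block_closed_after[OF less.prems(1) B lr]
    have "B \<subseteq> {l..<r}" using block_closedD[OF less.prems(1) B] lr by simp
    then have "b (Suc (Max B)) = b l" using less.prems(3) B after(4) by metis
    moreover have "b (Suc (Max B)) = b r"
      using after by (intro less.hyps less.prems(3)) auto
    ultimately show ?thesis by simp
  qed simp
qed

end

text \<open>Turns the pair (row index, traced index) of a marginal into the pair of \<open>B\<close>
  and \<open>C\<close> indices naming a slice of the tensor; for \<open>AC\<close> it is the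
  \<open>B\<close> factor that is traced out.\<close>

fun orient :: "marginal \<Rightarrow> nat \<Rightarrow> nat \<Rightarrow> colour" where
  "orient AB b k = (b, k)"
| "orient AC b k = (k, b)"

lemma orient_eq_iff:
  "orient g b k = orient g' b' k' \<longleftrightarrow> (if g = g' then b = b' \<and> k = k' else b = k' \<and> k = b')"
  by (cases g; cases g') auto

text \<open>
  The indices \<open>b\<^sub>i\<close> (row of the \<open>i\<close>-th marginal) and \<open>k\<^sub>i\<close> (traced out in the \<open>i\<close>-th marginal) are
  stored as \<open>v (2 * i)\<close> and \<open>v (2 * i + 1)\<close>.
\<close>

abbreviation row_colour :: "(nat \<Rightarrow> marginal) \<Rightarrow> (nat \<Rightarrow> nat) \<Rightarrow> nat \<Rightarrow> colour" where
  "row_colour f v i \<equiv> orient (f i) (v (2 * i)) (v (2 * i + 1))"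

text \<open>The column index of the \<open>i\<close>-th marginal is the row index of the next one,
  stored at \<open>2 * (i + 1)\<close>. Matrix multiplication is thus built into the
  numbering.\<close>

abbreviation col_colour :: "(nat \<Rightarrow> marginal) \<Rightarrow> (nat \<Rightarrow> nat) \<Rightarrow> nat \<Rightarrow> colour" where
  "col_colour f v i \<equiv> orient (f i) (v (2 * i + 2)) (v (2 * i + 1))"

context nc_interval_partition
begin

definition compatible :: "(nat \<Rightarrow> marginal) \<Rightarrow> (nat \<Rightarrow> nat) \<Rightarrow> bool" where
  "compatible f v \<longleftrightarrow> (\<forall>i\<in>{L..<R}. row_colour f v i = col_colour f v (\<sigma> i))"

text \<open>Induction on the width of the block: each gap is filled by narrower blocks, for which
  the first claim is known, so \<open>b\<close> agrees at both ends of the gap. The colour equation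
  then gives \<open>k_i = k_(\<sigma> i)\<close> in either case: directly if \<open>f\<close> does
  not change, and through \<open>k_i = b_(\<sigma> i + 1) = b_i = k_(\<sigma> i)\<close> if it
  does.\<close>

lemma compatible_block:
  assumes "compatible f v" "B \<in> P"
  shows "v (2 * Suc (Max B)) = v (2 * Min B) \<and> (\<forall>i\<in>B. v (2 * i + 1) = v (2 * Min B + 1))
    \<and> (\<forall>i\<in>B. v (2 * i) = v (2 * \<sigma> i + 2))"
  using assms(2)
proof (induction "Max B - Min B" arbitrary: B rule: less_induct)
  case less
  note B = less.prems
  have eq: "row_colour f v i = col_colour f v (\<sigma> i)" if "i \<in> B" for i
    using assms(1) block_subset[OF B] that by (auto simp: compatible_def)
  have gap: "v (2 * Suc (\<sigma> i)) = v (2 * i)" if i: "i \<in> B" "i \<noteq> Min B" for i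
  proof (rule boundary_eq[of "Suc (\<sigma> i)" i "\<lambda>x. v (2 * x)"])
    note pred = perm_pred[OF B i]
    show "block_closed (Suc (\<sigma> i)) i" by (rule block_closed_gap[OF B i])
    show "Suc (\<sigma> i) \<le> i" using pred by simp
    fix C assume C: "C \<in> P" "C \<subseteq> {Suc (\<sigma> i)..<i}"
    have "\<sigma> i < Min C" "Max C < i" using C block_Min_in block_Max_in by fastforce+
    moreover have "Min B \<le> \<sigma> i" "i \<le> Max B" using Min_le[OF block_finite[OF B] pred(1)] Max_ge[OF block_finite[OF B] i(1)] .
    ultimately have "Max C - Min C < Max B - Min B" using pred(2) by linarith
    from less.hyps[OF this C(1)] show "v (2 * Suc (Max C)) = v (2 * Min C)" by blast
  qed
  have k: "v (2 * i + 1) = v (2 * \<sigma> i + 1)" if i: "i \<in> B" "i \<noteq> Min B" for i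
    using eq[OF i(1)] gap[OF i] by (auto simp: orient_eq_iff split: if_splits)
  have const: "v (2 * i + 1) = v (2 * Min B + 1)" if "i \<in> B" for i
    using that
  proof (induction i rule: less_induct)
    case (less i)
    show ?case
    proof (cases "i = Min B")
      case False
      then show ?thesis using k[of i] less perm_pred(1,2)[OF B less.prems] by metis
    qed simp
  qed
  \<comment> \<open>The step from minimum to maximum does not span a gap; here it is the constancy
    of \<open>k\<close> that makes the colour equation identify the two outer values of
    \<open>b\<close>.\<close>
  have "v (2 * Min B) = v (2 * Max B + 2)"
    using eq[OF block_Min_in[OF B B]] const[OF block_Max_in[OF B B]] perm_Min[OF B]
    by (auto simp: orient_eq_iff split: if_splits)
  moreover from this have "v (2 * i) = v (2 * \<sigma> i + 2)" if "i \<in> B" for i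
    using gap[OF that] perm_Min[OF B] by (cases "i = Min B") auto
  ultimately show ?case using const by auto
qed

definition block_of :: "nat \<Rightarrow> nat set" where
  "block_of i = (THE B. B \<in> P \<and> i \<in> B)"

lemma block_of_eq: "B \<in> P \<Longrightarrow> i \<in> B \<Longrightarrow> block_of i = B"
  unfolding block_of_def using partition_on_unique[OF part] by (intro the_equality) blast+

lemma block_of: "i \<in> {L..<R} \<Longrightarrow> block_of i \<in> P" "i \<in> {L..<R} \<Longrightarrow> i \<in> block_of i"
  using partition_on_blockE[OF part, of i] block_of_eq by metis+

text \<open>
  Listing the variables as \<open>b\<^sub>L, k\<^sub>L, b\<^sub>L\<^sub>+\<^sub>1, ...\<close>, each one is either free or a copy of an earlier one.
\<close>

definition free_variables :: "(nat \<Rightarrow> marginal) \<Rightarrow> nat set" where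
  "free_variables f = insert (2 * L)
     ((\<lambda>i. if i = Min (block_of i) then 2 * i + 1 else 2 * \<sigma> i + 2) ` {i \<in> {L..<R}. f i = f (\<sigma> i)})"

text \<open>Odd \<open>x\<close> is some \<open>k_i\<close>: it copies the \<open>k\<close> of the
  preceding point of the block, or \<open>b_i\<close> at the minimum. Even \<open>x\<close> is some
  \<open>b_(i+1)\<close>: it copies \<open>b\<close> at the block minimum if \<open>i\<close> is the
  maximum, and \<open>k_i\<close> otherwise. Copies between a \<open>b\<close> and a
  \<open>k\<close> stem from an alternation of \<open>f\<close>, and without it that variable is
  free; the other copies stem from planarity.\<close>

definition copied_variable :: "nat \<Rightarrow> nat" where
  "copied_variable x =
     (if odd x then let i = x div 2 in if i = Min (block_of i) then 2 * i else 2 * \<sigma> i + 1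
      else let i = x div 2 - 1 in if i = Max (block_of i) then 2 * Min (block_of i) else 2 * i + 1)"

lemma perm_range: "i \<in> {L..<R} \<Longrightarrow> \<sigma> i \<in> {L..<R}"
  using perm_in_block[OF block_of(1) block_of(2)] block_subset[OF block_of(1)] by blast

lemma compatible_imp_copied:
  assumes "compatible f v" "x \<in> {2 * L..<2 * R + 1} - free_variables f"
  shows "v x = v (copied_variable x)"
proof (cases "odd x")
  case True
  then obtain i where x: "x = 2 * i + 1" by (elim oddE)
  then have i: "i \<in> {L..<R}" using assms(2) by auto
  note B = block_of[OF i] and cb = compatible_block[OF assms(1) block_of(1)[OF i]]
  show ?thesis
  proof (cases "i = Min (block_of i)")
    case True
    then have "f i \<noteq> f (\<sigma> i)" using assms(2) i by (auto simp: free_variables_def x)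
    moreover have "row_colour f v i = col_colour f v (\<sigma> i)"
      using assms(1) i by (auto simp: compatible_def)
    ultimately have "v (2 * i) = v (2 * \<sigma> i + 1)" by (simp add: orient_eq_iff)
    also have "\<dots> = v (2 * i + 1)" using cb perm_in_block[OF B] B by metis
    finally show ?thesis using True by (simp add: copied_variable_def x)
  next
    case False
    have "v (2 * i + 1) = v (2 * \<sigma> i + 1)" using cb perm_in_block[OF B] B(2) by metis
    with False show ?thesis by (simp add: copied_variable_def x)
  qed
next
  case False
  have ne: "x \<noteq> 2 * L" using assms(2) by (auto simp: free_variables_def)
  moreover obtain y where "x = 2 * y" using False by (auto elim: evenE)
  moreover have "2 * L \<le> x" using assms(2) by simp
  ultimately have "x = 2 * (y - 1) + 2" by simp
  then obtain i where x: "x = 2 * i + 2" by blast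
  have i: "i \<in> {L..<R}" using assms(2) ne by (auto simp: x)
  note B = block_of[OF i] and cb = compatible_block[OF assms(1) block_of(1)[OF i]]
  show ?thesis
  proof (cases "i = Max (block_of i)")
    case True
    then show ?thesis using cb by (simp add: copied_variable_def x)
  next
    case False
    \<comment> \<open>The variable \<open>b_(i+1)\<close> enters the colour equation of the point
      whose predecessor in the block is \<open>i\<close>.\<close>
    obtain j where j: "j \<in> block_of i" "j \<noteq> Min (block_of i)" "\<sigma> j = i"
      using perm_surj_pred[OF B False] .
    have jr: "j \<in> {L..<R}" using j(1) block_subset[OF B(1)] by auto
    have "f j \<noteq> f (\<sigma> j)"
    proof
      assume "f j = f (\<sigma> j)"
      then have "x \<in> free_variables f"
        using jr j block_of_eq[OF B(1) j(1)] by (auto simp: free_variables_def x intro!: image_eqI[of _ _ j])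
      then show False using assms(2) by simp
    qed
    moreover have "row_colour f v j = col_colour f v (\<sigma> j)"
      using assms(1) jr by (auto simp: compatible_def)
    ultimately have "v (2 * i + 2) = v (2 * j + 1)" using j by (simp add: orient_eq_iff)
    also have "\<dots> = v (2 * i + 1)" using cb j B by metis
    finally show ?thesis using False by (simp add: copied_variable_def x)
  qed
qed

text \<open>The copying rules give back the planar facts: \<open>k\<close> is constant on blocks,
  and \<open>b\<close> agrees at the two ends of every block, hence across every gap by
  \<open>boundary_eq\<close>. At an alternation they add \<open>b_i = k_i\<close>, which makes the
  two colours agree.\<close>

lemma copied_imp_compatible:
  assumes copied: "\<And>x. x \<in> {2 * L..<2 * R + 1} - free_variables f \<Longrightarrow> v x = v (copied_variable x)"
  shows "compatible f v"
proof -
  have odd_free: "2 * i + 1 \<in> free_variables f \<longleftrightarrow> i = Min (block_of i) \<and> f i = f (\<sigma> i)" if "i \<in> {L..<R}" for i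
    using that by (auto simp: free_variables_def split: if_splits) presburger+
  have even_free: "\<exists>j\<in>{L..<R}. f j = f (\<sigma> j) \<and> j \<noteq> Min (block_of j) \<and> \<sigma> j = i"
    if "2 * i + 2 \<in> free_variables f" "i \<in> {L..<R}" for i
    using that by (auto simp: free_variables_def split: if_splits) presburger+
  have k: "v (2 * i + 1) = v (2 * \<sigma> i + 1)" if "i \<in> {L..<R}" "i \<noteq> Min (block_of i)" for i
    using copied[of "2 * i + 1"] that odd_free[OF that(1)] by (auto simp: copied_variable_def)
  have const: "v (2 * i + 1) = v (2 * Min B + 1)" if "B \<in> P" "i \<in> B" for B i
    using that(2)
  proof (induction i rule: less_induct)
    case (less i)
    have "i \<in> {L..<R}" using block_subset that(1) less.prems by blast
    then show ?case
      using k[of i] less perm_pred(1,2)[OF that(1) less.prems] block_of_eq[OF that(1) less.prems] by metis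
  qed
  have kmin: "v (2 * i + 1) = v (2 * i)" if "i \<in> {L..<R}" "i = Min (block_of i)" "f i \<noteq> f (\<sigma> i)" for i
    using copied[of "2 * i + 1"] that odd_free[OF that(1)] by (auto simp: copied_variable_def)
  have bmax: "v (2 * Suc (Max B)) = v (2 * Min B)" if B: "B \<in> P" for B
  proof -
    have M: "Max B \<in> {L..<R}" "block_of (Max B) = B"
      using block_Max_in[OF B B] block_subset[OF B] block_of_eq[OF B] by blast+
    have "2 * Max B + 2 \<notin> free_variables f"
    proof
      assume "2 * Max B + 2 \<in> free_variables f"
      from even_free[OF this M(1)] obtain j where j: "j \<in> {L..<R}" "j \<noteq> Min (block_of j)" "\<sigma> j = Max B" by auto
      note pred = perm_pred[OF block_of(1,2)[OF j(1)] j(2)]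
      have "block_of j = B"
        using partition_on_unique[OF part block_of(1)[OF j(1)] B pred(1)] block_Max_in[OF B B] j(3) by simp
      then show False using pred(2) Max_ge[OF block_finite[OF B], of j] block_of(2)[OF j(1)] j(3) by simp
    qed
    then show ?thesis using copied[of "2 * Max B + 2"] M by (simp add: copied_variable_def)
  qed
  have bgap: "v (2 * i) = v (2 * \<sigma> i + 2)" if "i \<in> {L..<R}" for i
  proof (cases "i = Min (block_of i)")
    case True
    then show ?thesis using bmax[OF block_of(1)[OF that]] perm_Min[OF block_of(1)[OF that]] by simp
  next
    case False
    have "v (2 * Suc (\<sigma> i)) = v (2 * i)"
      using block_closed_gap[OF block_of[OF that] False] perm_pred(2)[OF block_of[OF that] False] bmax
      by (intro boundary_eq[of "Suc (\<sigma> i)" i "\<lambda>x. v (2 * x)"]) auto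
    then show ?thesis by simp
  qed
  have alt: "v (2 * i) = v (2 * i + 1)" if i: "i \<in> {L..<R}" "f i \<noteq> f (\<sigma> i)" for i
  proof (cases "i = Min (block_of i)")
    case False
    note pred = perm_pred[OF block_of[OF i(1)] False]
    have B: "block_of (\<sigma> i) = block_of i" using block_of_eq[OF block_of(1)[OF i(1)] pred(1)] .
    have "2 * \<sigma> i + 2 \<notin> free_variables f"
    proof
      assume "2 * \<sigma> i + 2 \<in> free_variables f"
      from even_free[OF this perm_range[OF i(1)]]
      obtain j where j: "j \<in> {L..<R}" "f j = f (\<sigma> j)" "j \<noteq> Min (block_of j)" "\<sigma> j = \<sigma> i" by auto
      \<comment> \<open>By injectivity only the point \<open>i\<close> could have made this variable
        free, but \<open>f\<close> alternates there.\<close>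
      have "j = i" by (rule perm_inj_pred[OF block_of[OF j(1)] j(3) block_of[OF i(1)] False j(4)])
      then show False using j i by simp
    qed
    moreover have "\<sigma> i \<noteq> Max (block_of i)"
      using pred(2) Max_ge[OF block_finite[OF block_of(1)[OF i(1)]] block_of(2)[OF i(1)]] by auto
    ultimately have "v (2 * \<sigma> i + 2) = v (2 * \<sigma> i + 1)"
      using copied[of "2 * \<sigma> i + 2"] perm_range[OF i(1)] B by (simp add: copied_variable_def)
    then show ?thesis using bgap[OF i(1)] k[OF i(1) False] by simp
  qed (use kmin i in simp)
  show ?thesis
    unfolding compatible_def
  proof
    fix i assume i: "i \<in> {L..<R}"
    have "v (2 * i + 1) = v (2 * \<sigma> i + 1)"
      using const[OF block_of(1)[OF i] block_of(2)[OF i]]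
        const[OF block_of(1)[OF i] perm_in_block[OF block_of(1,2)[OF i]]] by simp
    then show "row_colour f v i = col_colour f v (\<sigma> i)"
      using bgap[OF i] alt[OF i] by (simp add: orient_eq_iff)
  qed
qed

text \<open>Distinct points free distinct variables, by parity and injectivity of
  \<open>\<sigma>\<close>. The extra one is the first row index, which has nothing earlier to
  copy.\<close>

lemma card_free_variables:
  "card (free_variables f) = Suc (card {i \<in> {L..<R}. f i = f (\<sigma> i)})"
proof -
  let ?g = "\<lambda>i. if i = Min (block_of i) then 2 * i + 1 else 2 * \<sigma> i + 2"
  let ?I = "{i \<in> {L..<R}. f i = f (\<sigma> i)}"
  have inj: "inj_on ?g ?I"
  proof (rule inj_onI)
    fix i j assume *: "i \<in> ?I" "j \<in> ?I" "?g i = ?g j"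
    then have i: "i \<in> {L..<R}" and j: "j \<in> {L..<R}" by auto
    show "i = j"
    proof (cases "i = Min (block_of i) \<or> j = Min (block_of j)")
      case True
      then show ?thesis using *(3) by (auto split: if_splits) presburger+
    next
      case False
      then have "\<sigma> i = \<sigma> j" using *(3) by auto
      then show ?thesis using perm_inj_pred[OF block_of[OF i] _ block_of[OF j]] False by blast
    qed
  qed
  have "?g i \<noteq> 2 * L" if "i \<in> ?I" for i
  proof (cases "i = Min (block_of i)")
    case False
    have "L \<le> \<sigma> i" using perm_range[of i] that by simp
    then show ?thesis using False by simp
  qed (simp, presburger)
  then have notin: "2 * L \<notin> ?g ` ?I" by fastforce
  have fin: "finite (?g ` ?I)" by simp
  show ?thesis
    unfolding free_variables_def card_insert_disjoint[OF fin notin] card_image[OF inj] ..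
qed

lemma card_compatible:
  assumes "L < R"
  shows "card {v \<in> {2 * L..<2 * R + 1} \<rightarrow>\<^sub>E {..<m}. compatible f v}
    = m ^ Suc (card {i \<in> {L..<R}. f i = f (\<sigma> i)})"
proof -
  have "{v \<in> {2 * L..<2 * R + 1} \<rightarrow>\<^sub>E {..<m}. compatible f v}
    = {v \<in> {2 * L..<2 * R + 1} \<rightarrow>\<^sub>E {..<m}. \<forall>x\<in>{2 * L..<2 * R + 1} - free_variables f. v x = v (copied_variable x)}"
    using compatible_imp_copied copied_imp_compatible by blast
  also have "card \<dots> = m ^ card (free_variables f)"
  proof (rule card_copy_constrained)
    show "free_variables f \<subseteq> {2 * L..<2 * R + 1}"
    proof
      fix x assume "x \<in> free_variables f"
      then consider "x = 2 * L" | i where "i \<in> {L..<R}" "x = 2 * i + 1"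
        | i where "i \<in> {L..<R}" "x = 2 * \<sigma> i + 2" by (auto simp: free_variables_def split: if_splits)
      then show "x \<in> {2 * L..<2 * R + 1}"
      proof cases
        case 3
        then show ?thesis using perm_range[of i] by auto
      qed (use assms in auto)
    qed
    fix x assume x: "x \<in> {2 * L..<2 * R + 1} - free_variables f"
    show "2 * L \<le> copied_variable x \<and> copied_variable x < x"
    proof (cases "odd x")
      case True
      then obtain i where xi: "x = 2 * i + 1" by (elim oddE)
      then have i: "i \<in> {L..<R}" using x by auto
      show ?thesis
        using perm_pred(2)[OF block_of[OF i]] perm_range[OF i] i by (auto simp: copied_variable_def xi)
    next
      case False
      have "x \<noteq> 2 * L" using x by (auto simp: free_variables_def)
      then have "x div 2 - 1 \<in> {L..<R}" "x = 2 * (x div 2 - 1) + 2" using x False by auto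
      then obtain i where xi: "x = 2 * i + 2" and i: "i \<in> {L..<R}" by blast
      have "Min (block_of i) \<le> i" using Min_le[OF block_finite[OF block_of(1)[OF i]] block_of(2)[OF i]] .
      moreover have "L \<le> Min (block_of i)"
        using block_Min_in[OF block_of(1)[OF i] block_of(1)[OF i]] block_subset[OF block_of(1)[OF i]] by auto
      ultimately show ?thesis using i by (auto simp: copied_variable_def xi)
    qed
  qed
  finally show ?thesis by (simp only: card_free_variables)
qed

text \<open>The whole interval is a union of blocks, so the condition closing the trace follows from
  compatibility.\<close>

lemma compatible_boundary:
  assumes "compatible f v" "L \<le> R"
  shows "v (2 * L) = v (2 * R)"
proof (rule boundary_eq[of L R "\<lambda>x. v (2 * x)"])
  show "block_closed L R" using block_subset by (auto simp: block_closed_def)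
qed (use assms compatible_block in blast)+

end

section \<open>Traces of words in the marginals\<close>

lemma sum_nat_mult_split:
  fixes F :: "nat \<Rightarrow> 'a::comm_monoid_add"
  shows "(\<Sum>q<N * m. F q) = (\<Sum>a<N. \<Sum>b<m. F (a * m + b))"
proof -
  have "(\<Sum>q<N * m. F q) = (\<Sum>a<N. sum F {a * m..<a * m + m})"
    by (rule sum.nat_group[symmetric])
  also have "\<dots> = (\<Sum>a<N. \<Sum>b<m. F (a * m + b))"
  proof (rule sum.cong[OF refl])
    fix a
    show "sum F {a * m..<a * m + m} = (\<Sum>b<m. F (a * m + b))"
      by (rule sum.reindex_bij_witness[of _ "\<lambda>b. a * m + b" "\<lambda>q. q - a * m"]) auto
  qed
  finally show ?thesis .
qed

lemma sum_PiE_insert: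
  assumes "x \<notin> S"
  shows "(\<Sum>v\<in>insert x S \<rightarrow>\<^sub>E T. F v) = (\<Sum>y\<in>T. \<Sum>v\<in>S \<rightarrow>\<^sub>E T. F (v(x := y)))"
proof -
  have "(\<Sum>v\<in>insert x S \<rightarrow>\<^sub>E T. F v) = (\<Sum>p\<in>T \<times> (S \<rightarrow>\<^sub>E T). F ((\<lambda>(y, v). v(x := y)) p))"
    unfolding PiE_insert_eq using inj_combinator[OF assms, of "\<lambda>_. T"]
    by (subst sum.reindex) auto
  then show ?thesis by (simp add: sum.cartesian_product split_beta')
qed

lemma mat_word_carrier:
  assumes "\<And>l. A l \<in> carrier_mat d d"
  shows "mat_word d A w \<in> carrier_mat d d"
  using assms by (induction w) (auto simp: mat_word_def intro: mult_carrier_mat)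

lemma mult_mat_entry:
  assumes "A \<in> carrier_mat d d" "B \<in> carrier_mat d d" "i < d" "j < d"
  shows "(A * B) $$ (i, j) = (\<Sum>q<d. A $$ (i, q) * B $$ (q, j))"
  using assms by (simp add: scalar_prod_def atLeast0LessThan)

lemma mat_word_Cons: "mat_word d A (l # w) = A l * mat_word d A w"
  by (simp add: mat_word_def)

lemma W_carrier: "W N m D x l \<in> carrier_mat (N * m) (N * m)"
  by (cases l) (auto simp: partial_trace_CD_def partial_trace_BD_def)

lemma index_pair_less: "a < N \<Longrightarrow> b < m \<Longrightarrow> a * m + b < N * (m::nat)"
proof -
  assume "a < N" "b < m"
  then have "a * m + b < Suc a * m" by simp
  also have "\<dots> \<le> N * m" using \<open>a < N\<close> by (intro mult_le_mono1) simp
  finally show ?thesis .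
qed

lemma W_entry:
  assumes "a < N" "b < m" "a' < N" "b' < m"
  shows "W N m D x l $$ (a * m + b, a' * m + b')
    = (\<Sum>k<m. \<Sum>d<D. x (entry_index a (orient l b k) d) * cnj (x (entry_index a' (orient l b' k) d)))"
  using assms index_pair_less[of a N b m] index_pair_less[of a' N b' m]
  by (cases l) (simp_all add: partial_trace_CD_def partial_trace_BD_def outer_def entry_index_def)

abbreviation colour_word :: "(nat \<Rightarrow> marginal) \<Rightarrow> (nat \<Rightarrow> nat) \<Rightarrow> nat \<Rightarrow> nat \<Rightarrow> (colour \<times> colour) list" where
  "colour_word f v l r \<equiv> map (\<lambda>i. (row_colour f v i, col_colour f v i)) [l..<r]"

text \<open>All row, column and traced indices are collected in one function \<open>v\<close>, whose
  values at \<open>2 * l\<close> and \<open>2 * r\<close> are the outer indices. Peeling off the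
  leftmost matrix adds the variables \<open>2 * l\<close> and \<open>2 * l + 1\<close>.\<close>

lemma mat_word_W_entry:
  assumes "l \<le> r" "a < N" "b < m" "a' < N" "b' < m"
  shows "mat_word (N * m) (W N m D x) (map f [l..<r]) $$ (a * m + b, a' * m + b')
    = (\<Sum>v\<in>{2 * l..<2 * r + 1} \<rightarrow>\<^sub>E {..<m}. of_bool (v (2 * l) = b \<and> v (2 * r) = b')
         * word_entry N D x (colour_word f v l r) a a')"
  using assms
proof (induction "r - l" arbitrary: l a b)
  case 0
  have eq: "a * m + b = a' * m + b' \<longleftrightarrow> a = a' \<and> b = b'"
  proof
    assume h: "a * m + b = a' * m + b'"
    have "a = (a * m + b) div m" "b = (a * m + b) mod m" "a' = (a' * m + b') div m" "b' = (a' * m + b') mod m"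
      using 0 by auto
    with h show "a = a' \<and> b = b'" by metis
  qed auto
  have S: "{2 * l..<2 * l + 1} = insert (2 * l) {}" by auto
  have "(\<Sum>v\<in>{2 * l..<2 * l + 1} \<rightarrow>\<^sub>E {..<m}. of_bool (v (2 * l) = b \<and> v (2 * l) = b') * of_bool (a = a'))
     = (\<Sum>y<m. if y = b then of_bool (b = b') * of_bool (a = a') else 0 :: complex)"
    unfolding S by (subst sum_PiE_insert) (auto intro!: sum.cong)
  also have "\<dots> = of_bool (b = b') * of_bool (a = a')"
    using 0 by (simp add: sum.delta)
  finally show ?case
    using 0 index_pair_less[of a N b m] index_pair_less[of a' N b' m] eq by (auto simp: mat_word_def)
next
  case (Suc n)
  then have lr: "l < r" by simp
  let ?V = "{2 * l + 2..<2 * r + 1} \<rightarrow>\<^sub>E {..<m}"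
  let ?w = "\<lambda>v e. word_entry N D x (colour_word f v (Suc l) r) e a'"
  let ?X = "\<lambda>k d. x (entry_index a (orient (f l) b k) d)"
  let ?Y = "\<lambda>e b1 k d. cnj (x (entry_index e (orient (f l) b1 k) d))"
  have IH: "mat_word (N * m) (W N m D x) (map f [Suc l..<r]) $$ (e * m + b1, a' * m + b')
    = (\<Sum>v\<in>?V. of_bool (v (2 * l + 2) = b1 \<and> v (2 * r) = b') * ?w v e)" if "e < N" "b1 < m" for e b1
    using Suc.hyps(1)[of "Suc l" e b1] Suc.hyps(2) Suc.prems that lr by simp
  have "mat_word (N * m) (W N m D x) (map f [l..<r]) $$ (a * m + b, a' * m + b')
    = (\<Sum>e<N. \<Sum>b1<m. W N m D x (f l) $$ (a * m + b, e * m + b1)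
        * mat_word (N * m) (W N m D x) (map f [Suc l..<r]) $$ (e * m + b1, a' * m + b'))"
    using lr Suc.prems by (simp only: upt_conv_Cons list.map mat_word_Cons)
      (subst mult_mat_entry[OF W_carrier mat_word_carrier[OF W_carrier]],
        auto simp: index_pair_less sum_nat_mult_split)
  also have "\<dots> = (\<Sum>e<N. \<Sum>b1<m. (\<Sum>k<m. \<Sum>d<D. ?X k d * ?Y e b1 k d)
        * (\<Sum>v\<in>?V. of_bool (v (2 * l + 2) = b1 \<and> v (2 * r) = b') * ?w v e))"
    using Suc.prems by (intro sum.cong refl arg_cong2[where f = "(*)"] IH W_entry) auto
  also have "\<dots> = (\<Sum>e<N. \<Sum>b1<m. \<Sum>v\<in>?V. if b1 = v (2 * l + 2) then
        (\<Sum>k<m. \<Sum>d<D. ?X k d * ?Y e b1 k d) * (of_bool (v (2 * r) = b') * ?w v e) else 0)"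
    by (simp only: sum_distrib_left) (intro sum.cong refl, auto)
  also have "\<dots> = (\<Sum>e<N. \<Sum>v\<in>?V. \<Sum>b1<m. if b1 = v (2 * l + 2) then
        (\<Sum>k<m. \<Sum>d<D. ?X k d * ?Y e b1 k d) * (of_bool (v (2 * r) = b') * ?w v e) else 0)"
    by (intro sum.cong refl sum.swap)
  also have "\<dots> = (\<Sum>e<N. \<Sum>v\<in>?V. (\<Sum>k<m. \<Sum>d<D. ?X k d * ?Y e (v (2 * l + 2)) k d) * (of_bool (v (2 * r) = b') * ?w v e))"
  proof (intro sum.cong refl)
    fix e v assume "v \<in> ?V"
    then have "v (2 * l + 2) < m" using lr by (auto simp: PiE_iff)
    then show "(\<Sum>b1<m. if b1 = v (2 * l + 2) then
        (\<Sum>k<m. \<Sum>d<D. ?X k d * ?Y e b1 k d) * (of_bool (v (2 * r) = b') * ?w v e) else 0)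
      = (\<Sum>k<m. \<Sum>d<D. ?X k d * ?Y e (v (2 * l + 2)) k d) * (of_bool (v (2 * r) = b') * ?w v e)"
      by (simp add: sum.delta')
  qed
  also have "\<dots> = (\<Sum>e<N. \<Sum>v\<in>?V. \<Sum>k<m. \<Sum>d<D. of_bool (v (2 * r) = b') * (?X k d * (?Y e (v (2 * l + 2)) k d * ?w v e)))"
    by (simp only: sum_distrib_right sum_distrib_left mult_ac)
  also have "\<dots> = (\<Sum>v\<in>?V. \<Sum>e<N. \<Sum>k<m. \<Sum>d<D. of_bool (v (2 * r) = b') * (?X k d * (?Y e (v (2 * l + 2)) k d * ?w v e)))"
    by (rule sum.swap)
  also have "\<dots> = (\<Sum>v\<in>?V. \<Sum>k<m. \<Sum>e<N. \<Sum>d<D. of_bool (v (2 * r) = b') * (?X k d * (?Y e (v (2 * l + 2)) k d * ?w v e)))"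
    by (intro sum.cong refl sum.swap)
  also have "\<dots> = (\<Sum>k<m. \<Sum>v\<in>?V. \<Sum>e<N. \<Sum>d<D. of_bool (v (2 * r) = b') * (?X k d * (?Y e (v (2 * l + 2)) k d * ?w v e)))"
    by (rule sum.swap)
  also have "\<dots> = (\<Sum>k<m. \<Sum>v\<in>?V. of_bool (v (2 * r) = b')
      * (\<Sum>d<D. \<Sum>e<N. ?X k d * (?Y e (v (2 * l + 2)) k d * ?w v e)))"
    by (simp only: sum_distrib_left) (intro sum.cong refl sum.swap)
  \<comment> \<open>The fixed row index \<open>b\<close> is turned into a sum over \<open>y\<close>
    with a delta, so that it can become the value of \<open>v\<close> at
    \<open>2 * l\<close>.\<close>
  also have "\<dots> = (\<Sum>y<m. if y = b then (\<Sum>k<m. \<Sum>v\<in>?V. of_bool (v (2 * r) = b')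
      * (\<Sum>d<D. \<Sum>e<N. ?X k d * (?Y e (v (2 * l + 2)) k d * ?w v e))) else 0)"
    using Suc.prems by (simp add: sum.delta')
  also have "\<dots> = (\<Sum>y<m. \<Sum>k<m. \<Sum>v\<in>?V. of_bool (y = b \<and> v (2 * r) = b')
       * word_entry N D x ((orient (f l) y k, orient (f l) (v (2 * l + 2)) k) # colour_word f v (Suc l) r) a a')"
    by (intro sum.cong refl) auto
  also have "\<dots> = (\<Sum>y<m. \<Sum>k<m. \<Sum>v\<in>?V.
        of_bool ((v(2 * l + 1 := k, 2 * l := y)) (2 * l) = b \<and> (v(2 * l + 1 := k, 2 * l := y)) (2 * r) = b')
         * word_entry N D x (colour_word f (v(2 * l + 1 := k, 2 * l := y)) l r) a a')"
  proof (intro sum.cong refl)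
    fix y k v
    have "colour_word f (v(2 * l + 1 := k, 2 * l := y)) (Suc l) r = colour_word f v (Suc l) r"
      by (intro map_cong refl) auto
    then have "colour_word f (v(2 * l + 1 := k, 2 * l := y)) l r
       = (orient (f l) y k, orient (f l) (v (2 * l + 2)) k) # colour_word f v (Suc l) r"
      by (simp only: upt_conv_Cons[OF lr] list.map) simp
    moreover have "2 * r \<noteq> 2 * l" "2 * r \<noteq> 2 * l + 1" using lr by auto
    ultimately show "of_bool (y = b \<and> v (2 * r) = b')
       * word_entry N D x ((orient (f l) y k, orient (f l) (v (2 * l + 2)) k) # colour_word f v (Suc l) r) a a'
       = of_bool ((v(2 * l + 1 := k, 2 * l := y)) (2 * l) = b \<and> (v(2 * l + 1 := k, 2 * l := y)) (2 * r) = b')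
         * word_entry N D x (colour_word f (v(2 * l + 1 := k, 2 * l := y)) l r) a a'"
      by simp
  qed
  also have "\<dots> = (\<Sum>v\<in>insert (2 * l) (insert (2 * l + 1) {2 * l + 2..<2 * r + 1}) \<rightarrow>\<^sub>E {..<m}.
      of_bool (v (2 * l) = b \<and> v (2 * r) = b') * word_entry N D x (colour_word f v l r) a a')"
    by (subst sum_PiE_insert, simp, subst sum_PiE_insert) auto
  also have "insert (2 * l) (insert (2 * l + 1) {2 * l + 2..<2 * r + 1}) = {2 * l..<2 * r + 1}"
    using lr by auto
  finally show ?case .
qed

lemma mat_trace_W_word:
  assumes "l \<le> r"
  shows "mat_trace (mat_word (N * m) (W N m D x) (map f [l..<r]))
    = (\<Sum>v\<in>{2 * l..<2 * r + 1} \<rightarrow>\<^sub>E {..<m}. of_bool (v (2 * l) = v (2 * r))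
         * word_trace N D x (colour_word f v l r))"
proof -
  let ?V = "{2 * l..<2 * r + 1} \<rightarrow>\<^sub>E {..<m}"
  have dim: "dim_row (mat_word (N * m) (W N m D x) (map f [l..<r])) = N * m"
    using carrier_matD(1)[OF mat_word_carrier[of "W N m D x" "N * m", OF W_carrier]] .
  have "mat_trace (mat_word (N * m) (W N m D x) (map f [l..<r]))
    = (\<Sum>a<N. \<Sum>b<m. \<Sum>v\<in>?V. if b = v (2 * l) then of_bool (v (2 * l) = v (2 * r))
         * word_entry N D x (colour_word f v l r) a a else 0)"
    unfolding mat_trace_def dim sum_nat_mult_split
  proof (intro sum.cong refl)
    fix a b assume ab: "a \<in> {..<N}" "b \<in> {..<m}"
    show "mat_word (N * m) (W N m D x) (map f [l..<r]) $$ (a * m + b, a * m + b)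
      = (\<Sum>v\<in>?V. if b = v (2 * l) then of_bool (v (2 * l) = v (2 * r))
         * word_entry N D x (colour_word f v l r) a a else 0)"
      using ab assms by (subst mat_word_W_entry) (auto intro!: sum.cong)
  qed
  also have "\<dots> = (\<Sum>a<N. \<Sum>v\<in>?V. \<Sum>b<m. if b = v (2 * l) then of_bool (v (2 * l) = v (2 * r))
         * word_entry N D x (colour_word f v l r) a a else 0)"
    by (intro sum.cong refl sum.swap)
  also have "\<dots> = (\<Sum>a<N. \<Sum>v\<in>?V. of_bool (v (2 * l) = v (2 * r)) * word_entry N D x (colour_word f v l r) a a)"
  proof (intro sum.cong refl)
    fix a v assume "v \<in> ?V"
    then have "v (2 * l) < m" using assms by (auto simp: PiE_iff)
    then show "(\<Sum>b<m. if b = v (2 * l) then of_bool (v (2 * l) = v (2 * r))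
         * word_entry N D x (colour_word f v l r) a a else 0)
       = of_bool (v (2 * l) = v (2 * r)) * word_entry N D x (colour_word f v l r) a a"
      by (simp add: sum.delta')
  qed
  also have "\<dots> = (\<Sum>v\<in>?V. of_bool (v (2 * l) = v (2 * r)) * word_trace N D x (colour_word f v l r))"
    by (subst sum.swap) (simp only: word_trace_def sum_distrib_left)
  finally show ?thesis .
qed

lemma orient_in: "b < m \<Longrightarrow> k < m \<Longrightarrow> orient g b k \<in> {..<m} \<times> {..<m}"
  by (cases g) auto

lemma colour_word_in:
  assumes "v \<in> {2 * l..<2 * r + 1} \<rightarrow>\<^sub>E {..<m}"
  shows "set (colour_word f v l r) \<subseteq> ({..<m} \<times> {..<m}) \<times> ({..<m} \<times> {..<m})"
proof -
  have v: "v x < m" if "2 * l \<le> x" "x \<le> 2 * r" for x using assms that by (auto simp: PiE_iff)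
  show ?thesis
  proof
    fix q assume "q \<in> set (colour_word f v l r)"
    then obtain i where i: "i \<in> {l..<r}" and q: "q = (row_colour f v i, col_colour f v i)"
      by auto
    show "q \<in> ({..<m} \<times> {..<m}) \<times> ({..<m} \<times> {..<m})"
      unfolding q using i by (intro SigmaI[of "row_colour f v i"] orient_in v) auto
  qed
qed

definition NC_moment :: "nat \<Rightarrow> real \<Rightarrow> nat \<Rightarrow> (nat \<Rightarrow> marginal) \<Rightarrow> real" where
  "NC_moment m c p f = (\<Sum>\<alpha>\<in>NC p. c ^ card \<alpha> / real m ^ alt p f (partition_perm \<alpha>))"

text \<open>For each partition the sum over \<open>v\<close> counts the compatible assignments, all
  of which close the trace. Every point without alternation contributes a factor \<open>m\<close>
  and the first row index one more, which gives the exponent \<open>p + 1 - alt\<close>.\<close>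

lemma planar_moment_colour_sum:
  assumes m: "m \<ge> 1" and p: "p \<ge> 1"
  shows "(\<Sum>v\<in>{2..<2 * p + 3} \<rightarrow>\<^sub>E {..<m}. of_bool (v 2 = v (2 * p + 2)) * planar_moment (of_real c) (colour_word f v 1 (p + 1)))
    = of_real (real m ^ (p + 1) * NC_moment m c p f)"
proof -
  let ?V = "{2 * 1..<2 * (p + 1) + 1} \<rightarrow>\<^sub>E {..<m}"
  let ?ok = "\<lambda>P v. \<forall>i\<in>{1..<p + 1}. row_colour f v i = col_colour f v (partition_perm P i)"
  have finV: "finite ?V" by (intro finite_PiE) auto
  have "(\<Sum>v\<in>?V. of_bool (v (2 * 1) = v (2 * (p + 1))) * planar_moment (of_real c) (colour_word f v 1 (p + 1)))
    = (\<Sum>v\<in>?V. \<Sum>P\<in>NC p. of_real c ^ card P * of_bool (?ok P v))"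
  proof (intro sum.cong refl)
    fix v assume "v \<in> ?V"
    have "of_bool (v (2 * 1) = v (2 * (p + 1))) * (of_real c ^ card P * of_bool (?ok P v))
        = (of_real c ^ card P * of_bool (?ok P v) :: complex)" if "P \<in> NC p" for P
    proof -
      interpret nc_interval_partition 1 "p + 1" P
        using that by unfold_locales (simp add: NC_eq_NC_interval)
      have "v (2 * 1) = v (2 * (p + 1))" if "?ok P v"
        using compatible_boundary[of f v] that by (simp only: compatible_def)
      then show ?thesis by auto
    qed
    then show "of_bool (v (2 * 1) = v (2 * (p + 1))) * planar_moment (of_real c) (colour_word f v 1 (p + 1))
      = (\<Sum>P\<in>NC p. of_real c ^ card P * of_bool (?ok P v) :: complex)"
      unfolding planar_moment_eq_sum_NC NC_eq_NC_interval[symmetric] sum_distrib_left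
      by (intro sum.cong refl)
  qed
  also have "\<dots> = (\<Sum>P\<in>NC p. \<Sum>v\<in>?V. of_real c ^ card P * of_bool (?ok P v))"
    by (rule sum.swap)
  also have "\<dots> = (\<Sum>P\<in>NC p. of_real (real m ^ (p + 1) * (c ^ card P / real m ^ alt p f (partition_perm P))))"
  proof (intro sum.cong refl)
    fix P assume "P \<in> NC p"
    then interpret nc_interval_partition 1 "p + 1" P
      by unfold_locales (simp add: NC_eq_NC_interval)
    let ?same = "{i \<in> {1..<p + 1}. f i = f (\<sigma> i)}"
    have "card ?same + alt p f \<sigma> = card (?same \<union> {a \<in> {1..p}. f a \<noteq> f (\<sigma> a)})"
      unfolding alt_def by (subst card_Un_disjoint) auto
    also have "?same \<union> {a \<in> {1..p}. f a \<noteq> f (\<sigma> a)} = {1..p}" by auto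
    finally have card: "p + 1 = Suc (card ?same) + alt p f \<sigma>" by simp
    have "(\<Sum>v\<in>?V. of_real c ^ card P * of_bool (?ok P v)) = of_real c ^ card P * (\<Sum>v\<in>?V. of_bool (compatible f v) :: complex)"
      by (simp only: compatible_def sum_distrib_left)
    also have "(\<Sum>v\<in>?V. of_bool (compatible f v) :: complex) = of_nat (card {v \<in> ?V. compatible f v})"
    proof -
      have "?V \<inter> {v. compatible f v} = {v \<in> ?V. compatible f v}" by blast
      then show ?thesis using finV by (simp only: sum_of_bool_eq)
    qed
    also have "card {v \<in> ?V. compatible f v} = m ^ Suc (card ?same)"
      using p by (intro card_compatible) simp
    also have "of_real c ^ card P * of_nat (m ^ Suc (card ?same))
       = (of_real (real m ^ (p + 1) * (c ^ card P / real m ^ alt p f \<sigma>)) :: complex)"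
    proof -
      have "real m ^ (p + 1) = real m ^ Suc (card ?same) * real m ^ alt p f \<sigma>"
        using arg_cong[OF card, of "\<lambda>n. real m ^ n"] by (simp only: power_add[of _ "Suc (card ?same)"])
      then show ?thesis using m by simp
    qed
    finally show "(\<Sum>v\<in>?V. of_real c ^ card P * of_bool (?ok P v))
       = (of_real (real m ^ (p + 1) * (c ^ card P / real m ^ alt p f \<sigma>)) :: complex)" .
  qed
  finally show ?thesis
    by (simp add: NC_moment_def sum_distrib_left eval_nat_numeral)
qed

section \<open>Reversal of words in Hermitian matrices\<close>

lemma W_hermitian:
  assumes "i < N * m" "j < N * m"
  shows "W N m D x l $$ (i, j) = cnj (W N m D x l $$ (j, i))"
  using assms by (cases l) (simp_all add: partial_trace_CD_def partial_trace_BD_def outer_def mult.commute)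

lemma mat_word_append:
  assumes "\<And>l. A l \<in> carrier_mat d d"
  shows "mat_word d A (u @ v) = mat_word d A u * mat_word d A v"
proof (induction u)
  case Nil
  then show ?case using mat_word_carrier[of A d v, OF assms] by (simp add: mat_word_def[of _ _ "[]"])
next
  case (Cons l u)
  then show ?case
    using assoc_mult_mat[OF assms mat_word_carrier[of A d u, OF assms] mat_word_carrier[of A d v, OF assms]]
    by (simp add: mat_word_Cons)
qed

lemma mat_word_rev_hermitian:
  assumes A: "\<And>l. A l \<in> carrier_mat d d" and herm: "\<And>l i j. i < d \<Longrightarrow> j < d \<Longrightarrow> A l $$ (i, j) = cnj (A l $$ (j, i))"
    and "i < d" "j < d"
  shows "mat_word d A (rev w) $$ (i, j) = cnj (mat_word d A w $$ (j, i))"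
  using assms(3,4)
proof (induction w arbitrary: i j)
  case Nil
  then show ?case by (auto simp: mat_word_def)
next
  case (Cons l w)
  have one: "mat_word d A [l] = A l"
    using right_mult_one_mat[OF A] by (simp add: mat_word_def)
  have "mat_word d A (rev (l # w)) $$ (i, j) = (mat_word d A (rev w) * A l) $$ (i, j)"
    by (simp only: rev.simps mat_word_append[OF A] one)
  also have "\<dots> = (\<Sum>q<d. cnj (mat_word d A w $$ (q, i)) * cnj (A l $$ (j, q)))"
    unfolding mult_mat_entry[OF mat_word_carrier[OF A] A Cons.prems]
    using Cons.prems by (intro sum.cong refl arg_cong2[where f = "(*)"] Cons.IH herm) auto
  also have "\<dots> = cnj (mat_word d A (l # w) $$ (j, i))"
    unfolding mat_word_Cons mult_mat_entry[OF A mat_word_carrier[OF A] Cons.prems(2,1)]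
    by (simp add: mult.commute)
  finally show ?case .
qed

text \<open>\<open>W_word\<close> multiplies from \<open>f p\<close> down to \<open>f 1\<close>,
  whereas the limits are computed in increasing order; taking adjoints translates between the
  two.\<close>

lemma mat_trace_W_word_rev:
  "mat_trace (mat_word (N * m) (W N m D x) (rev w)) = cnj (mat_trace (mat_word (N * m) (W N m D x) w))"
proof -
  have "dim_row (mat_word (N * m) (W N m D x) u) = N * m" for u
    using carrier_matD(1)[OF mat_word_carrier[of "W N m D x" "N * m", OF W_carrier]] .
  then show ?thesis
    unfolding mat_trace_def
    by (simp add: mat_word_rev_hermitian[OF W_carrier W_hermitian])
qed

text \<open>With \<open>m\<close> fixed, the trace is a sum over a finite set of index assignments
  that does not depend on \<open>N\<close>, so limits are taken term by term. A single trace with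
  \<open>p\<close> letters accounts for \<open>N^(p+1)\<close>, and dividing by
  \<open>m^(p+1)\<close> completes the power of \<open>m * N\<close>.\<close>

lemma expected_trace_limit:
  fixes M :: "nat \<Rightarrow> 'w measure"
  assumes m: "m \<ge> 1" and c: "c > 0" and D: "\<And>N. D N = nat \<lfloor>c * real N\<rfloor>"
    and tensor: "\<And>N. N \<ge> 1 \<Longrightarrow> gaussian_tensor (M N) N m (D N) (X N)"
    and p: "p \<ge> 1"
  shows "(\<lambda>N. (\<integral>\<omega>. mat_trace (mat_word (N * m) (W N m (D N) (\<lambda>i. X N i \<omega>)) (map f [1..<p + 1])) \<partial>M N)
      / of_nat (m * N) ^ (p + 1)) \<longlonglongrightarrow> of_real (NC_moment m c p f)"
proof -
  let ?V = "{2..<2 * p + 3} \<rightarrow>\<^sub>E {..<m}"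
  let ?w = "\<lambda>v. colour_word f v 1 (p + 1)"
  let ?E = "\<lambda>N v. gaussian_tensor.trace_moment (M N) N (D N) (X N) [?w v]"
  have V: "{2 * 1..<2 * (p + 1) + 1} = {2..<2 * p + 3}" by (simp add: eval_nat_numeral)
  have "(\<lambda>N. real (D N) / real N) \<longlonglongrightarrow> c"
  proof -
    have "(\<lambda>N. real (nat \<lfloor>c * real N\<rfloor>) / real N) \<longlonglongrightarrow> c"
      using c by real_asymp
    then show ?thesis by (simp add: D)
  qed
  then have "(\<lambda>N. complex_of_real (real (D N) / real N)) \<longlonglongrightarrow> of_real c"
    by (rule tendsto_of_real)
  then have Dlim: "(\<lambda>N. of_nat (D N) / of_nat N) \<longlonglongrightarrow> complex_of_real c"
    by simp
  have lim: "(\<lambda>N. ?E N v / of_nat N ^ (p + 1)) \<longlonglongrightarrow> planar_moment (of_real c) (?w v)" if v: "v \<in> ?V" for v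
  proof -
    have "set (?w v) \<subseteq> ({..<m} \<times> {..<m}) \<times> ({..<m} \<times> {..<m})"
      using v by (intro colour_word_in) (simp only: V)
    from trace_moment_limit[OF tensor Dlim, of "[?w v]"] this show ?thesis by (simp del: upt_Suc)
  qed
  have "(\<lambda>N. (\<Sum>v\<in>?V. of_bool (v 2 = v (2 * p + 2)) * (?E N v / of_nat N ^ (p + 1))) / of_nat (m ^ (p + 1)))
    \<longlonglongrightarrow> (\<Sum>v\<in>?V. of_bool (v 2 = v (2 * p + 2)) * planar_moment (of_real c) (?w v)) / of_nat (m ^ (p + 1))"
    using m by (intro tendsto_intros lim) auto
  also have "(\<Sum>v\<in>?V. of_bool (v 2 = v (2 * p + 2)) * planar_moment (of_real c) (?w v)) / of_nat (m ^ (p + 1))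
    = of_real (NC_moment m c p f)"
    using m by (simp only: planar_moment_colour_sum[OF m p]) simp
  finally have "(\<lambda>N. (\<Sum>v\<in>?V. of_bool (v 2 = v (2 * p + 2)) * (?E N v / of_nat N ^ (p + 1))) / of_nat (m ^ (p + 1)))
    \<longlonglongrightarrow> of_real (NC_moment m c p f)" .
  moreover have "eventually (\<lambda>N. (\<Sum>v\<in>?V. of_bool (v 2 = v (2 * p + 2)) * (?E N v / of_nat N ^ (p + 1))) / of_nat (m ^ (p + 1))
    = (\<integral>\<omega>. mat_trace (mat_word (N * m) (W N m (D N) (\<lambda>i. X N i \<omega>)) (map f [1..<p + 1])) \<partial>M N)
      / of_nat (m * N) ^ (p + 1)) sequentially"
    using eventually_ge_at_top[of 1]
  proof eventually_elim
    case (elim N)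
    interpret gaussian_tensor "M N" N m "D N" "X N" using tensor elim by blast
    have int: "integrable (M N) (tr (?w v))" if "v \<in> ?V" for v
    proof -
      have "set (?w v) \<subseteq> ({..<m} \<times> {..<m}) \<times> ({..<m} \<times> {..<m})"
        using that by (intro colour_word_in) (simp only: V)
      then show ?thesis using integrable_trace_product[of "[?w v]"] by (simp del: upt_Suc)
    qed
    have "mat_trace (mat_word (N * m) (W N m (D N) (\<lambda>i. X N i \<omega>)) (map f [1..<p + 1]))
      = (\<Sum>v\<in>?V. of_bool (v 2 = v (2 * p + 2)) * tr (?w v) \<omega>)" for \<omega>
      using mat_trace_W_word[of 1 "p + 1" N m "D N" "\<lambda>i. X N i \<omega>" f] unfolding V by (simp del: upt_Suc)
    then have "(\<integral>\<omega>. mat_trace (mat_word (N * m) (W N m (D N) (\<lambda>i. X N i \<omega>)) (map f [1..<p + 1])) \<partial>M N)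
      = (\<Sum>v\<in>?V. \<integral>\<omega>. of_bool (v 2 = v (2 * p + 2)) * tr (?w v) \<omega> \<partial>M N)"
      by (simp only:) (intro Bochner_Integration.integral_sum integrable_mult_right int)
    also have "\<dots> = (\<Sum>v\<in>?V. of_bool (v 2 = v (2 * p + 2)) * ?E N v)"
      by (simp add: trace_moment_def del: upt_Suc)
    finally show ?case
      by (simp only: times_divide_eq_right sum_divide_distrib[symmetric] divide_divide_eq_left of_nat_mult
          of_nat_power power_mult_distrib mult.commute)
  qed
  ultimately show ?thesis by (rule Lim_transform_eventually)
qed

section \<open>Free cumulants\<close>

definition poly_scale :: "complex \<Rightarrow> 'l nc_poly \<Rightarrow> 'l nc_poly" where
  "poly_scale c p = Poly_Mapping.single 0 c * p"

text \<open>Linear extension of prescribed word moments to the free algebra; the letters then have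
  exactly these joint moments.\<close>

definition poly_functional :: "('l list \<Rightarrow> complex) \<Rightarrow> 'l nc_poly \<Rightarrow> complex" where
  "poly_functional \<mu> p = (\<Sum>u\<in>Poly_Mapping.keys p. Poly_Mapping.lookup p u * \<mu> (letters u))"

definition poly_letter :: "'l \<Rightarrow> 'l nc_poly" where
  "poly_letter l = Poly_Mapping.single (Word [l]) 1"

lemma lookup_poly_scale: "Poly_Mapping.lookup (poly_scale c p) u = c * Poly_Mapping.lookup p u"
  by (simp add: poly_scale_def flip: mult_map_scale_conv_mult) (simp add: Poly_Mapping.map.rep_eq when_def)

lemma poly_functional_superset:
  assumes "finite S" "Poly_Mapping.keys p \<subseteq> S"
  shows "poly_functional \<mu> p = (\<Sum>u\<in>S. Poly_Mapping.lookup p u * \<mu> (letters u))"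
  unfolding poly_functional_def using assms
  by (intro sum.mono_neutral_left) (auto simp: in_keys_iff)

text \<open>The convolution product does not commute in general, but constants sit on the empty
  word, which commutes with every word.\<close>

lemma poly_scale_central: "p * Poly_Mapping.single 0 c = Poly_Mapping.single 0 c * p"
  for p :: "'l nc_poly"
proof (induction p rule: update_induct)
  case (update f a b)
  have "Poly_Mapping.update a b f = f + Poly_Mapping.single a b"
    using update.hyps(1)
    by (intro poly_mapping_eqI)
      (auto simp: lookup_update lookup_add lookup_single in_keys_iff when_def)
  with update.IH show ?case
    by (simp add: distrib_left distrib_right mult_single mult.commute)
qed simp

lemma nc_prob_space_nc_poly:
  assumes "\<mu> [] = 1"
  shows "nc_prob_space poly_scale (poly_functional \<mu>)"
proof
  show "poly_scale a (x + y) = poly_scale a x + poly_scale a y" for a and x y :: "'a nc_poly"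
    by (simp add: poly_scale_def distrib_left)
  show "poly_scale (a + b) x = poly_scale a x + poly_scale b x" for a b and x :: "'a nc_poly"
    by (simp add: poly_scale_def single_add distrib_right)
  show "poly_scale a (poly_scale b x) = poly_scale (a * b) x" for a b and x :: "'a nc_poly"
    by (simp add: poly_scale_def mult.assoc[symmetric] mult_single)
  show "poly_scale 1 x = x" for x :: "'a nc_poly"
    by (simp add: poly_scale_def)
  show "poly_scale c x * y = poly_scale c (x * y)" for c and x y :: "'a nc_poly"
    by (simp add: poly_scale_def mult.assoc)
  show "x * poly_scale c y = poly_scale c (x * y)" for c and x y :: "'a nc_poly"
    by (simp add: poly_scale_def mult.assoc[symmetric] poly_scale_central)
  show "poly_functional \<mu> (x + y) = poly_functional \<mu> x + poly_functional \<mu> y" for x y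
  proof -
    let ?S = "Poly_Mapping.keys x \<union> Poly_Mapping.keys y"
    have "Poly_Mapping.keys (x + y) \<subseteq> ?S" by (rule keys_add)
    then show ?thesis
      by (simp add: poly_functional_superset[of ?S] lookup_add distrib_right sum.distrib)
  qed
  show "poly_functional \<mu> (poly_scale c x) = c * poly_functional \<mu> x" for c x
  proof -
    have "Poly_Mapping.keys (poly_scale c x) \<subseteq> Poly_Mapping.keys x"
      by (auto simp: in_keys_iff lookup_poly_scale)
    then show ?thesis
      by (simp add: poly_functional_superset[of "Poly_Mapping.keys x"] lookup_poly_scale sum_distrib_left mult.assoc)
  qed
  show "poly_functional \<mu> 1 = 1"
    using assms by (simp add: poly_functional_def zero_free_monoid_def lookup_one)
qed

lemma prod_list_poly_letter: "prod_list (map poly_letter w) = Poly_Mapping.single (Word w) 1"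
proof (induction w)
  case Nil
  then show ?case by (simp add: zero_free_monoid_def[symmetric])
next
  case (Cons l w)
  then show ?case by (simp add: poly_letter_def mult_single plus_free_monoid_def)
qed

lemma poly_functional_word: "poly_functional \<mu> (prod_list (map poly_letter w)) = \<mu> w"
  by (simp add: prod_list_poly_letter poly_functional_def)

definition word_cumulant :: "nat \<Rightarrow> real \<Rightarrow> marginal list \<Rightarrow> complex" where
  "word_cumulant m c w = of_real (c / real m ^ alt (length w) (\<lambda>i. w ! (i - 1)) (cyc (length w)))"

text \<open>Defining moments from cumulants separates two tasks: the free cumulants follow by
  inverting the moment-cumulant formula, and convergence by comparison with
  \<open>NC_moment\<close>.\<close>

definition word_moment :: "nat \<Rightarrow> real \<Rightarrow> marginal list \<Rightarrow> complex" where
  "word_moment m c w = (\<Sum>P\<in>NC (length w). \<Prod>B\<in>P. word_cumulant m c (sublist_at w B))"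

lemma word_moment_Nil: "word_moment m c [] = 1"
proof -
  have "NC 0 = {{}}" by (auto simp: NC_def noncrossing_def partition_on_def)
  then show ?thesis by (simp add: word_moment_def)
qed

lemma card_nontrivial_block:
  assumes "P \<in> NC n - {{{1..n}}}" "B \<in> P"
  shows "card B < n" "B \<noteq> {}" "B \<subseteq> {1..n}"
proof -
  have part: "partition_on {1..n} P" using assms by (simp add: NC_def)
  show sub: "B \<subseteq> {1..n}" and "B \<noteq> {}"
    using part assms(2) by (auto simp: partition_on_def)
  have "B \<noteq> {1..n}"
  proof
    assume B: "B = {1..n}"
    have "C = B" if C: "C \<in> P" for C
    proof -
      obtain x where "x \<in> C" using partition_on_nonemptyE[OF part C] .
      then show ?thesis
        using partition_on_unique[OF part C assms(2)] partition_on_memD[OF part C] B by blast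
    qed
    then have "P = {B}" using assms(2) by blast
    then show False using assms(1) B by simp
  qed
  then have "card B < card {1..n}" using sub by (intro psubset_card_mono) auto
  then show "card B < n" by simp
qed

lemma sublist_at_full: "sublist_at xs {1..length xs} = xs"
  by (rule nth_equalityI) (auto simp: sublist_at_def atLeastLessThanSuc_atLeastAtMost[symmetric] simp del: upt_Suc)

lemma full_block_in_NC: "n \<ge> 1 \<Longrightarrow> {{1..n}} \<in> NC n"
  by (auto simp: NC_def noncrossing_def partition_on_def disjoint_def)

text \<open>The moment-cumulant formula determines the cumulants: once the one-block term is
  isolated, all remaining blocks are strictly shorter and fall under the induction
  hypothesis.\<close>

lemma free_cumulant_eq_word_cumulant:
  assumes "\<And>w. \<phi> (prod_list (map x w)) = word_moment m c w"
  shows "w \<noteq> [] \<Longrightarrow> free_cumulant \<phi> (map x w) = word_cumulant m c w"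
proof (induction "length w" arbitrary: w rule: less_induct)
  case less
  let ?n = "length w"
  have IH: "free_cumulant \<phi> (sublist_at (map x w) B) = word_cumulant m c (sublist_at w B)"
    if "P \<in> NC ?n - {{{1..?n}}}" "B \<in> P" for P B
  proof -
    note B = card_nontrivial_block[OF that]
    have fin: "finite B" using B(3) finite_subset by blast
    have len: "length (sublist_at w B) = card B" by (simp add: sublist_at_def)
    have "i - 1 < ?n" if "i \<in> B" for i using B(3) that by fastforce
    then have "sublist_at (map x w) B = map x (sublist_at w B)"
      using fin by (simp add: sublist_at_def)
    moreover have "sublist_at w B \<noteq> []" using len fin B(2) by force
    ultimately show ?thesis using less.hyps[of "sublist_at w B"] len B(1) by simp
  qed
  have mem: "{{1..?n}} \<in> NC ?n" using less.prems by (intro full_block_in_NC) (simp add: Suc_le_eq)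
  have "(\<Sum>P\<in>NC ?n - {{{1..?n}}}. \<Prod>B\<in>P. free_cumulant \<phi> (sublist_at (map x w) B))
      = (\<Sum>P\<in>NC ?n - {{{1..?n}}}. \<Prod>B\<in>P. word_cumulant m c (sublist_at w B))"
    by (intro sum.cong prod.cong refl IH)
  then have "free_cumulant \<phi> (map x w) = word_moment m c w
      - (\<Sum>P\<in>NC ?n - {{{1..?n}}}. \<Prod>B\<in>P. word_cumulant m c (sublist_at w B))"
    by (simp add: free_cumulant.simps[of \<phi> "map x w"] assms)
  also have "\<dots> = word_cumulant m c (sublist_at w {1..?n})"
    by (simp add: word_moment_def sum.remove[OF finite_NC mem])
  finally show ?case by (simp only: sublist_at_full)
qed

lemma nth_map_upt_1: "a \<in> {1..p} \<Longrightarrow> map f [1..<p + 1] ! (a - 1) = f a"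
  using nth_map_upt[of "a - 1" "p + 1" 1 f] by auto

lemma word_cumulant_map:
  "word_cumulant m c (map f [1..<p + 1]) = of_real (c / real m ^ alt p f (cyc p))"
proof -
  have "cyc p a \<in> {1..p}" if "a \<in> {1..p}" for a
    using that by (auto simp: cyc_def)
  then have "alt p (\<lambda>i. map f [1..<p + 1] ! (i - 1)) (cyc p) = alt p f (cyc p)"
    unfolding alt_def by (intro arg_cong[where f = card] Collect_cong conj_cong refl) (simp only: nth_map_upt_1)
  then show ?thesis by (simp add: word_cumulant_def del: upt_Suc)
qed

context nc_interval_partition
begin

text \<open>\<open>cyc\<close> walks up the sorted block while \<open>\<sigma>\<close> walks down.
  Sending a position \<open>a\<close> to the element after it, cyclically, matches the two counts,
  since \<open>\<sigma>\<close> takes this element back to the one at position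
  \<open>a\<close>.\<close>

lemma alt_block:
  assumes B: "B \<in> P"
  shows "alt (card B) (\<lambda>a. f (sorted_list_of_set B ! (a - 1))) (cyc (card B)) = card {i \<in> B. f i \<noteq> f (\<sigma> i)}"
proof -
  let ?bs = "sorted_list_of_set B" and ?q = "card B"
  have fin: "finite B" and ne: "B \<noteq> {}" using block_finite block_nonempty B by auto
  have set: "set ?bs = B" and len: "length ?bs = ?q" and sorted: "sorted_wrt (<) ?bs"
    using fin by auto
  have q: "?q \<ge> 1" using fin ne by (simp add: Suc_le_eq card_gt_0_iff)
  have lt: "?bs ! i < ?bs ! j \<longleftrightarrow> i < j" if "i < ?q" "j < ?q" for i j
    using sorted_wrt_nth_less[OF sorted] that len by (metis linorder_neqE_nat order.asym less_irrefl)
  have mem: "?bs ! i \<in> B" if "i < ?q" for i using set len that nth_mem by metis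
  have ex: "\<exists>j<?q. x = ?bs ! j" if "x \<in> B" for x using that set len by (metis in_set_conv_nth)
  have min: "Min B = ?bs ! 0"
  proof (rule Min_eqI[OF fin])
    fix x assume "x \<in> B"
    then obtain j where "j < ?q" "x = ?bs ! j" using ex by blast
    then show "?bs ! 0 \<le> x" using lt[of 0 j] q by (cases "j = 0") auto
  qed (use mem q in auto)
  have max: "Max B = ?bs ! (?q - 1)"
  proof (rule Max_eqI[OF fin])
    fix x assume "x \<in> B"
    then obtain j where "j < ?q" "x = ?bs ! j" using ex by blast
    then show "x \<le> ?bs ! (?q - 1)" using lt[of j "?q - 1"] q by (cases "j = ?q - 1") auto
  qed (use mem q in auto)
  have perm: "\<sigma> (?bs ! (cyc ?q a - 1)) = ?bs ! (a - 1)" if a: "a \<in> {1..?q}" for a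
  proof (cases "a = ?q")
    case True
    then show ?thesis using perm_Min[OF B] min max by (simp add: cyc_def)
  next
    case False
    then have aq: "a < ?q" "1 \<le> a" using a by auto
    have ne: "?bs ! a \<noteq> Min B" using lt[of 0 a] aq min by auto
    note pred = perm_pred[OF B mem[OF aq(1)] ne]
    obtain j where j: "j < ?q" "\<sigma> (?bs ! a) = ?bs ! j" using ex[OF pred(1)] by blast
    have "j < a" using pred(2) j lt[OF j(1) aq(1)] by simp
    moreover have "?bs ! (a - 1) \<le> ?bs ! j"
      using pred(3)[OF mem[of "a - 1"]] lt[of "a - 1" a] aq j by simp
    then have "\<not> j < a - 1" using lt[of j "a - 1"] j(1) aq by auto
    ultimately have "j = a - 1" by simp
    then show ?thesis using j False by (simp add: cyc_def)
  qed
  have bij: "bij_betw (\<lambda>a. ?bs ! (cyc ?q a - 1)) {1..?q} B"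
  proof (rule bij_betw_imageI)
    show "inj_on (\<lambda>a. ?bs ! (cyc ?q a - 1)) {1..?q}"
    proof (rule inj_onI)
      fix a b assume ab: "a \<in> {1..?q}" "b \<in> {1..?q}" "?bs ! (cyc ?q a - 1) = ?bs ! (cyc ?q b - 1)"
      have "cyc ?q a - 1 < ?q" "cyc ?q b - 1 < ?q" using ab q by (auto simp: cyc_def)
      then have "cyc ?q a - 1 = cyc ?q b - 1"
        using ab(3) lt by (metis linorder_neqE_nat less_irrefl)
      then show "a = b" using ab(1,2) by (auto simp: cyc_def split: if_splits)
    qed
    show "(\<lambda>a. ?bs ! (cyc ?q a - 1)) ` {1..?q} = B"
    proof (intro equalityI subsetI)
      fix x assume "x \<in> (\<lambda>a. ?bs ! (cyc ?q a - 1)) ` {1..?q}"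
      then obtain a where a: "a \<in> {1..?q}" "x = ?bs ! (cyc ?q a - 1)" by blast
      have "cyc ?q a - 1 < ?q" using a q by (auto simp: cyc_def)
      then show "x \<in> B" using mem a by simp
    next
      fix x assume "x \<in> B"
      then obtain j where j: "j < ?q" "x = ?bs ! j" using ex by blast
      then have "x = ?bs ! (cyc ?q (if j = 0 then ?q else j) - 1)" "(if j = 0 then ?q else j) \<in> {1..?q}"
        using q by (auto simp: cyc_def)
      then show "x \<in> (\<lambda>a. ?bs ! (cyc ?q a - 1)) ` {1..?q}" by (rule image_eqI)
    qed
  qed
  have "bij_betw (\<lambda>a. ?bs ! (cyc ?q a - 1))
      {a \<in> {1..?q}. f (?bs ! (a - 1)) \<noteq> f (?bs ! (cyc ?q a - 1))} {i \<in> B. f i \<noteq> f (\<sigma> i)}"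
  proof (rule bij_betw_subset[OF bij])
    let ?g = "\<lambda>a. ?bs ! (cyc ?q a - 1)"
    have img: "?g ` {1..?q} = B" using bij by (rule bij_betw_imp_surj_on)
    have iff: "f (?bs ! (a - 1)) \<noteq> f (?g a) \<longleftrightarrow> f (?g a) \<noteq> f (\<sigma> (?g a))" if "a \<in> {1..?q}" for a
      unfolding perm[OF that] by auto
    show "?g ` {a \<in> {1..?q}. f (?bs ! (a - 1)) \<noteq> f (?g a)} = {i \<in> B. f i \<noteq> f (\<sigma> i)}"
    proof (intro equalityI subsetI)
      fix i assume "i \<in> ?g ` {a \<in> {1..?q}. f (?bs ! (a - 1)) \<noteq> f (?g a)}"
      then obtain a where a: "a \<in> {1..?q}" "f (?bs ! (a - 1)) \<noteq> f (?g a)" "i = ?g a" by blast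
      have "?g a \<in> B" using img a(1) by blast
      then show "i \<in> {i \<in> B. f i \<noteq> f (\<sigma> i)}" using iff[OF a(1)] a(2,3) by simp
    next
      fix i assume i: "i \<in> {i \<in> B. f i \<noteq> f (\<sigma> i)}"
      then have "i \<in> ?g ` {1..?q}" unfolding img by simp
      then obtain a where a: "a \<in> {1..?q}" "i = ?g a" by blast
      then have "f (?bs ! (a - 1)) \<noteq> f (?g a)" using iff[OF a(1)] i by simp
      with a show "i \<in> ?g ` {a \<in> {1..?q}. f (?bs ! (a - 1)) \<noteq> f (?g a)}" by blast
    qed
  qed blast
  then show ?thesis unfolding alt_def by (rule bij_betw_same_card)
qed

end

text \<open>The alternations along \<open>\<alpha>\<close> are the sum over its blocks of their
  cyclic alternations, so the product of block cumulants is a single power of \<open>m\<close> times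
  \<open>c ^ card \<alpha>\<close>.\<close>

lemma word_moment_map: "word_moment m c (map f [1..<p + 1]) = of_real (NC_moment m c p f)"
proof -
  let ?w = "map f [1..<p + 1]"
  have "(\<Prod>B\<in>P. word_cumulant m c (sublist_at ?w B)) = of_real (c ^ card P / real m ^ alt p f (partition_perm P))"
    if P: "P \<in> NC p" for P
  proof -
    interpret nc_interval_partition 1 "p + 1" P
      using P by unfold_locales (simp add: NC_eq_NC_interval)
    let ?a = "\<lambda>B. card {i \<in> B. f i \<noteq> f (\<sigma> i)}"
    have K: "word_cumulant m c (sublist_at ?w B) = of_real (c / real m ^ ?a B)" if B: "B \<in> P" for B
    proof -
      have "map f [1..<p + 1] ! (i - 1) = f i" if "i \<in> B" for i
        using subsetD[OF block_subset[OF B] that] by (intro nth_map_upt_1) auto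
      then have "sublist_at ?w B = map f (sorted_list_of_set B)"
        using block_finite[OF B] by (simp add: sublist_at_def del: upt_Suc)
      moreover have "alt (card B) (\<lambda>i. map f (sorted_list_of_set B) ! (i - 1)) (cyc (card B)) = ?a B"
      proof -
        have "a - 1 < card B \<and> cyc (card B) a - 1 < card B" if "a \<in> {1..card B}" for a
          using that by (auto simp: cyc_def)
        then have "alt (card B) (\<lambda>i. map f (sorted_list_of_set B) ! (i - 1)) (cyc (card B))
          = alt (card B) (\<lambda>i. f (sorted_list_of_set B ! (i - 1))) (cyc (card B))"
          unfolding alt_def by (intro arg_cong[where f = card] Collect_cong conj_cong refl) simp
        then show ?thesis by (simp only: alt_block[OF B])
      qed
      ultimately show ?thesis by (simp add: word_cumulant_def)
    qed
    have fin: "finite P" using finite_elements[OF _ part] by simp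
    have "(\<Sum>B\<in>P. ?a B) = card (\<Union>B\<in>P. {i \<in> B. f i \<noteq> f (\<sigma> i)})"
    proof (rule card_UN_disjoint[symmetric, OF fin])
      show "\<forall>B\<in>P. finite {i \<in> B. f i \<noteq> f (\<sigma> i)}" using block_finite by simp
      show "\<forall>B\<in>P. \<forall>C\<in>P. B \<noteq> C \<longrightarrow> {i \<in> B. f i \<noteq> f (\<sigma> i)} \<inter> {i \<in> C. f i \<noteq> f (\<sigma> i)} = {}"
      proof (intro ballI impI)
        fix B C assume "B \<in> P" "C \<in> P" "B \<noteq> C"
        then have "B \<inter> C = {}" using part by (simp add: partition_on_def disjoint_def)
        then show "{i \<in> B. f i \<noteq> f (\<sigma> i)} \<inter> {i \<in> C. f i \<noteq> f (\<sigma> i)} = {}" by blast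
      qed
    qed
    also have "(\<Union>B\<in>P. {i \<in> B. f i \<noteq> f (\<sigma> i)}) = {i \<in> {1..p}. f i \<noteq> f (\<sigma> i)}"
    proof -
      have "\<Union>P = {1..p}" using P by (simp add: NC_def partition_on_def)
      then show ?thesis by blast
    qed
    finally have sum: "(\<Sum>B\<in>P. ?a B) = alt p f \<sigma>" by (simp add: alt_def)
    have "(\<Prod>B\<in>P. word_cumulant m c (sublist_at ?w B)) = of_real (\<Prod>B\<in>P. c / real m ^ ?a B)"
      unfolding of_real_prod by (intro prod.cong refl K)
    also have "(\<Prod>B\<in>P. c / real m ^ ?a B) = c ^ card P / real m ^ alt p f \<sigma>"
      by (simp add: prod_dividef power_sum[symmetric] sum)
    finally show ?thesis .
  qed
  then show ?thesis
    by (simp add: word_moment_def NC_moment_def del: upt_Suc)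
qed

text \<open>Asymptotic equivalence is read off a quotient and requires a nonzero limit; the
  one-block partition makes the sum of positive terms nonempty.\<close>

lemma NC_moment_pos:
  assumes "m \<ge> 1" "c > 0" "p \<ge> 1"
  shows "NC_moment m c p f > 0"
  unfolding NC_moment_def using assms full_block_in_NC[OF assms(3)]
  by (intro sum_pos finite_NC) auto

lemma mat_word_smult:
  assumes A: "\<And>l. A l \<in> carrier_mat d d"
  shows "mat_word d (\<lambda>l. k \<cdot>\<^sub>m A l) w = k ^ length w \<cdot>\<^sub>m mat_word d A w"
proof (induction w)
  case Nil
  then show ?case by (auto simp: mat_word_def)
next
  case (Cons l w)
  note w = mat_word_carrier[of A d w, OF A]
  have "k \<cdot>\<^sub>m A l * (k ^ length w \<cdot>\<^sub>m mat_word d A w) = k \<cdot>\<^sub>m (A l * (k ^ length w \<cdot>\<^sub>m mat_word d A w))"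
    by (rule mult_smult_assoc_mat[OF A smult_carrier_mat[OF w]])
  also have "A l * (k ^ length w \<cdot>\<^sub>m mat_word d A w) = k ^ length w \<cdot>\<^sub>m (A l * mat_word d A w)"
    by (rule mult_smult_distrib[OF A w])
  also have "k \<cdot>\<^sub>m (k ^ length w \<cdot>\<^sub>m (A l * mat_word d A w)) = k ^ length (l # w) \<cdot>\<^sub>m (A l * mat_word d A w)"
    by (rule eq_matI) auto
  finally show ?case
    using Cons.IH by (simp only: mat_word_Cons)
qed

lemma mat_trace_smult: "A \<in> carrier_mat d d \<Longrightarrow> mat_trace (k \<cdot>\<^sub>m A) = k * mat_trace A"
  by (auto simp: mat_trace_def sum_distrib_left)

theorem theorem3p16:
  fixes m :: nat and c :: real
    and M :: "nat \<Rightarrow> 'w measure"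
    and X :: "nat \<Rightarrow> tensor_index \<Rightarrow> 'w \<Rightarrow> complex"
    and D :: "nat \<Rightarrow> nat"
    and WX :: "nat \<Rightarrow> marginal \<Rightarrow> 'w \<Rightarrow> complex mat"
  assumes m: "m \<ge> 1" and c: "c > 0"
    and D: "\<And>N. D N = nat \<lfloor>c * real N\<rfloor>"
    and prob: "\<And>N. N \<ge> 1 \<Longrightarrow> prob_space (M N)"
    and gauss: "\<And>N. N \<ge> 1 \<Longrightarrow>
                  iid_standard_complex_gaussian (M N) (tensor_indices N m (D N)) (X N)"
    and WX: "\<And>N l \<omega>. WX N l \<omega> = W N m (D N) (\<lambda>i. X N i \<omega>) l"
  shows
    "(\<exists>(scale :: complex \<Rightarrow> marginal nc_poly \<Rightarrow> marginal nc_poly) \<phi> (x :: marginal \<Rightarrow> marginal nc_poly).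
        nc_prob_space scale \<phi> \<and>
        converges_in_distribution M (\<lambda>N. m * N)
          (\<lambda>N l \<omega>. (1 / of_nat (m * N)) \<cdot>\<^sub>m WX N l \<omega>) \<phi> x \<and>
        (\<forall>p\<ge>1. \<forall>f :: nat \<Rightarrow> marginal.
           free_cumulant \<phi> (map (\<lambda>i. x (f i)) [1..<p + 1])
             = of_real (c / real m ^ alt p f (cyc p))))
     \<and>
     (\<forall>p\<ge>1. \<forall>f :: nat \<Rightarrow> marginal.
        (\<lambda>N. \<integral>\<omega>. mat_trace (W_word N m (D N) (\<lambda>i. X N i \<omega>) p f) \<partial>M N)
          \<sim>[sequentially]
        (\<lambda>N. of_real (real (m * N) ^ (p + 1)
               * (\<Sum>\<alpha>\<in>NC p. c ^ card \<alpha> / real m ^ alt p f (partition_perm \<alpha>)))))"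
proof -
  have tensor: "gaussian_tensor (M N) N m (D N) (X N)" if "N \<ge> 1" for N
    using prob[OF that] gauss[OF that]
    by (simp add: gaussian_tensor_def complex_gaussian_family_def complex_gaussian_family_axioms_def tensor_indices_def)
  note limit = expected_trace_limit[OF m c D tensor]
  let ?\<phi> = "poly_functional (word_moment m c)"
  let ?T = "\<lambda>N w \<omega>. mat_trace (mat_word (N * m) (W N m (D N) (\<lambda>i. X N i \<omega>)) w)"
  have "nc_prob_space poly_scale ?\<phi>"
    by (rule nc_prob_space_nc_poly[of "word_moment m c", OF word_moment_Nil])
  moreover have "converges_in_distribution M (\<lambda>N. m * N)
          (\<lambda>N l \<omega>. (1 / of_nat (m * N)) \<cdot>\<^sub>m WX N l \<omega>) ?\<phi> poly_letter"
    unfolding converges_in_distribution_def poly_functional_word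
  proof
    fix w :: "marginal list"
    let ?E = "\<lambda>N. \<integral>\<omega>. mat_trace (mat_word (m * N) (\<lambda>l. (1 / of_nat (m * N)) \<cdot>\<^sub>m WX N l \<omega>) w) / of_nat (m * N) \<partial>M N"
    \<comment> \<open>Rescaling gives one factor \<open>1 / (m * N)\<close> per letter, and the
      normalised trace gives one more.\<close>
    have eq: "?E N = (\<integral>\<omega>. ?T N w \<omega> \<partial>M N) / of_nat (m * N) ^ (length w + 1)" for N
    proof -
      have "mat_trace (mat_word (m * N) (\<lambda>l. (1 / of_nat (m * N)) \<cdot>\<^sub>m WX N l \<omega>) w) / of_nat (m * N)
          = ?T N w \<omega> / of_nat (m * N) ^ (length w + 1)" for \<omega>
        unfolding WX mult.commute[of m N]
        by (simp only: mat_word_smult[OF W_carrier] mat_trace_smult[OF mat_word_carrier[OF W_carrier]])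
          (simp add: power_divide)
      then show ?thesis by simp
    qed
    show "?E \<longlonglongrightarrow> word_moment m c w"
    proof (cases "w = []")
      case True
      \<comment> \<open>The value 1 is claimed only from \<open>N = 1\<close> on: for
        \<open>N = 0\<close> the normalised trace is 0.\<close>
      have "eventually (\<lambda>N. ?E N = 1) sequentially"
        using eventually_ge_at_top[of 1]
      proof eventually_elim
        case (elim N)
        interpret prob_space "M N" using prob elim by blast
        have "?T N [] \<omega> = of_nat (m * N)" for \<omega>
          by (simp add: mat_word_def mat_trace_def)
        then show ?case unfolding eq using True m elim by (simp add: prob_space)
      qed
      then show ?thesis by (simp add: True word_moment_Nil tendsto_eventually)
    next
      case False
      define f where "f i = w ! (i - 1)" for i
      have w: "w = map f [1..<length w + 1]"
        by (rule nth_equalityI) (simp_all add: f_def del: upt_Suc)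
      have "length w \<ge> 1" using False by (simp add: Suc_le_eq)
      from limit[OF _ this, of f] show ?thesis
        unfolding eq using w word_moment_map[of m c f "length w"] by simp
    qed
  qed
  moreover have "free_cumulant ?\<phi> (map (\<lambda>i. poly_letter (f i)) [1..<p + 1])
             = of_real (c / real m ^ alt p f (cyc p))" if "p \<ge> 1" for p f
    using free_cumulant_eq_word_cumulant[of ?\<phi> poly_letter m c "map f [1..<p + 1]", OF poly_functional_word]
      word_cumulant_map[of m c f p] that by (simp add: comp_def del: upt_Suc)
  moreover have "(\<lambda>N. \<integral>\<omega>. mat_trace (W_word N m (D N) (\<lambda>i. X N i \<omega>) p f) \<partial>M N)
          \<sim>[sequentially] (\<lambda>N. of_real (real (m * N) ^ (p + 1) * NC_moment m c p f))" if p: "p \<ge> 1" for p f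
  proof (rule asymp_equivI')
    let ?Z = "complex_of_real (NC_moment m c p f)"
    have Z: "?Z \<noteq> 0" using NC_moment_pos[OF m c p, of f] by simp
    \<comment> \<open>The conjugate accounts for the reversed order in \<open>W_word\<close>; as
      \<open>?Z\<close> is real, the quotient tends to 1.\<close>
    have "(\<lambda>N. cnj ((\<integral>\<omega>. ?T N (map f [1..<p + 1]) \<omega> \<partial>M N) / of_nat (m * N) ^ (p + 1)) / ?Z) \<longlonglongrightarrow> cnj ?Z / ?Z"
      by (intro tendsto_divide tendsto_cnj limit p tendsto_const Z)
    moreover have "(\<integral>\<omega>. mat_trace (W_word N m (D N) (\<lambda>i. X N i \<omega>) p f) \<partial>M N)
        = cnj (\<integral>\<omega>. ?T N (map f [1..<p + 1]) \<omega> \<partial>M N)" for N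
      by (simp only: W_word_def mat_trace_W_word_rev Bochner_Integration.integral_cnj)
    ultimately show "(\<lambda>N. (\<integral>\<omega>. mat_trace (W_word N m (D N) (\<lambda>i. X N i \<omega>) p f) \<partial>M N)
        / of_real (real (m * N) ^ (p + 1) * NC_moment m c p f)) \<longlonglongrightarrow> 1"
      using Z by (simp del: upt_Suc)
  qed
  ultimately show ?thesis
    unfolding NC_moment_def by blast
qed

end
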